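(* Let $A \in \mathbb{R}^{n \times d}$, let $p \in [1,\infty)$ with $p \ne 2$ be fixed, and fix a constant $\gamma \in (0,1)$. Then there exists a one-pass deterministic algorithm, in both the streaming and the distributed summary models of computation, which constructs a $(1/d^{O(1/\gamma)}, 1)$ relative error $\ell_p$-subspace embedding for the column space of $A$, with $O(n^{\gamma} d^2 + n^{\gamma} d^5 \log n^{\gamma})$ update time and $O(n^{\gamma} d)$ space.
   Context: For $p\ge 1$, $\|v\|_p$ is the usual $\ell_p$ norm of a vector. A matrix $T$ (with $d$ columns) is a relative error $(c_1,c_2)$-$\ell_p$ subspace embedding for the column space of $A \in \mathbb{R}^{n\times d}$ if for all $x \in \mathbb{R}^d$, $c_1\|Ax\|_p \le \|Tx\|_p \le c_2 \|Ax\|_p$. Streaming model: the rows of $A$ arrive one by one and only a sublinear number of rows may be stored at any time; the stored rows are repeatedly summarized. Distributed summary model: $A$ is partitioned into blocks of at most $n^\gamma$ rows held at leaves of a computation tree; each node computes a summary of its input, parents merge the summaries of their children and reduce them, until a single summary of bounded size is obtained at the root. Update time is the time to compute a local summary.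
   Formalization: The formal theorem assumes 1 ≤ d ≤ n^γ; without a bound of this kind the claim fails, since for a rank-d matrix the embedding needs at least d rows of d entries, i.e. d² cells, which exceeds O(n^γ d) space when d is much larger than n^γ. *)

theory Defs
  imports
    Complex_Main
    "HOL-Library.Monad_Syntax"
    "Jordan_Normal_Form.Matrix"
begin

section \<open>Relative error subspace embeddings\<close>

definition lp_norm :: "real \<Rightarrow> real vec \<Rightarrow> real" where
  "lp_norm p v = (\<Sum>i<dim_vec v. \<bar>v $ i\<bar> powr p) powr (1 / p)"

definition subspace_embedding :: "real \<Rightarrow> real \<Rightarrow> real \<Rightarrow> real mat \<Rightarrow> real mat \<Rightarrow> bool" where
  "subspace_embedding p c1 c2 A T \<longleftrightarrow>
     dim_col T = dim_col A \<and>
     (\<forall>x \<in> carrier_vec (dim_col A).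
        c1 * lp_norm p (A *\<^sub>v x) \<le> lp_norm p (T *\<^sub>v x) \<and>
        lp_norm p (T *\<^sub>v x) \<le> c2 * lp_norm p (A *\<^sub>v x))"

section \<open>A real RAM\<close>

text \<open>
  Programs are written in a small deterministic while language over a random access machine. The
  machine has index registers holding natural numbers and a memory of cells holding exact reals;
  cells are addressed by index expressions. The arithmetic operations, comparisons, memory accesses
  and powers \<open>\<bar>x\<bar>\<^sup>c\<close> with a fixed exponent each take one time unit. There is no rounding
  operation from reals to indices.

  A run is subject to a memory limit \<open>S\<close> (only cells with address below \<open>S\<close> may be accessed)
  and a word limit \<open>W\<close> (no index expression may evaluate to a number above \<open>W\<close>). A program is a
  finite syntactic object, so it uses a fixed number of index registers, independent of the input;
  it may contain real constants, as in the Blum-Shub-Smale model. Violating a limit, or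
  dividing by zero, makes evaluation undefined (\<open>None\<close>), and the run is stuck.
\<close>

record state =
  regs :: "nat \<Rightarrow> nat"
  mem :: "nat \<Rightarrow> real"

datatype iexp =
    IConst nat
  | IReg nat
  | IAdd iexp iexp
  | ISub iexp iexp
  | IMul iexp iexp
  | IDiv iexp iexp

datatype rexp =
    RConst real
  | RIndex iexp
  | RCell iexp
  | RAdd rexp rexp
  | RSub rexp rexp
  | RMul rexp rexp
  | RDiv rexp rexp
  | RPow rexp real

datatype bexp =
    BILess iexp iexp
  | BRLess rexp rexp
  | BNot bexp
  | BAnd bexp bexp

datatype com =
    Skip
  | ISet nat iexp
  | RStore iexp rexp
  | Seq com com
  | Cond bexp com com
  | While bexp com

definition word :: "nat \<Rightarrow> nat \<Rightarrow> nat option" where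
  "word W v = (if v \<le> W then Some v else None)"

primrec ieval :: "nat \<Rightarrow> state \<Rightarrow> iexp \<Rightarrow> nat option" where
  "ieval W s (IConst k) = word W k"
| "ieval W s (IReg r) = word W (regs s r)"
| "ieval W s (IAdd e f) = do { a \<leftarrow> ieval W s e; b \<leftarrow> ieval W s f; word W (a + b) }"
| "ieval W s (ISub e f) = do { a \<leftarrow> ieval W s e; b \<leftarrow> ieval W s f; word W (a - b) }"
| "ieval W s (IMul e f) = do { a \<leftarrow> ieval W s e; b \<leftarrow> ieval W s f; word W (a * b) }"
| "ieval W s (IDiv e f) = do { a \<leftarrow> ieval W s e; b \<leftarrow> ieval W s f;
     if b = 0 then None else word W (a div b) }"

primrec reval :: "nat \<Rightarrow> nat \<Rightarrow> state \<Rightarrow> rexp \<Rightarrow> real option" where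
  "reval S W s (RConst c) = Some c"
| "reval S W s (RIndex e) = map_option real (ieval W s e)"
| "reval S W s (RCell e) = do { a \<leftarrow> ieval W s e; if a < S then Some (mem s a) else None }"
| "reval S W s (RAdd e f) = do { a \<leftarrow> reval S W s e; b \<leftarrow> reval S W s f; Some (a + b) }"
| "reval S W s (RSub e f) = do { a \<leftarrow> reval S W s e; b \<leftarrow> reval S W s f; Some (a - b) }"
| "reval S W s (RMul e f) = do { a \<leftarrow> reval S W s e; b \<leftarrow> reval S W s f; Some (a * b) }"
| "reval S W s (RDiv e f) = do { a \<leftarrow> reval S W s e; b \<leftarrow> reval S W s f;
     if b = 0 then None else Some (a / b) }"
| "reval S W s (RPow e c) = map_option (\<lambda>a. \<bar>a\<bar> powr c) (reval S W s e)"

primrec beval :: "nat \<Rightarrow> nat \<Rightarrow> state \<Rightarrow> bexp \<Rightarrow> bool option" where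
  "beval S W s (BILess e f) = do { a \<leftarrow> ieval W s e; b \<leftarrow> ieval W s f; Some (a < b) }"
| "beval S W s (BRLess e f) = do { a \<leftarrow> reval S W s e; b \<leftarrow> reval S W s f; Some (a < b) }"
| "beval S W s (BNot e) = map_option Not (beval S W s e)"
| "beval S W s (BAnd e f) = do { a \<leftarrow> beval S W s e; b \<leftarrow> beval S W s f; Some (a \<and> b) }"

primrec icost :: "iexp \<Rightarrow> nat" where
  "icost (IConst k) = 1"
| "icost (IReg r) = 1"
| "icost (IAdd e f) = 1 + icost e + icost f"
| "icost (ISub e f) = 1 + icost e + icost f"
| "icost (IMul e f) = 1 + icost e + icost f"
| "icost (IDiv e f) = 1 + icost e + icost f"

primrec rcost :: "rexp \<Rightarrow> nat" where
  "rcost (RConst c) = 1"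
| "rcost (RIndex e) = 1 + icost e"
| "rcost (RCell e) = 1 + icost e"
| "rcost (RAdd e f) = 1 + rcost e + rcost f"
| "rcost (RSub e f) = 1 + rcost e + rcost f"
| "rcost (RMul e f) = 1 + rcost e + rcost f"
| "rcost (RDiv e f) = 1 + rcost e + rcost f"
| "rcost (RPow e c) = 1 + rcost e"

primrec bcost :: "bexp \<Rightarrow> nat" where
  "bcost (BILess e f) = 1 + icost e + icost f"
| "bcost (BRLess e f) = 1 + rcost e + rcost f"
| "bcost (BNot e) = 1 + bcost e"
| "bcost (BAnd e f) = 1 + bcost e + bcost f"

text \<open>
  \<open>exec S W c s t s'\<close>: started in \<open>s\<close>, program \<open>c\<close> respects the limits \<open>S\<close> and \<open>W\<close> and halts in
  \<open>s'\<close> after exactly \<open>t\<close> time units.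
\<close>

inductive exec :: "nat \<Rightarrow> nat \<Rightarrow> com \<Rightarrow> state \<Rightarrow> nat \<Rightarrow> state \<Rightarrow> bool" for S W where
  Skip: "exec S W Skip s 1 s"
| ISet: "ieval W s e = Some v \<Longrightarrow>
    exec S W (ISet r e) s (1 + icost e) (s\<lparr>regs := (regs s)(r := v)\<rparr>)"
| RStore: "ieval W s e = Some a \<Longrightarrow> a < S \<Longrightarrow> reval S W s f = Some v \<Longrightarrow>
    exec S W (RStore e f) s (1 + icost e + rcost f) (s\<lparr>mem := (mem s)(a := v)\<rparr>)"
| Seq: "exec S W c s t s' \<Longrightarrow> exec S W c' s' t' s'' \<Longrightarrow> exec S W (Seq c c') s (t + t') s''"
| CondTrue: "beval S W s b = Some True \<Longrightarrow> exec S W c s t s' \<Longrightarrow>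
    exec S W (Cond b c c') s (1 + bcost b + t) s'"
| CondFalse: "beval S W s b = Some False \<Longrightarrow> exec S W c' s t s' \<Longrightarrow>
    exec S W (Cond b c c') s (1 + bcost b + t) s'"
| WhileFalse: "beval S W s b = Some False \<Longrightarrow> exec S W (While b c) s (1 + bcost b) s"
| WhileTrue: "beval S W s b = Some True \<Longrightarrow> exec S W c s t s' \<Longrightarrow> exec S W (While b c) s' t' s'' \<Longrightarrow>
    exec S W (While b c) s (1 + bcost b + t + t') s''"

lemma exec_deterministic:
  "exec S W c s t s' \<Longrightarrow> exec S W c s u s'' \<Longrightarrow> t = u \<and> s' = s''"
proof (induction arbitrary: u s'' rule: exec.induct)
  case (Skip s)
  from Skip.prems show ?case by cases simp
next
  case (ISet s e v r)
  from ISet.prems show ?case by cases (use ISet.hyps in simp)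
next
  case (RStore s e a f v)
  from RStore.prems show ?case by cases (use RStore.hyps in simp)
next
  case (Seq c s t s' c' t' s'' u)
  from Seq.prems show ?case by cases (use Seq.IH in blast)
next
  case (CondTrue s b c t s' c')
  note IH = CondTrue.IH and hyps = CondTrue.hyps
  from CondTrue.prems show ?case
  proof cases
    case (CondTrue t2)
    then show ?thesis using IH by blast
  qed (use hyps in simp)
next
  case (CondFalse s b c' t s' c)
  note IH = CondFalse.IH and hyps = CondFalse.hyps
  from CondFalse.prems show ?case
  proof cases
    case (CondFalse t2)
    then show ?thesis using IH by blast
  qed (use hyps in simp)
next
  case (WhileFalse s b c)
  from WhileFalse.prems show ?case by cases (use WhileFalse.hyps in simp_all)
next
  case (WhileTrue s b c t s' t' s'' u)
  note IH = WhileTrue.IH and hyps = WhileTrue.hyps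
  from WhileTrue.prems show ?case
  proof cases
    case (WhileTrue t2 s2 t2')
    then show ?thesis using IH by blast
  qed (use hyps in simp)
qed

text \<open>
  \<open>runs S W \<tau> c s s'\<close>: as \<open>exec\<close>, within time at most \<open>\<tau>\<close>.
\<close>

definition runs :: "nat \<Rightarrow> nat \<Rightarrow> real \<Rightarrow> com \<Rightarrow> state \<Rightarrow> state \<Rightarrow> bool" where
  "runs S W \<tau> c s s' \<longleftrightarrow> (\<exists>t. exec S W c s t s' \<and> real t \<le> \<tau>)"

text \<open>
  Calling convention: a program finds the dimensions \<open>n\<close> and \<open>d\<close> of the whole input in registers 0
  and 1. A result matrix with \<open>d\<close> columns is left in memory in row-major order, its number of rows
  in register 2 and its base address in register 3; it has to lie within the memory limit.
\<close>

definition result :: "nat \<Rightarrow> nat \<Rightarrow> state \<Rightarrow> real mat \<Rightarrow> bool" where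
  "result S d s T \<longleftrightarrow>
     regs s 3 + regs s 2 * d \<le> S \<and>
     T = mat (regs s 2) d (\<lambda>(i, j). mem s (regs s 3 + i * d + j))"

section \<open>Streaming\<close>

text \<open>
  A streaming algorithm consists of an initialisation, an update executed once for each arriving
  row, and a final program producing the result. Each new row is placed in the cells \<open>0..<d\<close>,
  overwriting their contents; it is the only access to the input, and the state is otherwise
  carried over from row to row. Memory limit and time limit apply to each of these steps.
\<close>

type_synonym streaming_alg = "com \<times> com \<times> com"

definition initial_state :: "nat \<Rightarrow> nat \<Rightarrow> state" where
  "initial_state n d = \<lparr>regs = (\<lambda>_. 0)(0 := n, 1 := d), mem = (\<lambda>_. 0)\<rparr>"

definition receive_row :: "real vec \<Rightarrow> state \<Rightarrow> state" where
  "receive_row v s = s\<lparr>mem := (\<lambda>a. if a < dim_vec v then v $ a else mem s a)\<rparr>"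

fun streaming_outputs ::
  "nat \<Rightarrow> nat \<Rightarrow> real \<Rightarrow> streaming_alg \<Rightarrow> real mat \<Rightarrow> real mat \<Rightarrow> bool" where
  "streaming_outputs S W \<tau> (init, update, final) A T \<longleftrightarrow>
     dim_col A \<le> S \<and>
     (\<exists>\<sigma> :: nat \<Rightarrow> state. \<exists>s.
        runs S W \<tau> init (initial_state (dim_row A) (dim_col A)) (\<sigma> 0) \<and>
        (\<forall>i < dim_row A. runs S W \<tau> update (receive_row (row A i) (\<sigma> i)) (\<sigma> (Suc i))) \<and>
        runs S W \<tau> final (\<sigma> (dim_row A)) s \<and>
        result S (dim_col A) s T)"

section \<open>Distributed summaries\<close>

text \<open>
  A distributed algorithm consists of a program for the leaves and a program for the inner nodes
  of the computation tree. Every node runs on a machine of its own, whose memory initially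
  contains only the input of that node: at a leaf its block of rows, at an inner node the stacked
  summaries of the children. The number of rows of this input is found in register 2.
\<close>

type_synonym distributed_alg = "com \<times> com"

definition node_state :: "nat \<Rightarrow> nat \<Rightarrow> real mat \<Rightarrow> state" where
  "node_state n d M =
     \<lparr>regs = (\<lambda>_. 0)(0 := n, 1 := d, 2 := dim_row M),
      mem = (\<lambda>a. if a < dim_row M * d then M $$ (a div d, a mod d) else 0)\<rparr>"

definition node_outputs ::
  "nat \<Rightarrow> nat \<Rightarrow> real \<Rightarrow> com \<Rightarrow> nat \<Rightarrow> nat \<Rightarrow> real mat \<Rightarrow> real mat \<Rightarrow> bool" where
  "node_outputs S W \<tau> c n d M T \<longleftrightarrow>
     dim_row M * d \<le> S \<and> (\<exists>s. runs S W \<tau> c (node_state n d M) s \<and> result S d s T)"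

text \<open>
  Leaves carry the number of the block they hold, a block being the list of its row indices.
\<close>

datatype ctree = Leaf nat | Node "ctree list"

primrec leaves :: "ctree \<Rightarrow> nat list" where
  "leaves (Leaf i) = [i]"
| "leaves (Node ts) = concat (map leaves ts)"

definition block_partition :: "nat \<Rightarrow> real \<Rightarrow> nat list list \<Rightarrow> bool" where
  "block_partition n m bs \<longleftrightarrow>
     distinct (concat bs) \<and> set (concat bs) = {..<n} \<and>
     (\<forall>b \<in> set bs. b \<noteq> [] \<and> real (length b) \<le> m)"

definition computation_tree :: "nat list list \<Rightarrow> ctree \<Rightarrow> bool" where
  "computation_tree bs t \<longleftrightarrow> distinct (leaves t) \<and> set (leaves t) = {..<length bs}"

inductive distributed_outputs ::
  "nat \<Rightarrow> nat \<Rightarrow> real \<Rightarrow> distributed_alg \<Rightarrow> nat list list \<Rightarrow> real mat \<Rightarrow> ctree \<Rightarrow> real mat \<Rightarrow> bool"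
  for S W \<tau> P bs A where
  Leaf: "node_outputs S W \<tau> (fst P) (dim_row A) (dim_col A)
           (mat_of_rows (dim_col A) (map (row A) (bs ! i))) T \<Longrightarrow>
         distributed_outputs S W \<tau> P bs A (Leaf i) T"
| Node: "list_all2 (distributed_outputs S W \<tau> P bs A) ts Ts \<Longrightarrow>
         node_outputs S W \<tau> (snd P) (dim_row A) (dim_col A)
           (mat_of_rows (dim_col A) (concat (map rows Ts))) T \<Longrightarrow>
         distributed_outputs S W \<tau> P bs A (Node ts) T"

section \<open>Resource bounds\<close>

definition time_bound :: "real \<Rightarrow> real \<Rightarrow> nat \<Rightarrow> nat \<Rightarrow> real" where
  "time_bound C \<gamma> n d =
     C * (real n powr \<gamma> * real d ^ 2 + real n powr \<gamma> * real d ^ 5 * ln (real n powr \<gamma>))"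

definition space_bound :: "real \<Rightarrow> real \<Rightarrow> nat \<Rightarrow> nat \<Rightarrow> nat" where
  "space_bound C \<gamma> n d = nat \<lfloor>C * (real n powr \<gamma> * real d)\<rfloor>"

text \<open>Index words of \<open>O(log (n + d))\<close> bits, the usual word size of a RAM.\<close>

definition word_bound :: "nat \<Rightarrow> nat \<Rightarrow> nat \<Rightarrow> nat" where
  "word_bound k n d = (n + d) ^ k"

end

theory Submission
  imports Defs "Jordan_Normal_Form.Determinant"
begin

text \<open>
  Write \<open>N x\<close> for the norm of \<open>A x\<close>. The functionals bounded by \<open>N\<close> form a symmetric convex body whose support function
  is \<open>N\<close>, and a subgradient of \<open>N\<close> at \<open>x\<close> is a functional in this body that attains \<open>N x\<close> at \<open>x\<close>. So an
  approximate barycentric spanner \<open>F\<close> of the body can be found by pivoting: keep \<open>A = U F\<close>, and whenever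
  column \<open>i\<close> of \<open>U\<close> has norm above 2, replace row \<open>i\<close> of \<open>F\<close> by a subgradient at the dual basis vector. Each
  pivot at least doubles the determinant, which is bounded once every nonzero column was pivoted one time;
  hence \<open>2 * d * d + 1\<close> further passes suffice. By the triangle inequality the rescaled rows of \<open>F\<close> are a
  summary of \<open>d\<close> rows with distortion \<open>d ^ 3\<close>, and merging summaries along a tree of depth \<open>2 / \<gamma>\<close> gives the result.

  A tree of this depth needs nodes with about \<open>n powr (\<gamma> / 2)\<close> children, for which there is room only when
  \<open>d * d \<le> n powr \<gamma>\<close>. For larger \<open>d\<close> every polynomial in \<open>n\<close> is bounded by some \<open>d powr (K / \<gamma>)\<close>, so it is
  enough to maintain the Euclidean norm of \<open>A x\<close> exactly, by Givens rotations.
\<close>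

section \<open>Norms and their subgradients\<close>

text \<open>Summaries are compared through \<open>mass\<close>, the power \<open>p\<close> of the
  norm, because masses add up when rows are stacked: merging any number of summaries is free, and
  only a compression loses a factor \<open>d powr (3 * p)\<close>. A compression never increases the
  mass, which keeps the upper constant at 1 throughout a tree or a buffer. Rank deficiency shapes
  the pivoting: a zero column of \<open>U\<close> cannot be pivoted, and a row of \<open>F\<close>
  that was never replaced is a unit row without any bound in terms of \<open>A\<close>. Hence the
  threshold 0 of the first pass, and hence the determinant is measured relative to the state after
  that pass, where all columns have norm at most \<open>2 ^ d\<close> whatever the scale of
  \<open>A\<close>. The passes cost about \<open>d ^ 4\<close> operations per row, within the
  \<open>d ^ 5\<close> term of the time bound. The exponent \<open>12 / \<gamma>\<close> is 3 for
  each of at most \<open>4 / \<gamma>\<close> compressions. The streaming algorithm realises the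
  tree as a counter in base \<open>b\<close> whose digits are the numbers of occupied slots; its
  output is the whole buffer.\<close>

definition mass :: "real \<Rightarrow> nat \<Rightarrow> (nat \<Rightarrow> real) \<Rightarrow> real" where
  "mass p m y = (\<Sum>k<m. \<bar>y k\<bar> powr p)"

definition nrm :: "real \<Rightarrow> nat \<Rightarrow> (nat \<Rightarrow> real) \<Rightarrow> real" where
  "nrm p m y = mass p m y powr (1 / p)"

text \<open>The derivative of |y|^p / p, written as a product so that the machine evaluates it with
  \<open>RPow\<close> and no sign test. As \<open>0 powr\<close> anything is 0, the value at 0 is 0
  also when \<open>p - 2\<close> is negative; for \<open>p = 1\<close> it is the sign.\<close>

definition dual_weight :: "real \<Rightarrow> real \<Rightarrow> real" where
  "dual_weight p y = y * \<bar>y\<bar> powr (p - 2)"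

lemma mass_nonneg [simp]: "0 \<le> mass p m y"
  by (simp add: mass_def sum_nonneg)

lemma nrm_nonneg [simp]: "0 \<le> nrm p m y"
  by (simp add: nrm_def)

lemma mass_cong: "(\<And>k. k < m \<Longrightarrow> y k = z k) \<Longrightarrow> mass p m y = mass p m z"
  by (simp add: mass_def)

lemma nrm_cong: "(\<And>k. k < m \<Longrightarrow> y k = z k) \<Longrightarrow> nrm p m y = nrm p m z"
  unfolding nrm_def by (metis mass_cong)

lemma abs_dual_weight: "\<bar>dual_weight p y\<bar> = \<bar>y\<bar> powr (p - 1)"
proof (cases "y = 0")
  case False
  then have "\<bar>y\<bar> * \<bar>y\<bar> powr (p - 2) = \<bar>y\<bar> powr (1 + (p - 2))"
    by (simp only: powr_add) simp
  then show ?thesis by (simp add: dual_weight_def abs_mult algebra_simps)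
qed (simp add: dual_weight_def)

lemma mult_dual_weight: "dual_weight p y * y = \<bar>y\<bar> powr p"
proof (cases "y = 0")
  case False
  then have "\<bar>y\<bar> * \<bar>y\<bar> * \<bar>y\<bar> powr (p - 2) = \<bar>y\<bar> powr (1 + 1 + (p - 2))"
    by (simp only: powr_add) simp
  then show ?thesis by (simp add: dual_weight_def abs_mult algebra_simps)
qed (simp add: dual_weight_def)

text \<open>Young's inequality without the conjugate exponent, so that \<open>p = 1\<close> is not
  special. With \<open>t = b / a\<close> it says that \<open>t\<close> is at most the weighted mean
  \<open>w\<close> of \<open>t powr p\<close> and 1. This is concavity of the logarithm, obtained
  from \<open>ln z \<le> z - 1\<close> at the two points divided by \<open>w\<close>.\<close>

lemma young:
  fixes a b p :: real
  assumes p: "1 \<le> p" and a: "0 \<le> a" and b: "0 \<le> b"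
  shows "a powr (p - 1) * b \<le> (1 - 1 / p) * a powr p + b powr p / p"
proof -
  consider "a = 0 \<or> b = 0" | "0 < a" "0 < b" using a b by linarith
  then show ?thesis
  proof cases
    case 1
    then show ?thesis using p by (auto simp: divide_simps)
  next
    case 2
    define t where "t = b / a"
    define u where "u = t powr p"
    define w where "w = u / p + (1 - 1 / p)"
    have t: "0 < t" using 2 by (simp add: t_def)
    have u: "0 < u" using t by (simp add: u_def)
    have "0 < u / p" using u p by simp
    moreover have "0 \<le> 1 - 1 / p" using p by simp
    ultimately have w: "0 < w" unfolding w_def by linarith
    have "ln (u / w) \<le> u / w - 1" using u w by (intro ln_le_minus_one) simp
    then have 3: "(ln u - ln w) / p \<le> (u / w - 1) / p"
      using u w p by (simp add: ln_div divide_right_mono)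
    have "ln (1 / w) \<le> 1 / w - 1" using w by (intro ln_le_minus_one) simp
    then have "- ln w \<le> 1 / w - 1" using w by (simp add: ln_div)
    then have 4: "(1 - 1 / p) * - ln w \<le> (1 - 1 / p) * (1 / w - 1)"
      using p by (intro mult_left_mono) auto
    have "(u / w - 1) / p + (1 - 1 / p) * (1 / w - 1) = (u / p + (1 - 1 / p)) / w - 1"
      using w p by (simp add: field_simps)
    also have "\<dots> = 0" using w by (simp add: w_def[symmetric])
    finally have "(ln u - ln w) / p + (1 - 1 / p) * - ln w \<le> 0" using 3 4 by linarith
    moreover have "(ln u - ln w) / p + (1 - 1 / p) * - ln w = ln u / p - ln w"
      using p by (simp add: field_simps)
    ultimately have "ln u / p \<le> ln w" by linarith
    moreover have "ln u / p = ln t" using t p by (simp add: u_def ln_powr)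
    ultimately have "t \<le> w" using t w by simp
    then have "a powr p * t \<le> a powr p * w" by (simp add: mult_left_mono)
    moreover have "a powr p * t = a powr (p - 1) * b"
      using 2 by (simp add: t_def powr_diff)
    moreover have "a powr p * u = b powr p"
      using 2 by (simp add: u_def t_def powr_divide)
    then have "a powr p * w = (1 - 1 / p) * a powr p + b powr p / p"
      by (simp add: w_def algebra_simps)
    ultimately show ?thesis by linarith
  qed
qed

lemma nrm_powr: "1 \<le> p \<Longrightarrow> nrm p m y powr p = mass p m y"
  by (simp add: nrm_def powr_powr)

lemma nrm_eq_0_iff: "1 \<le> p \<Longrightarrow> nrm p m y = 0 \<longleftrightarrow> (\<forall>k<m. y k = 0)"
  by (auto simp: nrm_def mass_def sum_nonneg_eq_0_iff)

lemma mass_scale: "mass p m (\<lambda>k. c * y k) = \<bar>c\<bar> powr p * mass p m y"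
  by (simp add: mass_def abs_mult powr_mult sum_distrib_left)

lemma nrm_scale: "1 \<le> p \<Longrightarrow> nrm p m (\<lambda>k. c * y k) = \<bar>c\<bar> * nrm p m y"
  by (simp add: nrm_def mass_scale powr_mult powr_powr)

lemma component_le_nrm:
  assumes "1 \<le> p" "k < m"
  shows "\<bar>y k\<bar> \<le> nrm p m y"
proof -
  have "\<bar>y k\<bar> powr p \<le> mass p m y"
    unfolding mass_def using assms by (intro member_le_sum) auto
  then have "(\<bar>y k\<bar> powr p) powr (1 / p) \<le> nrm p m y"
    unfolding nrm_def using assms by (intro powr_mono2) auto
  then show ?thesis using assms by (simp add: powr_powr)
qed

text \<open>Only test vectors of the form \<open>dual_weight p (y k)\<close> occur, so no dual norm
  has to be introduced. After scaling both norms to 1, \<open>young\<close> bounds the terms, and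
  the bounds add up to \<open>(1 - 1 / p) + 1 / p\<close>.\<close>

lemma hoelder:
  assumes p: "1 \<le> p"
  shows "\<bar>\<Sum>k<m. dual_weight p (y k) * z k\<bar> \<le> nrm p m y powr (p - 1) * nrm p m z"
proof -
  consider "nrm p m y = 0" | "nrm p m z = 0" | "0 < nrm p m y" "0 < nrm p m z"
    using nrm_nonneg[of p m y] nrm_nonneg[of p m z] by linarith
  then show ?thesis
  proof cases
    case 1
    then have "\<forall>k<m. y k = 0" using nrm_eq_0_iff p by blast
    then show ?thesis using 1 by (simp add: dual_weight_def)
  next
    case 2
    then have "\<forall>k<m. z k = 0" using nrm_eq_0_iff p by blast
    then show ?thesis using 2 by simp
  next
    case 3
    define Y Z where "Y = nrm p m y" and "Z = nrm p m z"
    have YZ: "0 < Y" "0 < Z" using 3 by (auto simp: Y_def Z_def)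
    have "\<bar>\<Sum>k<m. dual_weight p (y k) * z k\<bar> \<le> (\<Sum>k<m. \<bar>y k\<bar> powr (p - 1) * \<bar>z k\<bar>)"
      by (rule order_trans[OF sum_abs]) (simp add: abs_mult abs_dual_weight)
    also have "\<dots> = Y powr (p - 1) * Z * (\<Sum>k<m. (\<bar>y k\<bar> / Y) powr (p - 1) * (\<bar>z k\<bar> / Z))"
      using YZ by (simp add: sum_distrib_left powr_divide)
    also have "\<dots> \<le> Y powr (p - 1) * Z *
        (\<Sum>k<m. (1 - 1 / p) * (\<bar>y k\<bar> / Y) powr p + (\<bar>z k\<bar> / Z) powr p / p)"
      using YZ p by (intro mult_left_mono sum_mono young) auto
    also have "(\<Sum>k<m. (1 - 1 / p) * (\<bar>y k\<bar> / Y) powr p + (\<bar>z k\<bar> / Z) powr p / p) =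
        (1 - 1 / p) * (mass p m y / Y powr p) + mass p m z / Z powr p / p"
      using YZ by (simp add: sum.distrib sum_distrib_left[symmetric] sum_divide_distrib[symmetric]
          powr_divide mass_def)
    also have "\<dots> = 1"
    proof -
      have "mass p m y = Y powr p" "mass p m z = Z powr p"
        using nrm_powr[OF p] by (simp_all add: Y_def Z_def)
      moreover have "0 < Y powr p" "0 < Z powr p" using YZ by simp_all
      ultimately show ?thesis using p by (simp add: field_simps)
    qed
    finally show ?thesis by (simp add: Y_def Z_def)
  qed
qed

text \<open>Equality case of \<open>hoelder\<close>: the weights divided by
  \<open>nrm p m y powr (p - 1)\<close> form a subgradient of the norm at a nonzero
  \<open>y\<close>.\<close>

lemma sum_dual_weight_self:
  assumes "1 \<le> p"
  shows "(\<Sum>k<m. dual_weight p (y k) * y k) = nrm p m y powr (p - 1) * nrm p m y"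
proof (cases "nrm p m y = 0")
  case True
  then have "\<forall>k<m. y k = 0" using nrm_eq_0_iff assms by blast
  then show ?thesis using True by simp
next
  case False
  then have "nrm p m y powr (p - 1) * nrm p m y = nrm p m y powr (p - 1 + 1)"
    using nrm_nonneg[of p m y] by (simp only: powr_add) simp
  also have "\<dots> = mass p m y" using assms by (simp add: nrm_powr)
  finally show ?thesis by (simp add: mult_dual_weight mass_def)
qed

text \<open>Minkowski's inequality by duality: the sum \<open>y\<close> is tested against its own
  dual weights, where the functional attains \<open>Y powr (p - 1) * Y\<close>, while
  \<open>hoelder\<close> bounds it on every summand.\<close>

lemma nrm_sum_le:
  assumes p: "1 \<le> p"
  shows "nrm p m (\<lambda>k. \<Sum>l\<in>A. c l * u l k) \<le> (\<Sum>l\<in>A. \<bar>c l\<bar> * nrm p m (u l))"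
proof -
  define y where "y = (\<lambda>k. \<Sum>l\<in>A. c l * u l k)"
  define Y where "Y = nrm p m y"
  show ?thesis
  proof (cases "Y = 0")
    case True
    then show ?thesis by (simp add: Y_def y_def sum_nonneg)
  next
    case False
    then have Y: "0 < Y powr (p - 1)" using nrm_nonneg[of p m y] by (simp add: Y_def)
    have "Y powr (p - 1) * Y = (\<Sum>k<m. dual_weight p (y k) * y k)"
      using sum_dual_weight_self[OF p] by (simp add: Y_def)
    also have "\<dots> = (\<Sum>k<m. \<Sum>l\<in>A. c l * (dual_weight p (y k) * u l k))"
      by (simp add: y_def sum_distrib_left mult.left_commute)
    also have "\<dots> = (\<Sum>l\<in>A. c l * (\<Sum>k<m. dual_weight p (y k) * u l k))"
      by (subst sum.swap) (simp add: sum_distrib_left)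
    also have "\<dots> \<le> (\<Sum>l\<in>A. \<bar>c l\<bar> * (Y powr (p - 1) * nrm p m (u l)))"
    proof (rule sum_mono)
      fix l
      have "c l * (\<Sum>k<m. dual_weight p (y k) * u l k)
          \<le> \<bar>c l\<bar> * \<bar>\<Sum>k<m. dual_weight p (y k) * u l k\<bar>"
        by (metis abs_ge_self abs_mult)
      also have "\<dots> \<le> \<bar>c l\<bar> * (Y powr (p - 1) * nrm p m (u l))"
        unfolding Y_def using hoelder[OF p] by (intro mult_left_mono) auto
      finally show "c l * (\<Sum>k<m. dual_weight p (y k) * u l k)
          \<le> \<bar>c l\<bar> * (Y powr (p - 1) * nrm p m (u l))" .
    qed
    also have "\<dots> = Y powr (p - 1) * (\<Sum>l\<in>A. \<bar>c l\<bar> * nrm p m (u l))"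
      by (simp add: sum_distrib_left mult.left_commute)
    finally show ?thesis using Y by (simp add: Y_def y_def)
  qed
qed

text \<open>This is \<open>nrm_sum_le\<close> for the expansion of \<open>y\<close> in unit vectors,
  each of norm 1.\<close>

lemma nrm_le_sum_components:
  assumes "1 \<le> p"
  shows "nrm p m y \<le> (\<Sum>k<m. \<bar>y k\<bar>)"
proof -
  have "nrm p m (\<lambda>k. \<Sum>l<m. y l * (if k = l then 1 else 0))
      \<le> (\<Sum>l<m. \<bar>y l\<bar> * nrm p m (\<lambda>k. if k = l then 1 else 0))"
    by (rule nrm_sum_le[OF assms])
  also have "\<dots> = (\<Sum>l<m. \<bar>y l\<bar>)"
  proof (rule sum.cong[OF refl])
    fix l assume "l \<in> {..<m}"
    moreover have "mass p m (\<lambda>k. if k = l then 1 else 0) = (\<Sum>k<m. if k = l then 1 else 0)"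
      unfolding mass_def by (rule sum.cong) auto
    ultimately show "\<bar>y l\<bar> * nrm p m (\<lambda>k. if k = l then 1 else 0) = \<bar>y l\<bar>"
      by (simp add: nrm_def)
  qed
  also have "nrm p m (\<lambda>k. \<Sum>l<m. y l * (if k = l then 1 else 0)) = nrm p m y"
    by (rule nrm_cong) (simp add: if_distrib sum.delta cong: if_cong)
  finally show ?thesis .
qed

section \<open>Well-conditioned factorizations by pivoting\<close>

abbreviation (input) col_of :: "(nat \<Rightarrow> nat \<Rightarrow> real) \<Rightarrow> nat \<Rightarrow> nat \<Rightarrow> real" where
  "col_of U l \<equiv> \<lambda>k. U k l"

text \<open>The subgradient of the norm at column \<open>i\<close> of \<open>U\<close>, applied to
  column \<open>l\<close>. The exponent \<open>(p - 1) / p\<close> turns a mass into the power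
  \<open>p - 1\<close> of the norm, so the program only has to keep the mass.\<close>

definition coef :: "real \<Rightarrow> nat \<Rightarrow> (nat \<Rightarrow> nat \<Rightarrow> real) \<Rightarrow> nat \<Rightarrow> nat \<Rightarrow> real" where
  "coef p m U i l =
     (\<Sum>k<m. dual_weight p (U k i) * U k l) / mass p m (col_of U i) powr ((p - 1) / p)"

text \<open>Let \<open>E\<close> be the identity with row \<open>i\<close> replaced by
  \<open>coef p m U i\<close>. This is \<open>U\<close> times the inverse of \<open>E\<close>, and
  \<open>pivot_right\<close> is \<open>E\<close> times \<open>F\<close>, so the product is
  unchanged.\<close>

definition pivot_left :: "real \<Rightarrow> nat \<Rightarrow> (nat \<Rightarrow> nat \<Rightarrow> real) \<Rightarrow> nat \<Rightarrow> nat \<Rightarrow> nat \<Rightarrow> real" where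
  "pivot_left p m U i k l =
     (if l = i then U k i / coef p m U i i else U k l - coef p m U i l * (U k i / coef p m U i i))"

definition pivot_right ::
  "real \<Rightarrow> nat \<Rightarrow> nat \<Rightarrow> (nat \<Rightarrow> nat \<Rightarrow> real) \<Rightarrow> (nat \<Rightarrow> nat \<Rightarrow> real) \<Rightarrow> nat \<Rightarrow> nat \<Rightarrow> nat \<Rightarrow> real" where
  "pivot_right p m d U F i r j = (if r = i then \<Sum>l<d. coef p m U i l * F l j else F r j)"

definition pivot_step :: "real \<Rightarrow> nat \<Rightarrow> nat \<Rightarrow> real \<Rightarrow> nat \<Rightarrow>
    (nat \<Rightarrow> nat \<Rightarrow> real) \<times> (nat \<Rightarrow> nat \<Rightarrow> real) \<Rightarrow> (nat \<Rightarrow> nat \<Rightarrow> real) \<times> (nat \<Rightarrow> nat \<Rightarrow> real)" where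
  "pivot_step p m d th i UF = (if th < nrm p m (col_of (fst UF) i)
     then (pivot_left p m (fst UF) i, pivot_right p m d (fst UF) (snd UF) i) else UF)"

primrec pivot_pass :: "real \<Rightarrow> nat \<Rightarrow> nat \<Rightarrow> real \<Rightarrow> nat \<Rightarrow>
    (nat \<Rightarrow> nat \<Rightarrow> real) \<times> (nat \<Rightarrow> nat \<Rightarrow> real) \<Rightarrow> (nat \<Rightarrow> nat \<Rightarrow> real) \<times> (nat \<Rightarrow> nat \<Rightarrow> real)" where
  "pivot_pass p m d th 0 UF = UF"
| "pivot_pass p m d th (Suc i) UF = pivot_step p m d th i (pivot_pass p m d th i UF)"

text \<open>The threshold 0 of the first pass gives a pivot to every column that is nonzero when
  visited; later passes touch only columns of norm above 2.\<close>

primrec pivot_passes :: "real \<Rightarrow> nat \<Rightarrow> nat \<Rightarrow> nat \<Rightarrow>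
    (nat \<Rightarrow> nat \<Rightarrow> real) \<times> (nat \<Rightarrow> nat \<Rightarrow> real) \<Rightarrow> (nat \<Rightarrow> nat \<Rightarrow> real) \<times> (nat \<Rightarrow> nat \<Rightarrow> real)" where
  "pivot_passes p m d 0 UF = UF"
| "pivot_passes p m d (Suc r) UF = pivot_pass p m d (if r = 0 then 0 else 2) d (pivot_passes p m d r UF)"

definition id_fun :: "nat \<Rightarrow> nat \<Rightarrow> real" where
  "id_fun i j = (if i = j then 1 else 0)"

definition factors ::
  "nat \<Rightarrow> nat \<Rightarrow> (nat \<Rightarrow> nat \<Rightarrow> real) \<Rightarrow> (nat \<Rightarrow> nat \<Rightarrow> real) \<Rightarrow> (nat \<Rightarrow> nat \<Rightarrow> real) \<Rightarrow> bool" where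
  "factors m d A U F \<longleftrightarrow> (\<forall>k<m. \<forall>j<d. (\<Sum>l<d. U k l * F l j) = A k j)"

definition mat_app :: "nat \<Rightarrow> (nat \<Rightarrow> nat \<Rightarrow> real) \<Rightarrow> (nat \<Rightarrow> real) \<Rightarrow> nat \<Rightarrow> real" where
  "mat_app d A x k = (\<Sum>j<d. A k j * x j)"

text \<open>Membership of \<open>f\<close> in the symmetric convex body whose support function is
  the norm of \<open>A x\<close>.\<close>

definition bounded_row ::
  "real \<Rightarrow> nat \<Rightarrow> nat \<Rightarrow> (nat \<Rightarrow> nat \<Rightarrow> real) \<Rightarrow> (nat \<Rightarrow> real) \<Rightarrow> bool" where
  "bounded_row p m d A f \<longleftrightarrow> (\<forall>x. \<bar>\<Sum>j<d. f j * x j\<bar> \<le> nrm p m (mat_app d A x))"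

lemma mass_powr_eq: "1 \<le> p \<Longrightarrow> mass p m y powr ((p - 1) / p) = nrm p m y powr (p - 1)"
  by (simp add: nrm_def powr_powr)

lemma coef_self:
  assumes "1 \<le> p"
  shows "coef p m U i i = nrm p m (col_of U i)"
proof -
  define N where "N = nrm p m (col_of U i)"
  have "coef p m U i i = (N powr (p - 1) * N) / N powr (p - 1)"
    unfolding coef_def mass_powr_eq[OF assms] N_def
    by (subst sum_dual_weight_self[OF assms]) (rule refl)
  also have "\<dots> = N"
  proof (cases "N = 0")
    case False
    then have "N powr (p - 1) \<noteq> 0" by (metis powr_eq_0_iff)
    then show ?thesis by (metis nonzero_mult_div_cancel_left)
  qed (metis mult_zero_right div_0)
  finally show ?thesis unfolding N_def .
qed

text \<open>The subgradient has dual norm at most 1. The vector \<open>z\<close> is arbitrary, since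
  this is applied to columns of \<open>U\<close> as well as to \<open>A x\<close>; at a zero column
  the quotient is 0 by the convention for division.\<close>

lemma abs_coef_le:
  assumes "1 \<le> p"
  shows "\<bar>\<Sum>k<m. dual_weight p (U k i) * z k\<bar> / mass p m (col_of U i) powr ((p - 1) / p)
    \<le> nrm p m z"
proof (cases "nrm p m (col_of U i) = 0")
  case True
  then show ?thesis unfolding mass_powr_eq[OF assms] by simp
next
  case False
  then have "0 < nrm p m (col_of U i) powr (p - 1)" by simp
  then show ?thesis unfolding mass_powr_eq[OF assms]
    using hoelder[OF assms, where m = m and y = "col_of U i" and z = z]
    by (metis divide_le_eq mult.commute)
qed

lemma app_factors:
  assumes "factors m d A U F" "k < m"
  shows "mat_app d A x k = (\<Sum>l<d. U k l * mat_app d F x l)"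
proof -
  have "mat_app d A x k = (\<Sum>j<d. \<Sum>l<d. U k l * F l j * x j)"
    using assms by (simp add: mat_app_def factors_def sum_distrib_right[symmetric])
  also have "\<dots> = (\<Sum>l<d. U k l * mat_app d F x l)"
    by (subst sum.swap) (simp add: mat_app_def sum_distrib_left mult.assoc)
  finally show ?thesis .
qed

lemma factors_pivot:
  assumes p: "1 \<le> p" and f: "factors m d A U F" and i: "i < d"
    and pos: "0 < nrm p m (col_of U i)"
  shows "factors m d A (pivot_left p m U i) (pivot_right p m d U F i)"
  unfolding factors_def
proof (intro allI impI)
  fix k j assume k: "k < m" and j: "j < d"
  define N where "N = coef p m U i i"
  define h where "h = coef p m U i"
  have N: "N \<noteq> 0" using pos by (simp add: N_def coef_self[OF p])
  have hi: "h i = N" by (simp add: h_def N_def)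
  let ?S = "{..<d} - {i}"
  have "(\<Sum>l<d. pivot_left p m U i k l * pivot_right p m d U F i l j)
      = U k i / N * (\<Sum>l<d. h l * F l j) + (\<Sum>l\<in>?S. (U k l - h l * (U k i / N)) * F l j)"
    using i by (subst sum.remove[of _ i])
      (auto simp: pivot_left_def pivot_right_def N_def h_def intro!: sum.cong)
  also have "(\<Sum>l<d. h l * F l j) = N * F i j + (\<Sum>l\<in>?S. h l * F l j)"
    using i hi by (subst sum.remove[of _ i]) auto
  also have "(\<Sum>l\<in>?S. (U k l - h l * (U k i / N)) * F l j) =
     (\<Sum>l\<in>?S. U k l * F l j) - U k i / N * (\<Sum>l\<in>?S. h l * F l j)"
    unfolding sum_distrib_left sum_subtractf[symmetric]
    by (rule sum.cong) (simp_all add: algebra_simps)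
  also have "U k i / N * (N * F i j + (\<Sum>l\<in>?S. h l * F l j)) +
      ((\<Sum>l\<in>?S. U k l * F l j) - U k i / N * (\<Sum>l\<in>?S. h l * F l j)) =
      U k i * F i j + (\<Sum>l\<in>?S. U k l * F l j)"
    using N by (simp add: distrib_left)
  also have "\<dots> = (\<Sum>l<d. U k l * F l j)"
    using i by (subst (2) sum.remove[of _ i]) auto
  also have "\<dots> = A k j" using f k j by (simp add: factors_def)
  finally show "(\<Sum>l<d. pivot_left p m U i k l * pivot_right p m d U F i l j) = A k j" .
qed

text \<open>The new row is the subgradient \<open>g\<close> at column \<open>i\<close> composed with
  \<open>U F = A\<close>; it maps \<open>x\<close> to \<open>g (A x)\<close>, which
  \<open>abs_coef_le\<close> bounds. So a single pivot turns a unit row into an element of the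
  body.\<close>

lemma bounded_row_pivot:
  assumes p: "1 \<le> p" and f: "factors m d A U F"
  shows "bounded_row p m d A (pivot_right p m d U F i i)"
  unfolding bounded_row_def
proof
  fix x
  define W where "W = mass p m (col_of U i) powr ((p - 1) / p)"
  have W: "0 \<le> W" by (simp add: W_def)
  have "(\<Sum>j<d. pivot_right p m d U F i i j * x j) = (\<Sum>j<d. \<Sum>l<d. coef p m U i l * (F l j * x j))"
    by (simp add: pivot_right_def sum_distrib_right mult.assoc)
  also have "\<dots> = (\<Sum>l<d. coef p m U i l * mat_app d F x l)"
    by (subst sum.swap) (simp add: mat_app_def sum_distrib_left)
  also have "\<dots> = (\<Sum>l<d. (\<Sum>k<m. dual_weight p (U k i) * U k l * mat_app d F x l) / W)"
    by (simp add: coef_def W_def sum_distrib_right)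
  also have "\<dots> = (\<Sum>l<d. \<Sum>k<m. dual_weight p (U k i) * (U k l * mat_app d F x l)) / W"
    by (simp add: sum_divide_distrib mult.assoc)
  also have "\<dots> = (\<Sum>k<m. dual_weight p (U k i) * (\<Sum>l<d. U k l * mat_app d F x l)) / W"
    by (subst sum.swap) (simp add: sum_distrib_left)
  also have "\<dots> = (\<Sum>k<m. dual_weight p (U k i) * mat_app d A x k) / W"
    using app_factors[OF f] by simp
  finally have "\<bar>\<Sum>j<d. pivot_right p m d U F i i j * x j\<bar> =
      \<bar>\<Sum>k<m. dual_weight p (U k i) * mat_app d A x k\<bar> / W" using W by simp
  also have "\<dots> \<le> nrm p m (mat_app d A x)"
    using abs_coef_le[OF p, where m = m and U = U and i = i and z = "mat_app d A x"] by (simp add: W_def)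
  finally show "\<bar>\<Sum>j<d. pivot_right p m d U F i i j * x j\<bar> \<le> nrm p m (mat_app d A x)" .
qed

lemma nrm_pivot_self:
  assumes p: "1 \<le> p" and pos: "0 < nrm p m (col_of U i)"
  shows "nrm p m (col_of (pivot_left p m U i) i) = 1"
proof -
  have "col_of (pivot_left p m U i) i = (\<lambda>k. (1 / coef p m U i i) * U k i)"
    by (simp add: pivot_left_def)
  then show ?thesis using pos by (simp only: nrm_scale[OF p] coef_self[OF p]) simp
qed

text \<open>What is subtracted from column \<open>l\<close> is \<open>coef p m U i l\<close> times a
  vector of norm 1, and \<open>abs_coef_le\<close> bounds this coefficient by the norm of column
  \<open>l\<close>. Hence a pivot at most doubles the other columns and keeps zero columns
  zero.\<close>

lemma nrm_pivot_other:
  assumes p: "1 \<le> p" and pos: "0 < nrm p m (col_of U i)"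
  shows "nrm p m (col_of (pivot_left p m U i) l) \<le> max 1 (2 * nrm p m (col_of U l))"
    and "l \<noteq> i \<Longrightarrow> nrm p m (col_of (pivot_left p m U i) l) \<le> 2 * nrm p m (col_of U l)"
proof -
  show *: "nrm p m (col_of (pivot_left p m U i) l) \<le> 2 * nrm p m (col_of U l)" if "l \<noteq> i"
  proof -
    define N where "N = nrm p m (col_of U i)"
    have N: "0 < N" using pos by (simp add: N_def)
    define c where "c = (\<lambda>b. if b then 1 else - (coef p m U i l / N))"
    define u where "u = (\<lambda>b. if b then col_of U l else col_of U i)"
    have "nrm p m (col_of (pivot_left p m U i) l) = nrm p m (\<lambda>k. \<Sum>b\<in>UNIV. c b * u b k)"
      using that by (intro nrm_cong) (simp add: pivot_left_def UNIV_bool c_def u_def coef_self[OF p] N_def)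
    also have "\<dots> \<le> (\<Sum>b\<in>UNIV. \<bar>c b\<bar> * nrm p m (u b))" by (rule nrm_sum_le[OF p])
    also have "\<dots> = nrm p m (col_of U l) + \<bar>coef p m U i l\<bar>"
      using N by (simp add: UNIV_bool c_def u_def N_def[symmetric])
    also have "\<bar>coef p m U i l\<bar> \<le> nrm p m (col_of U l)"
      using abs_coef_le[OF p, where m = m and U = U and i = i and z = "col_of U l"] by (simp add: coef_def)
    finally show ?thesis by simp
  qed
  show "nrm p m (col_of (pivot_left p m U i) l) \<le> max 1 (2 * nrm p m (col_of U l))"
    using * nrm_pivot_self[OF p, of m U i] pos by (cases "l = i") auto
qed

section \<open>Determinants: replacing one row, and a bound from the entries\<close>

definition fun_det :: "nat \<Rightarrow> (nat \<Rightarrow> nat \<Rightarrow> real) \<Rightarrow> real" where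
  "fun_det d M = det (mat d d (\<lambda>(i, j). M i j))"

lemma fun_det_id: "fun_det d id_fun = 1"
proof -
  have "mat d d (\<lambda>(i, j). id_fun i j) = 1\<^sub>m d" by (rule eq_matI) (auto simp: id_fun_def)
  then show ?thesis by (simp add: fun_det_def)
qed

text \<open>The change is multiplication from the left by the identity with row \<open>i\<close>
  replaced by \<open>h\<close>. The determinant of that factor is \<open>h i\<close>, by Cramer's
  rule for the identity system applied to the transpose.\<close>

lemma fun_det_replace_row:
  assumes i: "i < d"
  shows "fun_det d (\<lambda>r j. if r = i then \<Sum>l<d. h l * M l j else M r j) = h i * fun_det d M"
proof -
  define E where "E = mat d d (\<lambda>(r, l). if r = i then h l else if r = l then 1 else (0::real))"
  define X where "X = mat d d (\<lambda>(i, j). M i j)"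
  have E: "E \<in> carrier_mat d d" and X: "X \<in> carrier_mat d d" by (simp_all add: E_def X_def)
  have "transpose_mat E = replace_col (1\<^sub>m d) (1\<^sub>m d *\<^sub>v vec d h) i"
    by (rule eq_matI) (auto simp: E_def replace_col_def)
  then have "det (transpose_mat E) = h i"
    using cramer_lemma_mat[of "1\<^sub>m d" d "vec d h" i] i by simp
  then have detE: "det E = h i" using det_transpose[OF E] by simp
  have "mat d d (\<lambda>(r, j). if r = i then \<Sum>l<d. h l * M l j else M r j) = E * X"
  proof (rule eq_matI)
    fix r j assume "r < dim_row (E * X)" "j < dim_col (E * X)"
    then have r: "r < d" and j: "j < d" by (simp_all add: E_def X_def)
    have "(E * X) $$ (r, j) = (\<Sum>l<d. (if r = i then h l else if r = l then 1 else 0) * M l j)"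
      using r j by (simp add: E_def X_def scalar_prod_def atLeast0LessThan)
    also have "\<dots> = (if r = i then \<Sum>l<d. h l * M l j else M r j)"
      using r by (simp add: if_distrib[of "\<lambda>x. x * _"] sum.delta cong: if_cong)
    finally show "mat d d (\<lambda>(r, j). if r = i then \<Sum>l<d. h l * M l j else M r j) $$ (r, j) =
        (E * X) $$ (r, j)" using r j by simp
  qed (simp_all add: E_def X_def)
  then show ?thesis using det_mult[OF E X] detE by (simp add: fun_det_def X_def)
qed

lemma abs_fun_det_le:
  assumes B: "\<And>i j. i < d \<Longrightarrow> j < d \<Longrightarrow> \<bar>M i j\<bar> \<le> B"
  shows "\<bar>fun_det d M\<bar> \<le> fact d * B ^ d"
proof -
  have "\<bar>fun_det d M\<bar> \<le> (\<Sum>q\<in>{q. q permutes {0..<d}}. \<bar>signof q * (\<Prod>i=0..<d. M i (q i))\<bar>)"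
    unfolding fun_det_def
    by (subst det_def') (auto intro!: order_trans[OF sum_abs] sum_mono simp: abs_mult abs_prod)
  also have "\<dots> \<le> (\<Sum>q\<in>{q. q permutes {0..<d}}. B ^ d)"
  proof (rule sum_mono)
    fix q assume q: "q \<in> {q. q permutes {0..<d}}"
    have "\<bar>signof q * (\<Prod>i=0..<d. M i (q i))\<bar> = (\<Prod>i=0..<d. \<bar>M i (q i)\<bar>)"
      by (simp add: abs_mult abs_prod sign_def)
    also have "\<dots> \<le> (\<Prod>i=0..<d. B)"
      using q B by (intro prod_mono) (auto dest: permutes_in_image[of _ "{0..<d}"])
    finally show "\<bar>signof q * (\<Prod>i=0..<d. M i (q i))\<bar> \<le> B ^ d" by simp
  qed
  also have "\<dots> = fact d * B ^ d" by (simp add: card_permutations)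
  finally show ?thesis .
qed


lemma factors_id: "factors m d A A id_fun"
  by (simp add: factors_def id_fun_def if_distrib sum.delta cong: if_cong)

section \<open>Invariants of the passes and the number of passes needed\<close>

lemma step_cases:
  obtains "pivot_step p m d th i (U, F) = (U, F)" "nrm p m (col_of U i) \<le> th"
  | "pivot_step p m d th i (U, F) = (pivot_left p m U i, pivot_right p m d U F i)"
    "th < nrm p m (col_of U i)"
  by (cases "th < nrm p m (col_of U i)") (auto simp: pivot_step_def)

text \<open>A visited column gets norm 1, or it is zero and stays zero, and every later pivot at
  most doubles it; hence \<open>2 ^ i\<close>, whatever the size of the columns of
  \<open>A\<close>.\<close>

lemma first_pass_invariant:
  assumes p: "1 \<le> p" and "i \<le> d" and "pivot_pass p m d 0 i (A, id_fun) = (U, F)"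
  shows "factors m d A U F \<and> (\<forall>l<i. nrm p m (col_of U l) \<le> 2 ^ i \<and>
    (nrm p m (col_of U l) = 0 \<or> bounded_row p m d A (F l)))"
  using assms(2,3)
proof (induction i arbitrary: U F)
  case 0
  then show ?case by (simp add: factors_id)
next
  case (Suc i)
  obtain V G where VG: "pivot_pass p m d 0 i (A, id_fun) = (V, G)" by (metis surj_pair)
  have i: "i < d" using Suc.prems by simp
  have IH: "factors m d A V G"
    "\<And>l. l < i \<Longrightarrow> nrm p m (col_of V l) \<le> 2 ^ i"
    "\<And>l. l < i \<Longrightarrow> nrm p m (col_of V l) = 0 \<or> bounded_row p m d A (G l)"
    using Suc.IH[OF _ VG] i by auto
  have UF: "(U, F) = pivot_step p m d 0 i (V, G)" using Suc.prems VG by simp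
  show ?case
  proof (cases rule: step_cases[of p m d 0 i V G])
    case 1
    then have UF': "U = V" "F = G" and z: "nrm p m (col_of V i) = 0"
      using UF nrm_nonneg[of p m "col_of V i"] by auto
    have "nrm p m (col_of V l) \<le> 2 ^ Suc i \<and>
        (nrm p m (col_of V l) = 0 \<or> bounded_row p m d A (G l))" if "l < Suc i" for l
    proof (cases "l = i")
      case False
      then have "l < i" using that by simp
      moreover have "nrm p m (col_of V l) \<le> 2 ^ Suc i"
        using IH(2)[OF \<open>l < i\<close>] power_increasing[of i "Suc i" "2::real"] by linarith
      ultimately show ?thesis using IH(3) by blast
    qed (simp add: z)
    then show ?thesis using IH(1) UF' by simp
  next
    case 2
    then have UF': "U = pivot_left p m V i" "F = pivot_right p m d V G i"
      and pos: "0 < nrm p m (col_of V i)" using UF by auto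
    have "nrm p m (col_of U l) \<le> 2 ^ Suc i \<and>
        (nrm p m (col_of U l) = 0 \<or> bounded_row p m d A (F l))" if "l < Suc i" for l
    proof (cases "l = i")
      case True
      then show ?thesis
        using nrm_pivot_self[of p m V i, OF p pos] bounded_row_pivot[OF p IH(1)] one_le_power[of "2::real" "Suc i"]
        by (simp add: UF')
    next
      case False
      then have l: "l < i" using that by simp
      have le: "nrm p m (col_of U l) \<le> 2 * nrm p m (col_of V l)"
        using nrm_pivot_other(2)[of p m V i l, OF p pos False] by (simp add: UF')
      moreover have "F l = G l" using False by (simp add: UF' pivot_right_def fun_eq_iff)
      moreover have "nrm p m (col_of V l) = 0 \<Longrightarrow> nrm p m (col_of U l) = 0"
        using le nrm_nonneg[of p m "col_of U l"] by linarith
      ultimately show ?thesis using IH(2,3)[OF l] by auto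
    qed
    then show ?thesis using factors_pivot[OF p IH(1) i pos] by (simp add: UF')
  qed
qed

text \<open>Rows of \<open>F\<close> at zero columns are exempt: they may still be unit rows that no
  pivot has replaced, and they contribute nothing to the product \<open>U F\<close>.\<close>

definition well_factored ::
  "real \<Rightarrow> nat \<Rightarrow> nat \<Rightarrow> (nat \<Rightarrow> nat \<Rightarrow> real) \<Rightarrow> (nat \<Rightarrow> nat \<Rightarrow> real) \<Rightarrow> (nat \<Rightarrow> nat \<Rightarrow> real) \<Rightarrow> bool" where
  "well_factored p m d A U F \<longleftrightarrow> factors m d A U F \<and>
     (\<forall>l<d. nrm p m (col_of U l) = 0 \<or> bounded_row p m d A (F l))"

lemma well_factored_step:
  assumes p: "1 \<le> p" and th: "0 \<le> th" and i: "i < d" and w: "well_factored p m d A U F"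
    and s: "pivot_step p m d th i (U, F) = (U', F')"
  shows "well_factored p m d A U' F'"
proof (cases rule: step_cases[of p m d th i U F])
  case 1
  then show ?thesis using s w by simp
next
  case 2
  then have UF': "U' = pivot_left p m U i" "F' = pivot_right p m d U F i"
    and pos: "0 < nrm p m (col_of U i)" using s th by auto
  have f: "factors m d A U F" using w by (simp add: well_factored_def)
  have "nrm p m (col_of U' l) = 0 \<or> bounded_row p m d A (F' l)" if "l < d" for l
  proof (cases "l = i")
    case True
    then show ?thesis using bounded_row_pivot[OF p f] by (simp add: UF')
  next
    case False
    have "nrm p m (col_of U' l) \<le> 2 * nrm p m (col_of U l)"
      using nrm_pivot_other(2)[of p m U i l, OF p pos False] by (simp add: UF')
    then have "nrm p m (col_of U l) = 0 \<Longrightarrow> nrm p m (col_of U' l) = 0"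
      using nrm_nonneg[of p m "col_of U' l"] by linarith
    moreover have "F' l = F l" using False by (simp add: UF' pivot_right_def fun_eq_iff)
    ultimately show ?thesis using w that by (auto simp: well_factored_def)
  qed
  then show ?thesis using factors_pivot[OF p f i pos] by (simp add: well_factored_def UF')
qed

lemma well_factored_pass:
  assumes p: "1 \<le> p" and th: "0 \<le> th" and w: "well_factored p m d A (fst UF) (snd UF)"
  shows "i \<le> d \<Longrightarrow> well_factored p m d A (fst (pivot_pass p m d th i UF)) (snd (pivot_pass p m d th i UF))"
proof (induction i)
  case (Suc i)
  then show ?case
    using well_factored_step[OF p th, of i d m A _ _ "fst (pivot_pass p m d th (Suc i) UF)"]
    by (metis Suc_le_lessD Suc_leD pivot_pass.simps(2) prod.collapse)
qed (use w in simp)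

text \<open>The count is \<open>Suc r\<close> because the unit rows at nonzero columns disappear
  only with the first pass.\<close>

lemma well_factored_passes:
  assumes p: "1 \<le> p"
  shows "well_factored p m d A (fst (pivot_passes p m d (Suc r) (A, id_fun)))
    (snd (pivot_passes p m d (Suc r) (A, id_fun)))"
proof (induction r)
  case 0
  show ?case
    using first_pass_invariant[OF p order_refl surjective_pairing, of m d A]
    by (simp add: well_factored_def)
next
  case (Suc r)
  show ?case
    using well_factored_pass[OF p _ Suc, of 2 d]
    by (subst pivot_passes.simps(2), subst (1) pivot_passes.simps(2)) simp
qed

text \<open>
  Rows of the ghost matrix \<open>M\<close> have bounded entries, whereas every pivot of a column of norm above 2
  doubles its determinant. Hence such pivots occur in few rounds only.
\<close>

definition ghost :: "real \<Rightarrow> nat \<Rightarrow> nat \<Rightarrow> (nat \<Rightarrow> nat \<Rightarrow> real) \<Rightarrow> (nat \<Rightarrow> nat \<Rightarrow> real) \<Rightarrow> nat \<Rightarrow> bool" where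
  "ghost p m d U0 U r \<longleftrightarrow> (\<exists>M. factors m d U0 U M \<and>
     (\<forall>l<d. (\<forall>j<d. M l j = id_fun l j) \<or> bounded_row p m d U0 (M l)) \<and> 2 ^ r \<le> \<bar>fun_det d M\<bar>)"

lemma ghost_start: "ghost p m d U U 0"
  unfolding ghost_def by (intro exI[of _ id_fun]) (simp add: factors_id fun_det_id)

lemma ghost_mono: "ghost p m d U0 U (Suc r) \<Longrightarrow> ghost p m d U0 U r"
  unfolding ghost_def
proof (elim exE conjE)
  fix M
  assume M: "factors m d U0 U M"
    "\<forall>l<d. (\<forall>j<d. M l j = id_fun l j) \<or> bounded_row p m d U0 (M l)"
    "2 ^ Suc r \<le> \<bar>fun_det d M\<bar>"
  have "(2::real) ^ r \<le> 2 ^ Suc r" by simp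
  then have "2 ^ r \<le> \<bar>fun_det d M\<bar>" using M(3) by linarith
  then show "\<exists>M. factors m d U0 U M \<and>
      (\<forall>l<d. (\<forall>j<d. M l j = id_fun l j) \<or> bounded_row p m d U0 (M l)) \<and> 2 ^ r \<le> \<bar>fun_det d M\<bar>"
    using M(1,2) by blast
qed

text \<open>\<open>M\<close> records the pivots since the reference state, with
  \<open>U0 = U M\<close>. A pivot multiplies its determinant by \<open>coef p m U i i\<close>,
  which is the norm of column \<open>i\<close>, and the new row is bounded in terms of
  \<open>U0\<close>. Starting afresh with the identity makes the count independent of the scale of
  \<open>A\<close>.\<close>

lemma ghost_pivot:
  assumes p: "1 \<le> p" and i: "i < d" and g: "ghost p m d U0 U r" and N: "2 < nrm p m (col_of U i)"
  shows "ghost p m d U0 (pivot_left p m U i) (Suc r)"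
proof -
  obtain M where M: "factors m d U0 U M" "2 ^ r \<le> \<bar>fun_det d M\<bar>"
    "\<And>l. l < d \<Longrightarrow> (\<forall>j<d. M l j = id_fun l j) \<or> bounded_row p m d U0 (M l)"
    using g by (auto simp: ghost_def)
  define M' where "M' = pivot_right p m d U M i"
  have "fun_det d M' = coef p m U i i * fun_det d M"
    unfolding M'_def pivot_right_def by (rule fun_det_replace_row[OF i])
  then have "\<bar>fun_det d M'\<bar> = nrm p m (col_of U i) * \<bar>fun_det d M\<bar>"
    by (simp add: coef_self[OF p] abs_mult)
  then have "2 * 2 ^ r \<le> \<bar>fun_det d M'\<bar>"
    using N M(2) mult_mono[of 2 "nrm p m (col_of U i)" "2 ^ r" "\<bar>fun_det d M\<bar>"] by simp
  moreover have "(\<forall>j<d. M' l j = id_fun l j) \<or> bounded_row p m d U0 (M' l)" if "l < d" for l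
  proof (cases "l = i")
    case True
    then show ?thesis using bounded_row_pivot[OF p M(1)] by (simp add: M'_def)
  next
    case False
    then have "M' l = M l" by (simp add: M'_def pivot_right_def fun_eq_iff)
    then show ?thesis using M(3)[OF that] by simp
  qed
  moreover have "factors m d U0 (pivot_left p m U i) M'"
    unfolding M'_def using factors_pivot[OF p M(1) i] N by simp
  ultimately show ?thesis unfolding ghost_def by (intro exI[of _ M']) simp
qed

text \<open>As long as nothing is pivoted, the columns inspected so far have norm at most 2 in the
  unchanged state. The first pivot raises the exponent to \<open>Suc r\<close>; one doubling per
  pass is enough, so \<open>ghost_mono\<close> gives away the others.\<close>

lemma pass_unchanged_or_ghost:
  assumes p: "1 \<le> p" and g: "ghost p m d U0 (fst UF) r"
  shows "i \<le> d \<Longrightarrow> (pivot_pass p m d 2 i UF = UF \<and> (\<forall>l<i. nrm p m (col_of (fst UF) l) \<le> 2)) \<or>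
    ghost p m d U0 (fst (pivot_pass p m d 2 i UF)) (Suc r)"
proof (induction i)
  case (Suc i)
  obtain V G where VG: "pivot_pass p m d 2 i UF = (V, G)" by (metis surj_pair)
  have IH: "(UF = (V, G) \<and> (\<forall>l<i. nrm p m (col_of V l) \<le> 2)) \<or> ghost p m d U0 V (Suc r)"
    using Suc VG by auto
  have i: "i < d" using Suc.prems by simp
  show ?case
  proof (cases rule: step_cases[of p m d 2 i V G])
    case 1
    then have "pivot_pass p m d 2 (Suc i) UF = (V, G)" using VG by simp
    moreover have "\<forall>l<Suc i. nrm p m (col_of V l) \<le> 2" if "\<forall>l<i. nrm p m (col_of V l) \<le> 2"
      using that 1(2) less_Suc_eq by auto
    ultimately show ?thesis using IH by (metis fst_conv)
  next
    case 2
    have "ghost p m d U0 V r" using IH g ghost_mono by (metis fst_conv)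
    then have "ghost p m d U0 (pivot_left p m V i) (Suc r)"
      using ghost_pivot[of p i d m U0 V r] p i 2(2) by blast
    moreover have "pivot_pass p m d 2 (Suc i) UF = (pivot_left p m V i, pivot_right p m d V G i)"
      using VG 2(1) by simp
    ultimately show ?thesis by (metis fst_conv)
  qed
qed simp

lemma pass_idle:
  assumes "\<forall>l<d. nrm p m (col_of (fst UF) l) \<le> 2"
  shows "i \<le> d \<Longrightarrow> pivot_pass p m d 2 i UF = UF"
  using assms by (induction i) (auto simp: pivot_step_def Suc_le_eq)

lemma passes_small_or_ghost:
  assumes p: "1 \<le> p"
  shows "(\<forall>l<d. nrm p m (col_of (fst (pivot_passes p m d (Suc r) UF)) l) \<le> 2) \<or>
    ghost p m d (fst (pivot_passes p m d 1 UF)) (fst (pivot_passes p m d (Suc r) UF)) r"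
proof (induction r)
  case 0
  show ?case by (simp add: ghost_start)
next
  case (Suc r)
  let ?V = "pivot_passes p m d (Suc r) UF"
  have e: "pivot_passes p m d (Suc (Suc r)) UF = pivot_pass p m d 2 d ?V" by simp
  from Suc show ?case
  proof
    assume "\<forall>l<d. nrm p m (col_of (fst ?V) l) \<le> 2"
    then show ?thesis using pass_idle[of d p m ?V d] unfolding e by simp
  next
    assume "ghost p m d (fst (pivot_passes p m d 1 UF)) (fst ?V) r"
    from pass_unchanged_or_ghost[OF p this order_refl] show ?thesis unfolding e by auto
  qed
qed

text \<open>If a column stayed above 2, each of the \<open>2 * d * d + 1\<close> passes after the
  first would contain a doubling pivot. But a row of \<open>M\<close>, tested on unit vectors, has
  entries at most \<open>2 ^ d\<close>, the column bound of the first pass, so by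
  \<open>fact d \<le> (2 ^ d) ^ d\<close> the Leibniz bound is only
  \<open>2 ^ (2 * d * d)\<close>.\<close>

lemma passes_small:
  assumes p: "1 \<le> p" and l: "l < d"
  shows "nrm p m (col_of (fst (pivot_passes p m d (2 * d * d + 2) (A, id_fun))) l) \<le> 2"
proof (rule ccontr)
  let ?r = "Suc (2 * d * d)"
  let ?U0 = "fst (pivot_passes p m d 1 (A, id_fun))"
  have e: "2 * d * d + 2 = Suc ?r" by simp
  assume "\<not> ?thesis"
  then obtain M where M: "2 ^ ?r \<le> \<bar>fun_det d M\<bar>"
    "\<And>l. l < d \<Longrightarrow> (\<forall>j<d. M l j = id_fun l j) \<or> bounded_row p m d ?U0 (M l)"
    using passes_small_or_ghost[OF p, of d m ?r "(A, id_fun)"] l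
    unfolding e ghost_def by blast
  have U0: "nrm p m (col_of ?U0 j) \<le> 2 ^ d" if "j < d" for j
    using first_pass_invariant[OF p order_refl surjective_pairing, of m d A] that by simp
  have bnd: "\<bar>M i j\<bar> \<le> 2 ^ d" if i: "i < d" and j: "j < d" for i j
    using M(2)[OF i]
  proof
    assume "\<forall>j<d. M i j = id_fun i j"
    then have "\<bar>M i j\<bar> \<le> 1" using j by (simp add: id_fun_def)
    then show ?thesis using one_le_power[of "2::real" d] by linarith
  next
    assume "bounded_row p m d ?U0 (M i)"
    then have "\<bar>\<Sum>l<d. M i l * (if l = j then 1 else 0)\<bar>
        \<le> nrm p m (mat_app d ?U0 (\<lambda>l. if l = j then 1 else 0))"
      unfolding bounded_row_def by (rule spec)
    moreover have "mat_app d ?U0 (\<lambda>l. if l = j then 1 else 0) = col_of ?U0 j"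
      using j by (simp add: mat_app_def fun_eq_iff if_distrib sum.delta cong: if_cong)
    ultimately show ?thesis using j U0[OF j] by (simp add: if_distrib sum.delta cong: if_cong)
  qed
  have "2 ^ ?r \<le> (fact d * (2 ^ d) ^ d :: real)"
    using M(1) abs_fun_det_le[of d M "2 ^ d", OF bnd] by linarith
  also have "(fact d :: real) \<le> (2 ^ d) ^ d"
  proof -
    have "(fact d :: real) \<le> real d ^ d"
      by (metis fact_le_power of_nat_fact of_nat_le_iff of_nat_power order_refl)
    also have "\<dots> \<le> (2 ^ d) ^ d" using of_nat_less_two_power[of d, where 'a = real] by (intro power_mono) auto
    finally show ?thesis .
  qed
  finally have "(2::real) ^ ?r \<le> (2 ^ d) ^ d * (2 ^ d) ^ d" by simp
  also have "\<dots> = 2 ^ (2 * d * d)" by (simp add: power_mult[symmetric] power_add[symmetric] algebra_simps)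
  finally show False by simp
qed

text \<open>
  The factor \<open>nrm p m (col_of U i)\<close> cancels the rows that belong to zero columns, and makes the case
  \<open>d = 1\<close> exact.
\<close>

definition summary_fun ::
  "real \<Rightarrow> nat \<Rightarrow> nat \<Rightarrow> (nat \<Rightarrow> nat \<Rightarrow> real) \<Rightarrow> nat \<Rightarrow> nat \<Rightarrow> real" where
  "summary_fun p m d A i j = (let (U, F) = pivot_passes p m d (2 * d * d + 2) (A, id_fun)
     in F i j * nrm p m (col_of U i) / real (d * d))"

lemma app_summary:
  "mat_app d (summary_fun p m d A) x l =
     mat_app d (snd (pivot_passes p m d (2 * d * d + 2) (A, id_fun))) x l *
     nrm p m (col_of (fst (pivot_passes p m d (2 * d * d + 2) (A, id_fun))) l) / real (d * d)"
  by (simp add: mat_app_def summary_fun_def case_prod_beta sum_distrib_right sum_divide_distrib ac_simps)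

text \<open>\<open>A x\<close> is the combination of the columns of \<open>U\<close> with
  coefficients \<open>F x\<close>. The upper bound adds \<open>d\<close> entries, each at most
  \<open>2 / (d * d)\<close> times the norm of \<open>A x\<close>; the lower bound is the triangle
  inequality with \<open>d\<close> summands, each scaled back by \<open>d * d\<close>.\<close>

theorem nrm_summary_fun:
  assumes p: "1 \<le> p" and d: "1 \<le> d"
  shows "nrm p d (mat_app d (summary_fun p m d A) x) \<le> nrm p m (mat_app d A x)"
    and "nrm p m (mat_app d A x) \<le> real d ^ 3 * nrm p d (mat_app d (summary_fun p m d A) x)"
proof -
  define U F where "U = fst (pivot_passes p m d (2 * d * d + 2) (A, id_fun))"
    and "F = snd (pivot_passes p m d (2 * d * d + 2) (A, id_fun))"
  let ?y = "mat_app d (summary_fun p m d A) x"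
  define y where "y = ?y"
  have y: "y l = mat_app d F x l * nrm p m (col_of U l) / real (d * d)" for l
    by (simp only: y_def app_summary U_def F_def)
  have w: "well_factored p m d A U F"
    using well_factored_passes[OF p, of m d A "2 * d * d + 1"] by (simp add: U_def F_def)
  have small: "nrm p m (col_of U l) \<le> 2" if "l < d" for l
    using passes_small[OF p that] by (simp add: U_def)
  have Ax: "nrm p m (mat_app d A x) = nrm p m (\<lambda>k. \<Sum>l<d. mat_app d F x l * U k l)"
    using w by (intro nrm_cong) (simp add: app_factors[of m d A U F] well_factored_def mult.commute)
  have dd: "0 < real (d * d)" using d by simp
  have abs_y: "\<bar>y l\<bar> * real (d * d) = \<bar>mat_app d F x l\<bar> * nrm p m (col_of U l)" for l
    using d by (simp add: y abs_mult)
  have "nrm p d y \<le> nrm p m (mat_app d A x)"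
  \<comment> \<open>For \<open>d \<ge> 2\<close> the column bound 2 is absorbed by one of the two
    factors \<open>d\<close> of the divisor. For \<open>d = 1\<close> there is a single column and
    the summary is exact.\<close>
  proof (cases "d = 1")
    case True
    have "nrm p m (mat_app d A x) = \<bar>mat_app d F x 0\<bar> * nrm p m (col_of U 0)"
      unfolding Ax using True nrm_scale[OF p, of m "mat_app d F x 0" "col_of U 0"] by simp
    also have "\<dots> = \<bar>y 0\<bar>" using abs_y[of 0] True by simp
    also have "\<dots> = nrm p d y"
      using True p by (simp add: nrm_def mass_def powr_powr)
    finally show ?thesis by simp
  next
    case False
    then have d2: "2 \<le> real d" using d by simp
    have "\<bar>y l\<bar> \<le> nrm p m (mat_app d A x) / d" if l: "l < d" for l
    proof -
      have "\<bar>mat_app d F x l\<bar> * nrm p m (col_of U l) \<le> nrm p m (mat_app d A x) * real d"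
      proof (cases "nrm p m (col_of U l) = 0")
        case False
        then have "\<bar>mat_app d F x l\<bar> \<le> nrm p m (mat_app d A x)"
          using w l unfolding well_factored_def bounded_row_def mat_app_def by blast
        then show ?thesis using small[OF l] d2 by (intro mult_mono) auto
      qed simp
      then have "\<bar>y l\<bar> * real d * real d \<le> nrm p m (mat_app d A x) * real d"
        using abs_y[of l] by (simp add: mult.assoc)
      then have "\<bar>y l\<bar> * real d \<le> nrm p m (mat_app d A x)"
        using d2 by (simp add: mult_le_cancel_right)
      then show ?thesis using d2 by (simp add: pos_le_divide_eq)
    qed
    then have "(\<Sum>l<d. \<bar>y l\<bar>) \<le> (\<Sum>l<d. nrm p m (mat_app d A x) / d)"
      by (intro sum_mono) auto
    then show ?thesis using nrm_le_sum_components[OF p, of d y] d by simp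
  qed
  then show "nrm p d ?y \<le> nrm p m (mat_app d A x)" unfolding y_def .
  have "nrm p m (mat_app d A x) \<le> (\<Sum>l<d. \<bar>mat_app d F x l\<bar> * nrm p m (col_of U l))"
    unfolding Ax by (rule nrm_sum_le[OF p])
  also have "\<dots> = (\<Sum>l<d. \<bar>y l\<bar> * real (d * d))" by (simp only: abs_y)
  also have "\<dots> \<le> (\<Sum>l<d. nrm p d y * real (d * d))"
    using component_le_nrm[OF p] by (intro sum_mono mult_right_mono) auto
  also have "\<dots> = real d ^ 3 * nrm p d y" by (simp add: power3_eq_cube)
  finally show "nrm p m (mat_app d A x) \<le> real d ^ 3 * nrm p d ?y" unfolding y_def .
qed

section \<open>Weakest preconditions with running time\<close>

text \<open>Values are total and safety is a separate predicate, so that both unfold by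
  simplification instead of passing through options.\<close>

primrec ival :: "state \<Rightarrow> iexp \<Rightarrow> nat" where
  "ival s (IConst k) = k"
| "ival s (IReg r) = regs s r"
| "ival s (IAdd e f) = ival s e + ival s f"
| "ival s (ISub e f) = ival s e - ival s f"
| "ival s (IMul e f) = ival s e * ival s f"
| "ival s (IDiv e f) = ival s e div ival s f"

text \<open>Sums and products need a word check of their own. A truncated difference or a quotient
  is at most its first operand, which is already within the limit.\<close>

primrec isafe :: "nat \<Rightarrow> state \<Rightarrow> iexp \<Rightarrow> bool" where
  "isafe W s (IConst k) \<longleftrightarrow> k \<le> W"
| "isafe W s (IReg r) \<longleftrightarrow> regs s r \<le> W"
| "isafe W s (IAdd e f) \<longleftrightarrow> isafe W s e \<and> isafe W s f \<and> ival s e + ival s f \<le> W"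
| "isafe W s (ISub e f) \<longleftrightarrow> isafe W s e \<and> isafe W s f"
| "isafe W s (IMul e f) \<longleftrightarrow> isafe W s e \<and> isafe W s f \<and> ival s e * ival s f \<le> W"
| "isafe W s (IDiv e f) \<longleftrightarrow> isafe W s e \<and> isafe W s f \<and> ival s f \<noteq> 0"

primrec rval :: "state \<Rightarrow> rexp \<Rightarrow> real" where
  "rval s (RConst c) = c"
| "rval s (RIndex e) = real (ival s e)"
| "rval s (RCell e) = mem s (ival s e)"
| "rval s (RAdd e f) = rval s e + rval s f"
| "rval s (RSub e f) = rval s e - rval s f"
| "rval s (RMul e f) = rval s e * rval s f"
| "rval s (RDiv e f) = rval s e / rval s f"
| "rval s (RPow e c) = \<bar>rval s e\<bar> powr c"

primrec rsafe :: "nat \<Rightarrow> nat \<Rightarrow> state \<Rightarrow> rexp \<Rightarrow> bool" where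
  "rsafe S W s (RConst c) \<longleftrightarrow> True"
| "rsafe S W s (RIndex e) \<longleftrightarrow> isafe W s e"
| "rsafe S W s (RCell e) \<longleftrightarrow> isafe W s e \<and> ival s e < S"
| "rsafe S W s (RAdd e f) \<longleftrightarrow> rsafe S W s e \<and> rsafe S W s f"
| "rsafe S W s (RSub e f) \<longleftrightarrow> rsafe S W s e \<and> rsafe S W s f"
| "rsafe S W s (RMul e f) \<longleftrightarrow> rsafe S W s e \<and> rsafe S W s f"
| "rsafe S W s (RDiv e f) \<longleftrightarrow> rsafe S W s e \<and> rsafe S W s f \<and> rval s f \<noteq> 0"
| "rsafe S W s (RPow e c) \<longleftrightarrow> rsafe S W s e"

primrec bval :: "state \<Rightarrow> bexp \<Rightarrow> bool" where
  "bval s (BILess e f) \<longleftrightarrow> ival s e < ival s f"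
| "bval s (BRLess e f) \<longleftrightarrow> rval s e < rval s f"
| "bval s (BNot e) \<longleftrightarrow> \<not> bval s e"
| "bval s (BAnd e f) \<longleftrightarrow> bval s e \<and> bval s f"

primrec bsafe :: "nat \<Rightarrow> nat \<Rightarrow> state \<Rightarrow> bexp \<Rightarrow> bool" where
  "bsafe S W s (BILess e f) \<longleftrightarrow> isafe W s e \<and> isafe W s f"
| "bsafe S W s (BRLess e f) \<longleftrightarrow> rsafe S W s e \<and> rsafe S W s f"
| "bsafe S W s (BNot e) \<longleftrightarrow> bsafe S W s e"
| "bsafe S W s (BAnd e f) \<longleftrightarrow> bsafe S W s e \<and> bsafe S W s f"

lemma isafe_ival_le: "isafe W s e \<Longrightarrow> ival s e \<le> W"
  by (induction e) (auto intro: le_trans[OF diff_le_self] le_trans[OF div_le_dividend])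

lemma ieval_isafe: "isafe W s e \<Longrightarrow> ieval W s e = Some (ival s e)"
proof (induction e)
  case (ISub e f)
  then show ?case using isafe_ival_le[of W s e] by (auto simp: word_def)
next
  case (IDiv e f)
  then show ?case
    using isafe_ival_le[of W s e] le_trans[OF div_le_dividend] by (auto simp: word_def)
qed (auto simp: word_def)

lemma reval_rsafe: "rsafe S W s e \<Longrightarrow> reval S W s e = Some (rval s e)"
  by (induction e) (auto simp: ieval_isafe)

lemma beval_bsafe: "bsafe S W s b \<Longrightarrow> beval S W s b = Some (bval s b)"
  by (induction b) (auto simp: ieval_isafe reval_rsafe)

text \<open>Total correctness, with the exact running time handed to the postcondition. Since
  \<open>exec\<close> is deterministic, some halting run is the only one.\<close>

definition wp :: "nat \<Rightarrow> nat \<Rightarrow> com \<Rightarrow> state \<Rightarrow> (nat \<Rightarrow> state \<Rightarrow> bool) \<Rightarrow> bool" where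
  "wp S W c s Q \<longleftrightarrow> (\<exists>t s'. exec S W c s t s' \<and> Q t s')"

lemma wp_mono: "wp S W c s P \<Longrightarrow> (\<And>t s'. P t s' \<Longrightarrow> Q t s') \<Longrightarrow> wp S W c s Q"
  unfolding wp_def by blast

lemma wp_Skip: "Q 1 s \<Longrightarrow> wp S W Skip s Q"
  unfolding wp_def using exec.Skip by blast

lemma wp_ISet:
  "isafe W s e \<Longrightarrow> Q (1 + icost e) (s\<lparr>regs := (regs s)(r := ival s e)\<rparr>) \<Longrightarrow> wp S W (ISet r e) s Q"
  unfolding wp_def using exec.ISet[OF ieval_isafe] by blast

lemma wp_RStore:
  "isafe W s e \<Longrightarrow> ival s e < S \<Longrightarrow> rsafe S W s f \<Longrightarrow>
   Q (1 + icost e + rcost f) (s\<lparr>mem := (mem s)(ival s e := rval s f)\<rparr>) \<Longrightarrow> wp S W (RStore e f) s Q"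
  unfolding wp_def using exec.RStore[OF ieval_isafe _ reval_rsafe] by blast

lemma wp_Seq:
  "wp S W c s (\<lambda>t s'. wp S W c' s' (\<lambda>t' s''. Q (t + t') s'')) \<Longrightarrow> wp S W (Seq c c') s Q"
  unfolding wp_def using exec.Seq by blast

lemma wp_Cond:
  assumes "bsafe S W s b"
    and "bval s b \<Longrightarrow> wp S W c s (\<lambda>t. Q (1 + bcost b + t))"
    and "\<not> bval s b \<Longrightarrow> wp S W c' s (\<lambda>t. Q (1 + bcost b + t))"
  shows "wp S W (Cond b c c') s Q"
  using assms beval_bsafe[OF assms(1)] exec.CondTrue[of S W s b] exec.CondFalse[of S W s b]
  unfolding wp_def by (cases "bval s b") (metis (full_types))+

lemma wp_RStore_Seq:
  assumes "isafe W s e" "ival s e < S" "rsafe S W s f"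
    and "s\<lparr>mem := (mem s)(ival s e := rval s f)\<rparr> = s'"
    and "wp S W c s' P" and "\<And>t q. P t q \<Longrightarrow> Q (1 + icost e + rcost f + t) q"
  shows "wp S W (Seq (RStore e f) c) s Q"
  using assms(5,6) by (intro wp_Seq wp_RStore assms(1-3)) (unfold assms(4), rule wp_mono)

lemma wp_runs:
  "wp S W c s (\<lambda>t s'. real t \<le> \<tau> \<and> Q s') \<Longrightarrow> \<exists>s'. runs S W \<tau> c s s' \<and> Q s'"
  unfolding wp_def runs_def by blast

lemma wp_ISet_Seq:
  assumes "isafe W s e" and "s\<lparr>regs := (regs s)(r := ival s e)\<rparr> = s'"
    and "wp S W c s' P" and "\<And>t q. P t q \<Longrightarrow> Q (1 + icost e + t) q"
  shows "wp S W (Seq (ISet r e) c) s Q"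
  using assms(3,4) by (intro wp_Seq wp_ISet assms(1)) (unfold assms(2), rule wp_mono)

definition For :: "nat \<Rightarrow> iexp \<Rightarrow> com \<Rightarrow> com" where
  "For r e c = Seq (ISet r (IConst 0))
     (While (BILess (IReg r) e) (Seq c (ISet r (IAdd (IReg r) (IConst 1)))))"

text \<open>Every loop of the programs runs a number \<open>N\<close> of times that is known in
  advance, so the iteration index serves as variant and the time is a product.\<close>

lemma wp_While:
  assumes inv: "I 0 s"
    and body: "\<And>i s. i < N \<Longrightarrow> I i s \<Longrightarrow> bsafe S W s b \<and> bval s b \<and>
       wp S W c s (\<lambda>t s'. t \<le> \<tau> \<and> I (Suc i) s')"
    and exit: "\<And>s. I N s \<Longrightarrow> bsafe S W s b \<and> \<not> bval s b"
    and post: "\<And>t s'. t \<le> (N + 1) * (\<tau> + bcost b + 1) \<Longrightarrow> I N s' \<Longrightarrow> Q t s'"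
  shows "wp S W (While b c) s Q"
proof -
  have "i \<le> N \<Longrightarrow> I i s \<Longrightarrow>
    \<exists>t s'. exec S W (While b c) s t s' \<and> t \<le> (N - i + 1) * (\<tau> + bcost b + 1) \<and> I N s'" for i s
  proof (induction "N - i" arbitrary: i s)
    case 0
    then have "I N s" by simp
    then show ?case
      using exec.WhileFalse[of S W s b c] exit[of s] beval_bsafe[of S W s b]
      by (intro exI[of _ "1 + bcost b"] exI[of _ s]) auto
  next
    case (Suc n)
    then have i: "i < N" by simp
    from body[OF i Suc.prems(2)] obtain t s' where
      1: "bsafe S W s b" "bval s b" "exec S W c s t s'" "t \<le> \<tau>" "I (Suc i) s'"
      by (auto simp: wp_def)
    have "n = N - Suc i" using Suc.hyps(2) by simp
    from Suc.hyps(1)[OF this _ 1(5)] i obtain t' s'' where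
      2: "exec S W (While b c) s' t' s''" "t' \<le> (N - Suc i + 1) * (\<tau> + bcost b + 1)" "I N s''"
      by auto
    have "exec S W (While b c) s (1 + bcost b + t + t') s''"
      using exec.WhileTrue[OF _ 1(3) 2(1)] beval_bsafe[OF 1(1)] 1(2) by simp
    moreover have "N - i + 1 = Suc (N - Suc i + 1)" using i by simp
    then have "1 + bcost b + t + t' \<le> (N - i + 1) * (\<tau> + bcost b + 1)"
      using 1(4) 2(2) by simp
    ultimately show ?case using 2(3) by blast
  qed
  from this[of 0 s] inv post show ?thesis by (auto simp: wp_def)
qed

text \<open>The body takes \<open>a * X\<close> and the loop \<open>(a + 22) * (D * X)\<close>:
  nesting multiplies the size factors and only adds to the constant. The overhead per iteration is 4
  for the increment, at most 14 for the test and 1 for the loop; setting the counter costs 2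
  once.\<close>

lemma wp_For:
  assumes inv: "I 0 (s\<lparr>regs := (regs s)(r := 0)\<rparr>)"
    and bound: "\<And>i s'. i \<le> N \<Longrightarrow> I i s' \<Longrightarrow> regs s' r = i \<Longrightarrow> isafe W s' e \<and> ival s' e = N"
    and W: "N \<le> W" "1 \<le> W"
    and body: "\<And>i s'. i < N \<Longrightarrow> I i s' \<Longrightarrow> regs s' r = i \<Longrightarrow>
      wp S W c s' (\<lambda>t s''. t \<le> a * X \<and> regs s'' r = i \<and> I (Suc i) (s''\<lparr>regs := (regs s'')(r := Suc i)\<rparr>))"
    and e: "icost e \<le> 12" and X: "1 \<le> X" and D: "N < D"
    and post: "\<And>t s'. t \<le> (a + 22) * (D * X) \<Longrightarrow> I N s' \<Longrightarrow> regs s' r = N \<Longrightarrow> Q t s'"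
  shows "wp S W (For r e c) s Q"
  unfolding For_def
  apply (rule wp_Seq)
  apply (rule wp_ISet)
   apply simp
  apply (rule wp_While[where I = "\<lambda>i s. I i s \<and> regs s r = i" and N = N and \<tau> = "a * X + 4"])
proof -
  show "I 0 (s\<lparr>regs := (regs s)(r := ival s (IConst 0))\<rparr>) \<and>
    regs (s\<lparr>regs := (regs s)(r := ival s (IConst 0))\<rparr>) r = 0" using inv by simp
next
  fix i s assume i: "i < N" and I: "I i s \<and> regs s r = i"
  have 1: "isafe W s e" "ival s e = N" using bound[of i s] i I by auto
  have "wp S W (Seq c (ISet r (IAdd (IReg r) (IConst 1)))) s
     (\<lambda>t s'. t \<le> a * X + 4 \<and> I (Suc i) s' \<and> regs s' r = Suc i)"
    apply (rule wp_Seq)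
    apply (rule wp_mono[OF body[OF i]])
      apply (use I in simp)
     apply (use I in simp)
    apply (rule wp_ISet)
    using i W by auto
  then show "bsafe S W s (BILess (IReg r) e) \<and> bval s (BILess (IReg r) e) \<and>
     wp S W (Seq c (ISet r (IAdd (IReg r) (IConst 1)))) s
     (\<lambda>t s'. t \<le> a * X + 4 \<and> I (Suc i) s' \<and> regs s' r = Suc i)"
    using 1 i I W by simp
next
  fix s assume "I N s \<and> regs s r = N"
  then show "bsafe S W s (BILess (IReg r) e) \<and> \<not> bval s (BILess (IReg r) e)"
    using bound[of N s] W by simp
next
  fix t s' assume t: "t \<le> (N + 1) * (a * X + 4 + bcost (BILess (IReg r) e) + 1)"
    and I: "I N s' \<and> regs s' r = N"
  have "t \<le> (N + 1) * (a * X + 19)"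
    by (rule order_trans[OF t]) (use e in \<open>intro mult_le_mono2, simp\<close>)
  then have "1 + icost (IConst 0) + t \<le> (N + 1) * (a * X + 21)" by (simp add: algebra_simps)
  also have "\<dots> \<le> D * (a * X + 22 * X)" using X D by (intro mult_le_mono) auto
  also have "\<dots> = (a + 22) * (D * X)" by (simp add: algebra_simps)
  finally show "Q (1 + icost (IConst 0) + t) s'" using post I by auto
qed

text \<open>Loop bodies only modify registers above their loop counter.\<close>

definition frame :: "nat \<Rightarrow> state \<Rightarrow> state \<Rightarrow> bool" where
  "frame n s s' \<longleftrightarrow> (\<forall>r<n. regs s' r = regs s r)"

lemma frame_refl [simp]: "frame n s s"
  by (simp add: frame_def)

lemma frame_mem [simp]: "frame n s (s'\<lparr>mem := x\<rparr>) = frame n s s'"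
  by (simp add: frame_def)

text \<open>The invariant \<open>J\<close> speaks of the memory only. Nested loops use increasing
  counter registers, so all registers below the counter are preserved, and the loop bound has its
  value in every framed state.\<close>

lemma wp_For_frame:
  assumes inv: "J 0 (mem s)"
    and bound: "\<And>s'. frame r s s' \<Longrightarrow> isafe W s' e \<and> ival s' e = N"
    and W: "N \<le> W" "1 \<le> W"
    and body: "\<And>i s'. i < N \<Longrightarrow> J i (mem s') \<Longrightarrow> regs s' r = i \<Longrightarrow> frame r s s' \<Longrightarrow>
      wp S W c s' (\<lambda>t s''. t \<le> a * X \<and> frame (Suc r) s' s'' \<and> J (Suc i) (mem s''))"
    and e: "icost e \<le> 12" and X: "1 \<le> X" and D: "N < D"
    and post: "\<And>t s'. t \<le> (a + 22) * (D * X) \<Longrightarrow> frame r s s' \<Longrightarrow> J N (mem s') \<Longrightarrow> Q t s'"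
  shows "wp S W (For r e c) s Q"
proof (rule wp_For[where I = "\<lambda>i s'. frame r s s' \<and> J i (mem s')" and N = N and a = a and X = X and D = D])
  fix i s' assume i: "i < N" and I: "frame r s s' \<and> J i (mem s')" and r: "regs s' r = i"
  show "wp S W c s' (\<lambda>t s''. t \<le> a * X \<and> regs s'' r = i \<and>
      frame r s (s''\<lparr>regs := (regs s'')(r := Suc i)\<rparr>) \<and>
      J (Suc i) (mem (s''\<lparr>regs := (regs s'')(r := Suc i)\<rparr>)))"
    by (rule wp_mono[OF body[OF i _ r]]) (use I r in \<open>auto simp: frame_def\<close>)
qed (use assms in \<open>auto simp: frame_def\<close>)

section \<open>Memory layout and the pivoting program\<close>

text \<open>
  Registers 9, 10 and 11 hold the base addresses of the \<open>m\<close> by \<open>d\<close> input block \<open>U\<close>, the \<open>d\<close> by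
  \<open>d\<close> matrix \<open>F\<close> and a scratch vector \<open>c\<close>. The scratch vector has two more cells, an accumulator
  at position \<open>d\<close> and a temporary at position \<open>d + 1\<close>.
\<close>

definition cell_U :: "nat \<Rightarrow> nat \<Rightarrow> iexp" where
  "cell_U a b = IAdd (IReg 9) (IAdd (IMul (IReg a) (IReg 1)) (IReg b))"

definition cell_F :: "nat \<Rightarrow> nat \<Rightarrow> iexp" where
  "cell_F a b = IAdd (IReg 10) (IAdd (IMul (IReg a) (IReg 1)) (IReg b))"

definition cell_c :: "nat \<Rightarrow> iexp" where
  "cell_c a = IAdd (IReg 11) (IReg a)"

definition cell_acc :: iexp where
  "cell_acc = IAdd (IReg 11) (IReg 1)"

definition cell_tmp :: iexp where
  "cell_tmp = IAdd (IReg 11) (IAdd (IReg 1) (IConst 1))"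

lemma icost_cell [simp]:
  "icost (cell_U a b) = 7" "icost (cell_F a b) = 7" "icost (cell_c a) = 3"
  "icost cell_acc = 3" "icost cell_tmp = 5"
  by (simp_all add: cell_U_def cell_F_def cell_c_def cell_acc_def cell_tmp_def)

lemma mat_index_less:
  fixes i j m d :: nat
  assumes "i < m" "j < d"
  shows "i * d + j < m * d"
proof -
  have "i * d + j < Suc i * d" using assms by simp
  also have "\<dots> \<le> m * d" using assms by (intro mult_le_mono1) simp
  finally show ?thesis .
qed

lemma mat_index_inj:
  fixes i j i' j' d :: nat
  assumes "j < d" "j' < d"
  shows "i * d + j = i' * d + j' \<longleftrightarrow> i = i' \<and> j = j'"
  using assms by (metis add.commute div_mult_self1 div_less mod_less mod_mult_self1 add_0 less_nat_zero_code)

text \<open>A gap between the block and \<open>F\<close> is allowed, because the streaming algorithm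
  compresses one level inside its buffer. The bound \<open>2 * d * d + 2 \<le> W\<close> is for the
  counter of the passes.\<close>

locale layout =
  fixes S W m d B Fb Cb :: nat
  assumes lay: "B + m * d \<le> Fb" "Fb + d * d \<le> Cb" "Cb + d + 2 \<le> S" "S \<le> W"
    "2 * d * d + 2 \<le> W" and d: "1 \<le> d"
begin

definition env :: "state \<Rightarrow> bool" where
  "env s \<longleftrightarrow> regs s 1 = d \<and> regs s 8 = m \<and> regs s 9 = B \<and> regs s 10 = Fb \<and> regs s 11 = Cb"

lemma env_mem [simp]: "env (s\<lparr>mem := x\<rparr>) = env s"
  by (simp add: env_def)

lemma env_frame: "frame n s s' \<Longrightarrow> 12 \<le> n \<Longrightarrow> env s \<Longrightarrow> env s'"
  by (simp add: env_def frame_def)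

lemma m_le_W: "m \<le> W"
proof -
  have "m \<le> m * d" using d by simp
  then show ?thesis using lay by linarith
qed

lemma d_le_W: "d \<le> W"
  using lay by linarith

lemma addr_U: "k < m \<Longrightarrow> l < d \<Longrightarrow> B + (k * d + l) < Fb"
  using mat_index_less[of k m l d] lay by simp

lemma addr_F: "i < d \<Longrightarrow> j < d \<Longrightarrow> Fb + (i * d + j) < Cb"
  using mat_index_less[of i d j d] lay by simp

lemma cell_U [simp]:
  assumes "env s" "regs s a < m" "regs s b < d"
  shows "isafe W s (cell_U a b)" "ival s (cell_U a b) = B + (regs s a * d + regs s b)"
  using assms addr_U[OF assms(2,3)] lay m_le_W d_le_W by (auto simp: cell_U_def env_def)

lemma cell_F [simp]:
  assumes "env s" "regs s a < d" "regs s b < d"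
  shows "isafe W s (cell_F a b)" "ival s (cell_F a b) = Fb + (regs s a * d + regs s b)"
  using assms addr_F[OF assms(2,3)] lay d_le_W by (auto simp: cell_F_def env_def)

lemma cell_c [simp]:
  assumes "env s" "regs s a < d"
  shows "isafe W s (cell_c a)" "ival s (cell_c a) = Cb + regs s a"
  using assms lay by (auto simp: cell_c_def env_def)

lemma cell_acc [simp]:
  assumes "env s"
  shows "isafe W s cell_acc" "ival s cell_acc = Cb + d"
  using assms lay by (auto simp: cell_acc_def env_def)

lemma cell_tmp [simp]:
  assumes "env s"
  shows "isafe W s cell_tmp" "ival s cell_tmp = Suc (Cb + d)"
  using assms lay by (auto simp: cell_tmp_def env_def)

lemma addr_less_S [simp]:
  "k < m \<Longrightarrow> l < d \<Longrightarrow> B + (k * d + l) < S" "i < d \<Longrightarrow> l < d \<Longrightarrow> Fb + (i * d + l) < S"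
  "l < d \<Longrightarrow> Cb + l < S" "Cb + d < S" "Suc (Cb + d) < S"
  using addr_U[of k l] addr_F[of i l] lay by linarith+

text \<open>The last conjunct is the frame condition. It refers to one memory \<open>M0\<close>
  fixed at the start of a run, so that frames of successive steps need not be composed.\<close>

definition rep :: "(nat \<Rightarrow> real) \<Rightarrow> (nat \<Rightarrow> nat \<Rightarrow> real) \<Rightarrow> (nat \<Rightarrow> nat \<Rightarrow> real) \<Rightarrow> (nat \<Rightarrow> real) \<Rightarrow>
    (nat \<Rightarrow> real) \<Rightarrow> bool" where
  "rep M0 U F c M \<longleftrightarrow>
     (\<forall>k<m. \<forall>l<d. M (B + (k * d + l)) = U k l) \<and>
     (\<forall>i<d. \<forall>j<d. M (Fb + (i * d + j)) = F i j) \<and>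
     (\<forall>l<d+2. M (Cb + l) = c l) \<and>
     (\<forall>a. a \<notin> {B..<B + m * d} \<union> {Fb..<Cb + d + 2} \<longrightarrow> M a = M0 a)"

lemma rep_get:
  assumes "rep M0 U F c M"
  shows "k < m \<Longrightarrow> l < d \<Longrightarrow> M (B + (k * d + l)) = U k l"
    "i < d \<Longrightarrow> j < d \<Longrightarrow> M (Fb + (i * d + j)) = F i j"
    "l < d + 2 \<Longrightarrow> M (Cb + l) = c l"
  using assms by (auto simp: rep_def)

lemma rep_cong:
  assumes "rep M0 U F c M" "\<And>k l. k < m \<Longrightarrow> l < d \<Longrightarrow> U k l = U' k l"
    "\<And>i j. i < d \<Longrightarrow> j < d \<Longrightarrow> F i j = F' i j" "\<And>l. l < d + 2 \<Longrightarrow> c l = c' l"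
  shows "rep M0 U' F' c' M"
  using assms by (auto simp: rep_def)

lemma rep_set_U:
  assumes r: "rep M0 U F c M" and k: "k < m" and l: "l < d"
  shows "rep M0 (\<lambda>k' l'. if k' = k \<and> l' = l then v else U k' l') F c (M(B + (k * d + l) := v))"
proof -
  have "B + (k * d + l) < Fb" "k * d + l < m * d" using addr_U[OF k l] mat_index_less[OF k l] by auto
  then show ?thesis
    using r lay mat_index_inj[OF _ l] unfolding rep_def by auto
qed

lemma rep_set_F:
  assumes r: "rep M0 U F c M" and i: "i < d" and j: "j < d"
  shows "rep M0 U (\<lambda>i' j'. if i' = i \<and> j' = j then v else F i' j') c (M(Fb + (i * d + j) := v))"
proof -
  have "Fb + (i * d + j) < Cb" using addr_F[OF i j] by auto
  moreover have "B + (k' * d + l') \<noteq> Fb + (i * d + j)" if "k' < m" "l' < d" for k' l'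
    using addr_U[OF that] by linarith
  ultimately show ?thesis
    using r lay mat_index_inj[OF _ j] unfolding rep_def by auto
qed

lemma rep_set_c:
  assumes r: "rep M0 U F c M" and l: "l < d + 2"
  shows "rep M0 U F (c(l := v)) (M(Cb + l := v))"
proof -
  have "B + (k' * d + l') \<noteq> Cb + l" if "k' < m" "l' < d" for k' l'
    using addr_U[OF that] lay by linarith
  moreover have "Fb + (k' * d + l') \<noteq> Cb + l" if "k' < d" "l' < d" for k' l'
    using addr_F[OF that] lay by linarith
  moreover have "\<not> Cb + l < Fb" "\<not> Cb + l < B + m * d" using lay by auto
  ultimately show ?thesis using r lay l unfolding rep_def by auto
qed

text \<open>Units of time. They exceed \<open>d\<close> and \<open>m\<close> strictly, as
  \<open>wp_For\<close> demands \<open>N < D\<close>, and satisfy \<open>ud \<le> um\<close>, so the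
  costs of all loop nests compare as monomials.\<close>

definition ud :: nat where "ud = 2 * d"
definition um :: nat where "um = m + 2 * d"

lemma units: "1 \<le> ud" "1 \<le> um" "m < um" "d < um" "d < ud" "ud \<le> um" "d \<le> W" "1 \<le> W"
  using d lay by (auto simp: ud_def um_def)

lemma D_mult: "X \<le> ud * X" "X \<le> um * X"
  using units(1,2) by (metis mult_le_mono1 mult_1)+

end

section \<open>Programs for one pivot and for the whole compression\<close>

definition sum_powers :: "real \<Rightarrow> com" where
  "sum_powers p = Seq (RStore cell_acc (RConst 0))
     (For 14 (IReg 8) (RStore cell_acc (RAdd (RCell cell_acc) (RPow (RCell (cell_U 14 13)) p))))"

context layout begin

lemma wp_sum_powers:
  assumes e: "env s" and i: "regs s 13 < d" and r: "rep M0 U F c (mem s)"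
    and post: "\<And>t s'. t \<le> 150 * um \<Longrightarrow> frame 14 s s' \<Longrightarrow>
      rep M0 U F (c(d := mass p m (\<lambda>k. U k (regs s 13)))) (mem s') \<Longrightarrow> Q t s'"
  shows "wp S W (sum_powers p) s Q"
  unfolding sum_powers_def
  apply (rule wp_Seq)
  apply (rule wp_RStore)
     apply (simp_all add: e)
  apply (rule wp_For_frame[where N = m and a = 100 and X = 1 and D = um and
        J = "\<lambda>k M. rep M0 U F (c(d := mass p k (\<lambda>k. U k (regs s 13)))) M"])
         apply (use rep_set_c[OF r, of d 0] in \<open>simp add: mass_def\<close>)
        apply (use e m_le_W in \<open>simp add: frame_def env_def\<close>)
       apply (rule m_le_W)
      apply (rule units)
proof -
  fix k s' assume k: "k < m" and J: "rep M0 U F (c(d := mass p k (\<lambda>k. U k (regs s 13)))) (mem s')"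
    and r: "regs s' 14 = k" and f: "frame 14 (s\<lparr>mem := (mem s)(Cb + d := 0)\<rparr>) s'"
  have e': "env s'" "regs s' 13 = regs s 13"
    using f e by (auto simp: frame_def env_def)
  have "mem s' (B + (k * d + regs s 13)) = U k (regs s 13)" "mem s' (Cb + d) = mass p k (\<lambda>k. U k (regs s 13))"
    using rep_get[OF J] k i by auto
  then show "wp S W (RStore cell_acc (RAdd (RCell cell_acc) (RPow (RCell (cell_U 14 13)) p))) s'
     (\<lambda>t s''. t \<le> 100 * 1 \<and> frame (Suc 14) s' s'' \<and>
       rep M0 U F (c(d := mass p (Suc k) (\<lambda>k. U k (regs s 13)))) (mem s''))"
    apply (intro wp_RStore)
       apply (simp_all add: e' k r i)
    using rep_set_c[OF J, of d] by (simp add: mass_def)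
next
  fix t s' assume "t \<le> (100 + 22) * (um * 1)" "frame 14 (s\<lparr>mem := (mem s)(Cb + d := 0)\<rparr>) s'"
    "rep M0 U F (c(d := mass p m (\<lambda>k. U k (regs s 13)))) (mem s')"
  then show "Q (5 + t) s'"
    using post[of "5 + t" s'] units(2) by (simp add: frame_def)
qed (use units in auto)

end

text \<open>Expects the mass of column \<open>i\<close> in the accumulator, where
  \<open>sum_powers\<close> leaves it. The coefficients are stored because updating \<open>U\<close>
  destroys the columns from which they are computed.\<close>

definition store_coefs :: "real \<Rightarrow> com" where
  "store_coefs p = For 14 (IReg 1)
     (Seq (RStore (cell_c 14) (RConst 0))
     (Seq (For 15 (IReg 8) (RStore (cell_c 14) (RAdd (RCell (cell_c 14))
        (RMul (RMul (RCell (cell_U 15 13)) (RPow (RCell (cell_U 15 13)) (p - 2)))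
          (RCell (cell_U 15 14))))))
     (RStore (cell_c 14) (RDiv (RCell (cell_c 14)) (RPow (RCell cell_acc) ((p - 1) / p))))))"

text \<open>Works in place: the entry in row \<open>i\<close> and column \<open>j\<close> is read
  only while column \<open>j\<close> is processed, and it is overwritten after the sum is complete
  in the temporary cell.\<close>

definition update_F :: com where
  "update_F = For 14 (IReg 1)
     (Seq (RStore cell_tmp (RConst 0))
     (Seq (For 15 (IReg 1) (RStore cell_tmp (RAdd (RCell cell_tmp)
        (RMul (RCell (cell_c 15)) (RCell (cell_F 15 14))))))
     (RStore (cell_F 13 14) (RCell cell_tmp))))"

text \<open>The quotient is saved before the inner loop, which also passes over the pivot column and
  spoils its entry; the last store puts the quotient there.\<close>

definition update_U :: com where
  "update_U = For 14 (IReg 8)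
     (Seq (RStore cell_tmp (RDiv (RCell (cell_U 14 13)) (RCell (cell_c 13))))
     (Seq (For 15 (IReg 1) (RStore (cell_U 14 15)
        (RSub (RCell (cell_U 14 15)) (RMul (RCell (cell_c 15)) (RCell cell_tmp)))))
     (RStore (cell_U 14 13) (RCell cell_tmp))))"

context layout begin

lemma bound_reg_d: "frame n s s' \<Longrightarrow> 12 \<le> n \<Longrightarrow> env s \<Longrightarrow> isafe W s' (IReg 1) \<and> ival s' (IReg 1) = d"
  using d_le_W by (simp add: frame_def env_def)

lemma bound_reg_m: "frame n s s' \<Longrightarrow> 12 \<le> n \<Longrightarrow> env s \<Longrightarrow> isafe W s' (IReg 8) \<and> ival s' (IReg 8) = m"
  using m_le_W by (simp add: frame_def env_def)

lemma wp_store_coefs: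
  assumes e: "env s" and i: "regs s 13 = i" "i < d" and r: "rep M0 U F c (mem s)"
    and c: "c d = mass p m (\<lambda>k. U k i)" "0 < mass p m (\<lambda>k. U k i)"
  shows "wp S W (store_coefs p) s (\<lambda>t s'. t \<le> 222 * (ud * um) \<and> frame 14 s s' \<and>
    rep M0 U F (\<lambda>l. if l < d then coef p m U i l else c l) (mem s'))"
proof -
  define J where "J = (\<lambda>l. rep M0 U F (\<lambda>l'. if l' < l then coef p m U i l' else c l'))"
  show ?thesis unfolding store_coefs_def
  proof (rule wp_For_frame[where J = J and N = d and a = 200 and X = um and D = ud])
    show "J 0 (mem s)" using r by (simp add: J_def)
    fix l s' assume l: "l < d" and J: "J l (mem s')" and r14: "regs s' 14 = l" and f: "frame 14 s s'"
    have e': "env s'" using env_frame[OF f _ e] by simp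
    have r13: "regs s' 13 = i" using f i by (simp add: frame_def)
    let ?c = "\<lambda>l'. if l' < l then coef p m U i l' else c l'"
    let ?s = "s'\<lparr>mem := (mem s')(Cb + l := 0)\<rparr>"
    have es: "env ?s" using e' by simp
    define K where "K = (\<lambda>k. rep M0 U F (?c(l := \<Sum>k<k. dual_weight p (U k i) * U k l)))"
    have K0: "K 0 (mem ?s)" using rep_set_c[OF J[unfolded J_def], of l 0] l by (simp add: K_def)
    show "wp S W (Seq (RStore (cell_c 14) (RConst 0))
     (Seq (For 15 (IReg 8) (RStore (cell_c 14) (RAdd (RCell (cell_c 14))
        (RMul (RMul (RCell (cell_U 15 13)) (RPow (RCell (cell_U 15 13)) (p - 2)))
          (RCell (cell_U 15 14))))))
     (RStore (cell_c 14) (RDiv (RCell (cell_c 14)) (RPow (RCell cell_acc) ((p - 1) / p)))))) s'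
     (\<lambda>t s''. t \<le> 200 * um \<and> frame (Suc 14) s' s'' \<and> J (Suc l) (mem s''))"
      apply (rule wp_Seq)
      apply (rule wp_RStore)
         apply (simp_all add: e' r14 l)
      apply (rule wp_Seq)
    proof (rule wp_For_frame[where J = K and N = m and a = 100 and X = 1 and D = um], goal_cases)
      case (5 k q)
      note k = 5(1) and K = 5(2) and r15 = 5(3) and f' = 5(4)
      have eq: "env q" using env_frame[OF f'] e' by simp
      have regs: "regs q 13 = i" "regs q 14 = l" using f' r13 r14 by (simp_all add: frame_def)
      note get = rep_get[OF K[unfolded K_def]]
      show ?case
        apply (rule wp_RStore)
           apply (use l in \<open>simp_all add: eq regs r15 k i get\<close>)
        using rep_set_c[OF K[unfolded K_def], of l] l
        by (simp add: K_def dual_weight_def)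
    next
      case (9 t q)
      note t = 9(1) and f' = 9(2) and K = 9(3)
      have eq: "env q" using env_frame[OF f'] e' by simp
      have regs: "regs q 14 = l" using f' r14 by (simp add: frame_def)
      note get = rep_get[OF K[unfolded K_def]]
      show ?case
        apply (rule wp_RStore)
           apply (use c l in \<open>simp_all add: eq regs get\<close>)
        apply (intro conjI)
        subgoal using t units(2) by simp
        subgoal using f' by (simp add: frame_def)
        subgoal unfolding J_def
          by (rule rep_cong[OF rep_set_c[OF K[unfolded K_def], of l]]) (use l c in \<open>auto simp: coef_def\<close>)
        done
    qed (use K0 units m_le_W bound_reg_m[OF _ _ es] in auto)
  next
    fix t s' assume "t \<le> (200 + 22) * (ud * um)" "frame 14 s s'" "J d (mem s')"
    then show "t \<le> 222 * (ud * um) \<and> frame 14 s s' \<and>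
      rep M0 U F (\<lambda>l. if l < d then coef p m U i l else c l) (mem s')"
      by (simp add: J_def)
  qed (use units bound_reg_d[OF _ _ e] in auto)
qed

lemma wp_update_F:
  assumes e: "env s" and i: "regs s 13 = i" "i < d" and r: "rep M0 U F c (mem s)"
  shows "wp S W update_F s (\<lambda>t s'. t \<le> 222 * (ud * ud) \<and> frame 14 s s' \<and>
    (\<exists>v. rep M0 U (\<lambda>r j. if r = i then \<Sum>l<d. c l * F l j else F r j) (c(Suc d := v)) (mem s')))"
proof -
  define J where "J = (\<lambda>j M. \<exists>v. rep M0 U
    (\<lambda>r j'. if r = i \<and> j' < j then \<Sum>l<d. c l * F l j' else F r j') (c(Suc d := v)) M)"
  show ?thesis unfolding update_F_def
  proof (rule wp_For_frame[where J = J and N = d and a = 200 and X = ud and D = ud])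
    show "J 0 (mem s)" unfolding J_def using r by (intro exI[of _ "c (Suc d)"]) simp
    fix j s' assume j: "j < d" and J: "J j (mem s')" and r14: "regs s' 14 = j" and f: "frame 14 s s'"
    have e': "env s'" using env_frame[OF f _ e] by simp
    have r13: "regs s' 13 = i" using f i by (simp add: frame_def)
    let ?F = "\<lambda>r j'. if r = i \<and> j' < j then \<Sum>l<d. c l * F l j' else F r j'"
    obtain v where J': "rep M0 U ?F (c(Suc d := v)) (mem s')" using J by (auto simp: J_def)
    let ?s = "s'\<lparr>mem := (mem s')(Suc (Cb + d) := 0)\<rparr>"
    have es: "env ?s" using e' by simp
    define K where "K = (\<lambda>k. rep M0 U ?F (c(Suc d := \<Sum>l<k. c l * F l j)))"
    have K0: "K 0 (mem ?s)" using rep_set_c[OF J', of "Suc d" 0] by (simp add: K_def)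
    show "wp S W (Seq (RStore cell_tmp (RConst 0))
     (Seq (For 15 (IReg 1) (RStore cell_tmp (RAdd (RCell cell_tmp)
        (RMul (RCell (cell_c 15)) (RCell (cell_F 15 14))))))
     (RStore (cell_F 13 14) (RCell cell_tmp)))) s'
     (\<lambda>t s''. t \<le> 200 * ud \<and> frame (Suc 14) s' s'' \<and> J (Suc j) (mem s''))"
      apply (rule wp_Seq)
      apply (rule wp_RStore)
         apply (simp_all add: e')
      apply (rule wp_Seq)
    proof (rule wp_For_frame[where J = K and N = d and a = 100 and X = 1 and D = ud], goal_cases)
      case (5 l q)
      note l = 5(1) and K = 5(2) and r15 = 5(3) and f' = 5(4)
      have eq: "env q" using env_frame[OF f'] e' by simp
      have regs: "regs q 13 = i" "regs q 14 = j" using f' r13 r14 by (simp_all add: frame_def)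
      note get = rep_get[OF K[unfolded K_def]]
      have get': "mem q (Suc (Cb + d)) = (\<Sum>l<l. c l * F l j)" using get(3)[of "Suc d"] by simp
      \<comment> \<open>Row \<open>i\<close> has been replaced only to the left of column
        \<open>j\<close>, so the old entry is read also for \<open>l = i\<close>.\<close>
      have get'': "mem q (Fb + (l * d + j)) = F l j"
        using get(2)[OF l j] by (cases "l = i") simp_all
      show ?case
        apply (rule wp_RStore)
           apply (use l in \<open>simp_all add: eq regs r15 j i get(3) get' get''\<close>)
        using rep_set_c[OF K[unfolded K_def], of "Suc d"]
        by (simp add: K_def)
    next
      case (9 t q)
      note t = 9(1) and f' = 9(2) and K = 9(3)
      have eq: "env q" using env_frame[OF f'] e' by simp
      have regs: "regs q 13 = i" "regs q 14 = j" using f' r13 r14 by (simp_all add: frame_def)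
      note get = rep_get[OF K[unfolded K_def]]
      have get': "mem q (Suc (Cb + d)) = (\<Sum>l<d. c l * F l j)" using get(3)[of "Suc d"] by simp
      show ?case
        apply (rule wp_RStore)
           apply (use i in \<open>simp_all add: eq regs j get'\<close>)
        apply (intro conjI)
        subgoal using t units(1) by simp
        subgoal using f' by (simp add: frame_def)
        subgoal unfolding J_def
          by (intro exI, rule rep_cong[OF rep_set_F[OF K[unfolded K_def], of i j]])
            (use j i in \<open>auto simp: less_Suc_eq\<close>)
        done
    qed (use K0 units bound_reg_d[OF _ _ es] in auto)
  next
    fix t s' assume t: "t \<le> (200 + 22) * (ud * ud)" "frame 14 s s'" and "J d (mem s')"
    then obtain v where "rep M0 U (\<lambda>r j'. if r = i \<and> j' < d then \<Sum>l<d. c l * F l j' else F r j')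
       (c(Suc d := v)) (mem s')" by (auto simp: J_def)
    then have "rep M0 U (\<lambda>r j. if r = i then \<Sum>l<d. c l * F l j else F r j) (c(Suc d := v)) (mem s')"
      by (rule rep_cong) auto
    then show "t \<le> 222 * (ud * ud) \<and> frame 14 s s' \<and>
      (\<exists>v. rep M0 U (\<lambda>r j. if r = i then \<Sum>l<d. c l * F l j else F r j) (c(Suc d := v)) (mem s'))"
      using t by auto
  qed (use units bound_reg_d[OF _ _ e] in auto)
qed

lemma wp_update_U:
  assumes e: "env s" and i: "regs s 13 = i" "i < d" and r: "rep M0 U F c (mem s)" and ci: "c i \<noteq> 0"
  shows "wp S W update_U s (\<lambda>t s'. t \<le> 222 * (ud * um) \<and> frame 14 s s' \<and>
    (\<exists>v. rep M0 (\<lambda>k l. if l = i then U k i / c i else U k l - c l * (U k i / c i)) F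
       (c(Suc d := v)) (mem s')))"
proof -
  define V where "V = (\<lambda>k l. if l = i then U k i / c i else U k l - c l * (U k i / c i))"
  define J where "J = (\<lambda>k M. \<exists>v. rep M0 (\<lambda>k' l. if k' < k then V k' l else U k' l) F (c(Suc d := v)) M)"
  have swap: "ud * um = um * ud" by (rule mult.commute)
  show ?thesis unfolding update_U_def V_def[symmetric] swap
  proof (rule wp_For_frame[where J = J and N = m and a = 200 and X = ud and D = um])
    show "J 0 (mem s)" unfolding J_def using r by (intro exI[of _ "c (Suc d)"]) simp
    fix k s' assume k: "k < m" and J: "J k (mem s')" and r14: "regs s' 14 = k" and f: "frame 14 s s'"
    have e': "env s'" using env_frame[OF f _ e] by simp
    have r13: "regs s' 13 = i" using f i by (simp add: frame_def)
    let ?U = "\<lambda>k' l. if k' < k then V k' l else U k' l"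
    let ?u = "U k i / c i"
    obtain v where J': "rep M0 ?U F (c(Suc d := v)) (mem s')" using J by (auto simp: J_def)
    let ?s = "s'\<lparr>mem := (mem s')(Suc (Cb + d) := ?u)\<rparr>"
    have es: "env ?s" using e' by simp
    define K where "K = (\<lambda>l. rep M0 (\<lambda>k' l'. if k' = k \<and> l' < l then U k l' - c l' * ?u else ?U k' l') F
      (c(Suc d := ?u)))"
    have K0: "K 0 (mem ?s)" using rep_set_c[OF J', of "Suc d" ?u] by (simp add: K_def)
    note get0 = rep_get[OF J']
    show "wp S W (Seq (RStore cell_tmp (RDiv (RCell (cell_U 14 13)) (RCell (cell_c 13))))
     (Seq (For 15 (IReg 1) (RStore (cell_U 14 15)
        (RSub (RCell (cell_U 14 15)) (RMul (RCell (cell_c 15)) (RCell cell_tmp)))))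
     (RStore (cell_U 14 13) (RCell cell_tmp)))) s'
     (\<lambda>t s''. t \<le> 200 * ud \<and> frame (Suc 14) s' s'' \<and> J (Suc k) (mem s''))"
      apply (rule wp_Seq)
      apply (rule wp_RStore)
         apply (use i in \<open>simp_all add: e' r14 r13 k ci get0\<close>)
      apply (rule wp_Seq)
    proof (rule wp_For_frame[where J = K and N = d and a = 100 and X = 1 and D = ud], goal_cases)
      case (5 l q)
      note l = 5(3) and K = 5(4) and r15 = 5(5) and f' = 5(6)
      have eq: "env q" using env_frame[OF f'] e' by simp
      have regs: "regs q 13 = i" "regs q 14 = k" using f' r13 r14 by (simp_all add: frame_def)
      note get = rep_get[OF K[unfolded K_def]]
      have get': "mem q (Suc (Cb + d)) = ?u" using get(3)[of "Suc d"] by simp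
      show ?case
        apply (rule wp_RStore)
           apply (use l in \<open>simp_all add: eq regs r15 k i get get'\<close>)
        unfolding K_def
        by (rule rep_cong[OF rep_set_U[OF K[unfolded K_def], of k l]]) (use l k in \<open>auto simp: less_Suc_eq\<close>)
    next
      case (9 t q)
      note t = 9(3) and f' = 9(4) and K = 9(5)
      have eq: "env q" using env_frame[OF f'] e' by simp
      have regs: "regs q 13 = i" "regs q 14 = k" using f' r13 r14 by (simp_all add: frame_def)
      note get = rep_get[OF K[unfolded K_def]]
      have get': "mem q (Suc (Cb + d)) = ?u" using get(3)[of "Suc d"] by simp
      show ?case
        apply (rule wp_RStore)
           apply (use i in \<open>simp_all add: eq regs k get'\<close>)
        apply (intro conjI)
        subgoal using t units(1) by simp
        subgoal using f' by (simp add: frame_def)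
        subgoal unfolding J_def
          by (intro exI, rule rep_cong[OF rep_set_U[OF K[unfolded K_def], of k i]])
            (use k i in \<open>auto simp: V_def less_Suc_eq\<close>)
        done
    qed (use K0 units bound_reg_d[OF _ _ es] in auto)
  next
    fix t s' assume t: "t \<le> (200 + 22) * (um * ud)" "frame 14 s s'" and "J m (mem s')"
    then obtain v where "rep M0 (\<lambda>k' l. if k' < m then V k' l else U k' l) F (c(Suc d := v)) (mem s')"
      by (auto simp: J_def)
    then have "rep M0 V F (c(Suc d := v)) (mem s')"
      by (rule rep_cong) auto
    then show "t \<le> 222 * (um * ud) \<and> frame 14 s s' \<and> (\<exists>v. rep M0 V F (c(Suc d := v)) (mem s'))"
      using t by auto
  qed (use units m_le_W bound_reg_m[OF _ _ e] in auto)
qed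

end

text \<open>By truncated subtraction \<open>2 * (1 - (1 - r))\<close> is 0 for \<open>r = 0\<close>
  and 2 otherwise: the threshold of pass \<open>r\<close>, whose number is in register 12.\<close>

definition step_com :: "real \<Rightarrow> com" where
  "step_com p = Seq (sum_powers p)
     (Cond (BRLess (RIndex (IMul (IConst 2) (ISub (IConst 1) (ISub (IConst 1) (IReg 12)))))
         (RPow (RCell cell_acc) (1 / p)))
       (Seq (store_coefs p) (Seq update_F update_U)) Skip)"

definition zero_F :: com where
  "zero_F = For 14 (IReg 1) (For 15 (IReg 1) (RStore (cell_F 14 15) (RConst 0)))"

definition init_F :: com where
  "init_F = Seq zero_F (For 14 (IReg 1) (RStore (cell_F 14 14) (RConst 1)))"

definition scale_F :: "real \<Rightarrow> com" where
  "scale_F p = For 13 (IReg 1) (Seq (sum_powers p) (For 14 (IReg 1)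
     (RStore (cell_F 13 14) (RDiv (RMul (RCell (cell_F 13 14)) (RPow (RCell cell_acc) (1 / p)))
        (RIndex (IMul (IReg 1) (IReg 1)))))))"

definition compress :: "real \<Rightarrow> com" where
  "compress p = Seq init_F
     (Seq (For 12 (IAdd (IMul (IMul (IConst 2) (IReg 1)) (IReg 1)) (IConst 2))
         (For 13 (IReg 1) (step_com p)))
     (scale_F p))"

context layout begin

definition holds_pair where
  "holds_pair M0 UF M \<longleftrightarrow> (\<exists>c. rep M0 (fst UF) (snd UF) c M)"

lemma wp_step:
  assumes p: "1 \<le> p" and e: "env s" and i: "regs s 13 = i" "i < d"
    and r12: "regs s 12 = r" "r \<le> W" and rep: "holds_pair M0 UF (mem s)"
  shows "wp S W (step_com p) s (\<lambda>t s'. t \<le> 900 * (ud * um) \<and> frame 14 s s' \<and>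
    holds_pair M0 (pivot_step p m d (if r = 0 then 0 else 2) i UF) (mem s'))"
proof -
  obtain U F where UF: "UF = (U, F)" by (metis surj_pair)
  obtain c where r: "rep M0 U F c (mem s)" using rep by (auto simp: holds_pair_def UF)
  define th :: real where "th = (if r = 0 then 0 else 2)"
  have th0: "0 \<le> th" by (simp add: th_def)
  let ?N = "nrm p m (\<lambda>k. U k i)"
  note um_le = D_mult(1)[of um]
  show ?thesis
    unfolding step_com_def th_def[symmetric]
    apply (rule wp_Seq)
    apply (rule wp_sum_powers[OF e _ r])
     apply (simp add: i)
    subgoal for t1 s1
    proof (rule wp_Cond, goal_cases)
      case 1
      have e1: "env s1" using env_frame[OF 1(2) _ e] by simp
      have "regs s1 12 = r" using 1(2) r12 by (simp add: frame_def)
      then show ?case using e1 r12 lay by simp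
    next
      case 2
      have e1: "env s1" using env_frame[OF 2(2) _ e] by simp
      have i1: "regs s1 13 = i" using 2(2) i by (simp add: frame_def)
      let ?c1 = "c(d := mass p m (\<lambda>k. U k i))"
      have r1: "rep M0 U F ?c1 (mem s1)" using 2(3) i by simp
      have acc: "mem s1 (Cb + d) = mass p m (\<lambda>k. U k i)" using rep_get(3)[OF r1, of d] by simp
      have "regs s1 12 = r" using 2(2) r12 by (simp add: frame_def)
      then have N: "th < ?N"
        using 2(4) e1 acc by (auto simp: th_def nrm_def split: if_splits)
      then have pos: "0 < mass p m (\<lambda>k. U k i)" "0 < ?N"
        using th0 mass_nonneg[of p m "\<lambda>k. U k i"] by (auto simp: nrm_def less_le)
      show ?case
        apply (rule wp_Seq)
        apply (rule wp_mono[OF wp_store_coefs[OF e1 i1 i(2) r1]])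
          apply simp
         apply (rule pos(1))
        apply (erule conjE)+
        subgoal for t2 s2
        proof -
          assume t2: "t2 \<le> 222 * (ud * um)" and f2: "frame 14 s1 s2"
            and "rep M0 U F (\<lambda>l. if l < d then coef p m U i l else ?c1 l) (mem s2)"
          then have r2: "rep M0 U F (\<lambda>l. if l < d then coef p m U i l else ?c1 l) (mem s2)" (is "rep _ _ _ ?c2 _")
            by simp
          have e2: "env s2" using env_frame[OF f2 _ e1] by simp
          have i2: "regs s2 13 = i" using f2 i1 by (simp add: frame_def)
          show ?thesis
            apply (rule wp_Seq)
            apply (rule wp_mono[OF wp_update_F[OF e2 i2 i(2) r2]])
            apply (erule conjE exE)+
            subgoal for t3 s3 v
            proof -
              assume t3: "t3 \<le> 222 * (ud * ud)" and f3: "frame 14 s2 s3"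
                and "rep M0 U (\<lambda>r j. if r = i then \<Sum>l<d. ?c2 l * F l j else F r j) (?c2(Suc d := v)) (mem s3)"
              then have r3: "rep M0 U (pivot_right p m d U F i) (?c2(Suc d := v)) (mem s3)"
                by (elim rep_cong) (auto simp: pivot_right_def)
              have e3: "env s3" using env_frame[OF f3 _ e2] by simp
              have i3: "regs s3 13 = i" using f3 i2 by (simp add: frame_def)
              have ci: "(?c2(Suc d := v)) i = coef p m U i i" using i by simp
              show ?thesis
                apply (rule wp_mono[OF wp_update_U[OF e3 i3 i(2) r3]])
                subgoal using pos(2) by (simp add: ci coef_self[OF p] del: fun_upd_apply)
                apply (elim conjE exE)
                subgoal for t4 s4 v'
                proof (intro conjI)
                  assume t4: "t4 \<le> 222 * (ud * um)" and f4: "frame 14 s3 s4"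
                    and r4: "rep M0 (\<lambda>k l. if l = i then U k i / (?c2(Suc d := v)) i
                        else U k l - (?c2(Suc d := v)) l * (U k i / (?c2(Suc d := v)) i))
                      (pivot_right p m d U F i) (?c2(Suc d := v, Suc d := v')) (mem s4)"
                  have "ud * ud \<le> ud * um" by (rule mult_le_mono2[OF units(6)])
                  moreover have "1 \<le> ud * um" using units(1,2) um_le by linarith
                  ultimately show "t1 + (1 + bcost (BRLess (RIndex (IMul (IConst 2) (ISub (IConst 1)
                      (ISub (IConst 1) (IReg 12))))) (RPow (RCell cell_acc) (1 / p))) + (t2 + (t3 + t4)))
                    \<le> 900 * (ud * um)"
                    using 2(1) t2 t3 t4 um_le unfolding bcost.simps rcost.simps icost.simps icost_cell
                    by linarith
                  show "frame 14 s s4"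
                    using 2(2) f2 f3 f4 by (simp add: frame_def)
                  have "rep M0 (pivot_left p m U i) (pivot_right p m d U F i) (?c2(Suc d := v, Suc d := v')) (mem s4)"
                    by (rule rep_cong[OF r4]) (use i in \<open>auto simp: pivot_left_def\<close>)
                  then show "holds_pair M0 (pivot_step p m d th i UF) (mem s4)"
                    using N unfolding holds_pair_def UF pivot_step_def by auto
                qed
                done
            qed
            done
        qed
        done
    next
      case 3
      have e1: "env s1" using env_frame[OF 3(2) _ e] by simp
      let ?c1 = "c(d := mass p m (\<lambda>k. U k i))"
      have r1: "rep M0 U F ?c1 (mem s1)" using 3(3) i by simp
      have acc: "mem s1 (Cb + d) = mass p m (\<lambda>k. U k i)" using rep_get(3)[OF r1, of d] by simp
      have "regs s1 12 = r" using 3(2) r12 by (simp add: frame_def)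
      then have N: "\<not> th < ?N"
        using 3(4) e1 acc by (auto simp: th_def nrm_def split: if_splits)
      then have "holds_pair M0 (pivot_step p m d th i UF) (mem s1)"
        using r1 unfolding holds_pair_def UF pivot_step_def by auto
      moreover have "t1 + 16 \<le> 900 * (ud * um)" using 3(1) units(2) um_le by linarith
      ultimately show ?case using 3(2) by (intro wp_Skip) simp
    qed
    done
qed

lemma wp_zero_F:
  assumes e: "env s" and r: "rep M0 U F c (mem s)"
  shows "wp S W zero_F s (\<lambda>t s'. t \<le> 162 * (ud * ud) \<and> frame 14 s s' \<and>
    rep M0 U (\<lambda>i j. 0) c (mem s'))"
proof -
  define J where "J = (\<lambda>i. rep M0 U (\<lambda>i' j. if i' < i then 0 else F i' j) c)"
  show ?thesis
    unfolding zero_F_def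
  proof (rule wp_For_frame[where J = J and N = d and a = 140 and X = ud and D = ud], goal_cases)
    case 1
    show ?case using r by (simp add: J_def)
  next
    case (5 i s')
    note i = 5(1) and J = 5(2) and r14 = 5(3) and f = 5(4)
    have e': "env s'" using env_frame[OF f _ e] by simp
    define H where "H = (\<lambda>j. rep M0 U (\<lambda>i' j'. if i' < i \<or> (i' = i \<and> j' < j) then 0 else F i' j') c)"
    show ?case
    proof (rule wp_For_frame[where J = H and N = d and a = 100 and X = 1 and D = ud], goal_cases)
      case 1
      show ?case using J by (simp add: J_def H_def)
    next
      case (5 j q)
      note j = 5(1) and H = 5(2) and r15 = 5(3) and f' = 5(4)
      have eq: "env q" using env_frame[OF f' _ e'] by simp
      have "regs q 14 = i" using f' r14 by (simp add: frame_def)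
      then show ?case
        apply (intro wp_RStore)
           apply (use i j in \<open>simp_all add: eq r15\<close>)
        unfolding H_def
        by (rule rep_cong[OF rep_set_F[OF H[unfolded H_def], of i j]]) (use i j in auto)
    next
      case (9 t q)
      have "rep M0 U (\<lambda>i' j'. if i' < i \<or> (i' = i \<and> j' < d) then 0 else F i' j') c (mem q)"
        using 9(3) by (simp add: H_def)
      then have "J (Suc i) (mem q)" unfolding J_def by (rule rep_cong) auto
      then show ?case using 9(1,2) units(1) by (simp add: frame_def)
    qed (use units bound_reg_d[OF _ _ e'] in auto)
  next
    case (9 t s')
    have "rep M0 U (\<lambda>i j. 0) c (mem s')" by (rule rep_cong[OF 9(3)[unfolded J_def]]) auto
    then show ?case using 9(1,2) by simp
  qed (use units bound_reg_d[OF _ _ e] in auto)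
qed

lemma wp_init_F:
  assumes e: "env s" and r: "rep M0 U F c (mem s)"
  shows "wp S W init_F s (\<lambda>t s'. t \<le> 300 * (ud * ud) \<and> frame 14 s s' \<and>
    rep M0 U id_fun c (mem s'))"
proof -
  define K where "K = (\<lambda>i. rep M0 U (\<lambda>i' j. if i' = j \<and> i' < i then 1 else 0) c)"
  show ?thesis
    unfolding init_F_def
  proof (rule wp_Seq, rule wp_mono[OF wp_zero_F[OF e r]], elim conjE, goal_cases)
    case (1 t1 s1)
    note t1 = 1(1) and f1 = 1(2) and r1 = 1(3)
    have e1: "env s1" using env_frame[OF f1 _ e] by simp
    show ?case
    proof (rule wp_For_frame[where J = K and N = d and a = 100 and X = 1 and D = ud], goal_cases)
      case 1
      show ?case unfolding K_def by (rule rep_cong[OF r1]) auto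
    next
      case (5 i q)
      note i = 5(1) and K = 5(2) and r14 = 5(3) and f' = 5(4)
      have eq: "env q" using env_frame[OF f' _ e1] by simp
      show ?case
        apply (intro wp_RStore)
           apply (use i in \<open>simp_all add: eq r14\<close>)
        unfolding K_def
        by (rule rep_cong[OF rep_set_F[OF K[unfolded K_def], of i i]]) (use i in auto)
    next
      case (9 t2 s2)
      have "rep M0 U id_fun c (mem s2)"
        by (rule rep_cong[OF 9(3)[unfolded K_def]]) (auto simp: id_fun_def)
      moreover have "t1 + t2 \<le> 300 * (ud * ud)"
      proof -
        have "t2 \<le> 122 * ud" "t1 \<le> 162 * (ud * ud)" using 9(1) t1 by simp_all
        then show ?thesis using D_mult(1)[of ud] by linarith
      qed
      ultimately show ?case using 9(2) f1 by (simp add: frame_def)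
    qed (use units bound_reg_d[OF _ _ e1] in auto)
  qed
qed

lemma wp_scale_F:
  assumes e: "env s" and r: "rep M0 U F c (mem s)"
  shows "wp S W (scale_F p) s (\<lambda>t s'. t \<le> 322 * (ud * um) \<and> frame 13 s s' \<and>
    (\<exists>c. rep M0 U (\<lambda>i j. F i j * nrm p m (\<lambda>k. U k i) / real (d * d)) c (mem s')))"
proof -
  define G where "G = (\<lambda>i j. F i j * nrm p m (\<lambda>k. U k i) / real (d * d))"
  define J where "J = (\<lambda>i M. \<exists>c. rep M0 U (\<lambda>i' j. if i' < i then G i' j else F i' j) c M)"
  show ?thesis
    unfolding scale_F_def G_def[symmetric]
  proof (rule wp_For_frame[where J = J and N = d and a = 300 and X = um and D = ud], goal_cases)
    case 1
    show ?case using r by (auto simp: J_def)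
  next
    case (5 i s')
    note i = 5(1) and J = 5(2) and r13 = 5(3) and f = 5(4)
    have e': "env s'" using env_frame[OF f _ e] by simp
    obtain c where r': "rep M0 U (\<lambda>i' j. if i' < i then G i' j else F i' j) c (mem s')"
      using J by (auto simp: J_def)
    let ?c = "c(d := mass p m (\<lambda>k. U k i))"
    define K where "K = (\<lambda>j. rep M0 U (\<lambda>i' j'. if i' < i \<or> (i' = i \<and> j' < j) then G i' j' else F i' j') ?c)"
    show ?case
    proof (rule wp_Seq, rule wp_sum_powers[OF e' _ r'], goal_cases)
      case 1
      show ?case using i r13 by simp
    next
      case (2 t1 s1)
      have e1: "env s1" using env_frame[OF 2(2) _ e'] by simp
      have r13': "regs s1 13 = i" using 2(2) r13 by (simp add: frame_def)
      have t1: "t1 \<le> 150 * um" by (rule 2(1))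
      have f1: "frame 14 s' s1" by (rule 2(2))
      have K0: "K 0 (mem s1)" using 2(3) r13 by (simp add: K_def)
      show ?case
      proof (rule wp_For_frame[where J = K and N = d and a = 100 and X = 1 and D = ud], goal_cases)
        case 1
        show ?case by (rule K0)
      next
        case (5 j q)
        note j = 5(1) and K = 5(2) and r14 = 5(3) and f' = 5(4)
        have eq: "env q" using env_frame[OF f' _ e1] by simp
        have regs: "regs q 13 = i" "regs q (Suc 0) = d"
          using f' r13' eq by (simp_all add: frame_def env_def)
        note get = rep_get[OF K[unfolded K_def]]
        have g: "mem q (Fb + (i * d + j)) = F i j" "mem q (Cb + d) = mass p m (\<lambda>k. U k i)"
          using get(2)[OF i j] get(3)[of d] by auto
        have "d * d \<le> W" using lay by simp
        then show ?case
          apply (intro wp_RStore)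
             apply (use i j d_le_W d in \<open>simp_all add: eq regs r14 g\<close>)
          unfolding K_def
          by (rule rep_cong[OF rep_set_F[OF K[unfolded K_def], of i j]])
            (use i j in \<open>auto simp: G_def nrm_def\<close>)
      next
        case (9 t2 s2)
        have "rep M0 U (\<lambda>i' j'. if i' < i \<or> (i' = i \<and> j' < d) then G i' j' else F i' j') ?c (mem s2)"
          using 9(3) by (simp add: K_def)
        then have "rep M0 U (\<lambda>i' j'. if i' < Suc i then G i' j' else F i' j') ?c (mem s2)"
          by (rule rep_cong) auto
        then have "J (Suc i) (mem s2)" by (auto simp: J_def)
        then show ?case using 9(1,2) t1 f1 units(6) by (simp add: frame_def)
      qed (use units bound_reg_d[OF _ _ e1] in auto)
    qed
  next
    case (9 t s')
    then obtain c where "rep M0 U (\<lambda>i' j. if i' < d then G i' j else F i' j) c (mem s')"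
      by (auto simp: J_def)
    then have "rep M0 U G c (mem s')" by (rule rep_cong) auto
    then show ?case using 9(1,2) by auto
  qed (use units bound_reg_d[OF _ _ e] in auto)
qed

text \<open>The dominant cost is \<open>2 * d * d + 2\<close> passes of \<open>d\<close> pivots at
  \<open>ud * um\<close> each. The loop unit \<open>2 * ud * ud\<close> is \<open>8 * d * d\<close>,
  which exceeds the number of passes.\<close>

theorem wp_compress:
  assumes p: "1 \<le> p" and e: "env s" and r: "rep M0 A F c (mem s)"
  shows "wp S W (compress p) s (\<lambda>t s'. t \<le> 3000 * (ud * ud * ud * ud * um) \<and> frame 12 s s' \<and>
    (\<exists>U c. rep M0 U (summary_fun p m d A) c (mem s')))"
proof -
  let ?UF = "(A, id_fun)"
  define J where "J = (\<lambda>r. holds_pair M0 (pivot_passes p m d r ?UF))"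
  let ?R = "2 * d * d + 2"
  show ?thesis
    unfolding compress_def
    apply (rule wp_Seq)
    apply (rule wp_mono[OF wp_init_F[OF e r]])
    apply (elim conjE)
    apply (rule wp_Seq)
    subgoal for t1 s1
    proof (rule wp_For_frame[where J = J and N = ?R and a = 922 and X = "ud * (ud * um)" and D = "2 * ud * ud"], goal_cases)
      case 1
      then show ?case by (auto simp: J_def holds_pair_def)
    next
      case (2 s')
      have "env s'" using env_frame[OF 2(2) _ e] env_frame[OF 2(4)] by simp
      moreover have "2 * d \<le> 2 * d * d" using d by simp
      then have "2 * d \<le> W" using lay by linarith
      ultimately show ?case using lay d_le_W by (simp add: env_def)
    next
      case (5 r s')
      have e1: "env s1" using env_frame[OF 5(2) _ e] by simp
      note r12 = 5(6) and f = 5(7)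
      have e': "env s'" using env_frame[OF f _ e1] by simp
      define K where "K = (\<lambda>i. holds_pair M0 (pivot_pass p m d (if r = 0 then 0 else 2) i (pivot_passes p m d r ?UF)))"
      have K0: "K 0 (mem s')" using 5(5) by (simp add: K_def J_def)
      have rW: "r \<le> W" using 5(4) lay by simp
      show ?case
      proof (rule wp_For_frame[where J = K and N = d and a = 900 and X = "ud * um" and D = ud], goal_cases)
        case 1
        show ?case by (rule K0)
      next
        case (5 i q)
        have eq: "env q" using env_frame[OF 5(4) _ e'] by simp
        have "regs q 12 = r" using 5(4) r12 by (simp add: frame_def)
        from wp_step[OF p eq 5(3,1) this rW 5(2)[unfolded K_def]]
        show ?case by (rule wp_mono) (simp add: K_def)
      next
        case (9 t q)
        then show ?case by (simp add: K_def J_def)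
      qed (use units D_mult(1)[of um] bound_reg_d[OF _ _ e'] in auto)
    next
      case (9 t2 s2)
      have e1: "env s1" using env_frame[OF 9(2) _ e] by simp
      have e2: "env s2" using env_frame[OF 9(5) _ e1] by simp
      obtain c where r2: "rep M0 (fst (pivot_passes p m d ?R ?UF)) (snd (pivot_passes p m d ?R ?UF)) c (mem s2)"
        using 9(6) by (auto simp: J_def holds_pair_def)
      show ?case
        apply (rule wp_mono[OF wp_scale_F[OF e2 r2, of p]])
        apply (elim conjE exE)
        subgoal for t3 s3 c'
        proof (intro conjI)
          assume t3: "t3 \<le> 322 * (ud * um)" and f3: "frame 13 s2 s3"
            and r3: "rep M0 (fst (pivot_passes p m d ?R ?UF)) (\<lambda>i j. snd (pivot_passes p m d ?R ?UF) i j *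
              nrm p m (\<lambda>k. fst (pivot_passes p m d ?R ?UF) k i) / real (d * d)) c' (mem s3)"
          show "frame 12 s s3" using 9(2,5) f3 by (simp add: frame_def)
          show "\<exists>U c. rep M0 U (summary_fun p m d A) c (mem s3)"
            using r3 unfolding summary_fun_def[abs_def] case_prod_beta Let_def by (intro exI)
          let ?X = "ud * ud * ud * ud * um"
          have a: "ud * um \<le> ?X" "ud * ud \<le> ?X"
          proof -
            have "ud * um \<le> ud * (ud * (ud * (ud * um)))"
              using D_mult(1)[of um] D_mult(1)[of "ud * um"] D_mult(1)[of "ud * (ud * um)"]
              by (intro mult_le_mono2) linarith
            then show 1: "ud * um \<le> ?X" by (simp only: mult.assoc)
            show "ud * ud \<le> ?X" using mult_le_mono2[OF units(6), of ud] 1 by linarith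
          qed
          have "t2 \<le> 944 * (2 * ?X)" using 9(4) by (simp only: mult.assoc) simp
          then show "t1 + (t2 + t3) \<le> 3000 * ?X" using 9(1) t3 a by linarith
        qed
        done
    next
      case 8
      have "1 \<le> d * d" using d by simp
      then have "2 * (d * d) + 2 < 8 * (d * d)" by linarith
      then show ?case by (simp add: ud_def algebra_simps)
    qed (use units lay D_mult(1)[of um] D_mult(1)[of "ud * um"] in auto)
    done
qed

end

section \<open>Exact Euclidean summaries by Givens rotations\<close>

definition sq_mass :: "nat \<Rightarrow> nat \<Rightarrow> (nat \<Rightarrow> nat \<Rightarrow> real) \<Rightarrow> (nat \<Rightarrow> real) \<Rightarrow> real" where
  "sq_mass m d A x = (\<Sum>i<m. (mat_app d A x i)\<^sup>2)"

text \<open>Triangularity protects the zeros already created: row \<open>k\<close> of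
  \<open>R\<close> vanishes left of \<open>k\<close>, so a rotation with it leaves the leading zeros
  of the new row alone.\<close>

definition upper :: "nat \<Rightarrow> (nat \<Rightarrow> nat \<Rightarrow> real) \<Rightarrow> bool" where
  "upper d R \<longleftrightarrow> (\<forall>i<d. \<forall>j<i. R i j = 0)"

lemma rotation:
  fixes u v h :: real
  assumes "h\<^sup>2 = u\<^sup>2 + v\<^sup>2" "v \<noteq> 0"
  shows "(u / h * y + v / h * z)\<^sup>2 + (u / h * z - v / h * y)\<^sup>2 = y\<^sup>2 + z\<^sup>2"
proof -
  have "0 < u\<^sup>2 + v\<^sup>2" using assms(2) by (simp add: add_nonneg_pos)
  then have h: "h\<^sup>2 \<noteq> 0" using assms(1) by linarith
  then have "(u / h)\<^sup>2 + (v / h)\<^sup>2 = 1"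
    using assms(1) by (simp add: power_divide add_divide_distrib[symmetric])
  moreover have "(c * y + e * z)\<^sup>2 + (c * z - e * y)\<^sup>2 = (c\<^sup>2 + e\<^sup>2) * (y\<^sup>2 + z\<^sup>2)" for c e :: real
    by (simp add: power2_eq_square algebra_simps)
  ultimately show ?thesis by (metis mult_1)
qed

text \<open>Givens rotation of row \<open>k\<close> of \<open>R\<close> and the new row
  \<open>a\<close>, with cosine \<open>R k k / h\<close> and sine \<open>a k / h\<close>; it
  annihilates entry \<open>k\<close> of the new row.\<close>

definition rotate_R :: "(nat \<Rightarrow> nat \<Rightarrow> real) \<Rightarrow> (nat \<Rightarrow> real) \<Rightarrow> nat \<Rightarrow> real \<Rightarrow> nat \<Rightarrow> nat \<Rightarrow> real" where
  "rotate_R R a k h i j = (if i = k then R k k / h * R k j + a k / h * a j else R i j)"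

definition rotate_a :: "(nat \<Rightarrow> nat \<Rightarrow> real) \<Rightarrow> (nat \<Rightarrow> real) \<Rightarrow> nat \<Rightarrow> real \<Rightarrow> nat \<Rightarrow> real" where
  "rotate_a R a k h j = R k k / h * a j - a k / h * R k j"

text \<open>Only row \<open>k\<close> and the new row change, and their values at \<open>x\<close>
  undergo a plane rotation.\<close>

lemma sq_rotate:
  assumes k: "k < d" and h: "h\<^sup>2 = (R k k)\<^sup>2 + (a k)\<^sup>2" and ak: "a k \<noteq> 0"
  shows "sq_mass d d (rotate_R R a k h) x + (\<Sum>j<d. rotate_a R a k h j * x j)\<^sup>2 =
    sq_mass d d R x + (\<Sum>j<d. a j * x j)\<^sup>2"
proof -
  let ?c = "R k k / h" and ?e = "a k / h" and ?y = "mat_app d R x k" and ?z = "\<Sum>j<d. a j * x j"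
  have 1: "sq_mass d d (rotate_R R a k h) x = (?c * ?y + ?e * ?z)\<^sup>2 + (\<Sum>i\<in>{..<d} - {k}. (mat_app d R x i)\<^sup>2)"
    unfolding sq_mass_def using k
    by (subst sum.remove[of _ k])
      (auto simp: mat_app_def rotate_R_def distrib_right sum.distrib sum_distrib_left mult.assoc
        intro!: sum.cong)
  have 2: "(\<Sum>j<d. rotate_a R a k h j * x j) = ?c * ?z - ?e * ?y"
    by (simp add: mat_app_def rotate_a_def left_diff_distrib sum_subtractf sum_distrib_left mult.assoc)
  have 3: "sq_mass d d R x = ?y\<^sup>2 + (\<Sum>i\<in>{..<d} - {k}. (mat_app d R x i)\<^sup>2)"
    unfolding sq_mass_def using k by (subst sum.remove[of _ k]) auto
  show ?thesis unfolding 1 2 3 using rotation[OF h ak, of ?y ?z] by linarith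
qed

text \<open>No coefficients are kept during triangularization, so the first scratch cell serves as a
  third temporary, for the old entry of \<open>R\<close>.\<close>

definition cell_zero :: iexp where
  "cell_zero = IReg 11"

text \<open>\<open>RPow _ 1\<close> is the absolute value, so the condition says that the entry to
  be eliminated is nonzero, which also makes the divisor \<open>h\<close> nonzero. The accumulator
  holds first \<open>h\<close> and then the sine.\<close>

definition rotate_com :: com where
  "rotate_com = Cond (BRLess (RConst 0) (RPow (RCell (cell_U 12 13)) 1))
     (Seq (RStore cell_acc (RPow (RAdd (RMul (RCell (cell_F 13 13)) (RCell (cell_F 13 13)))
        (RMul (RCell (cell_U 12 13)) (RCell (cell_U 12 13)))) (1 / 2)))
     (Seq (RStore cell_tmp (RDiv (RCell (cell_F 13 13)) (RCell cell_acc)))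
     (Seq (RStore cell_acc (RDiv (RCell (cell_U 12 13)) (RCell cell_acc)))
     (For 14 (IReg 1)
       (Seq (RStore cell_zero (RCell (cell_F 13 14)))
       (Seq (RStore (cell_F 13 14) (RAdd (RMul (RCell cell_tmp) (RCell cell_zero))
          (RMul (RCell cell_acc) (RCell (cell_U 12 14)))))
       (RStore (cell_U 12 14) (RSub (RMul (RCell cell_tmp) (RCell (cell_U 12 14)))
          (RMul (RCell cell_acc) (RCell cell_zero))))))))))
     Skip"

text \<open>Register 7 holds a divisor that scales the row down in advance. It pays for the passage
  from the Euclidean norm to \<open>nrm p\<close> and thus yields the upper constant 1.\<close>

definition insert_row :: com where
  "insert_row = Seq (For 14 (IReg 1)
       (RStore (cell_U 12 14) (RDiv (RCell (cell_U 12 14)) (RIndex (IReg 7)))))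
     (For 13 (IReg 1) rotate_com)"

definition triangularize :: com where
  "triangularize = Seq zero_F (For 12 (IReg 8) insert_row)"

context layout begin

lemma cell_zero [simp]:
  assumes "env s"
  shows "isafe W s cell_zero" "ival s cell_zero = Cb" "icost cell_zero = 1"
  using assms lay by (auto simp: cell_zero_def env_def)

lemma wp_rotate:
  assumes e: "env s" and q: "regs s 12 = q" "q < m" and k: "regs s 13 = k" "k < d"
    and r: "rep M0 (U(q := a)) R c (mem s)"
  shows "wp S W rotate_com s (\<lambda>t s'. t \<le> 400 * ud \<and> frame 14 s s' \<and>
    (\<exists>R' a' c. rep M0 (U(q := a')) R' c (mem s') \<and>
      (if a k = 0 then R' = R \<and> a' = a else
        (\<exists>h. h\<^sup>2 = (R k k)\<^sup>2 + (a k)\<^sup>2 \<and> R' = rotate_R R a k h \<and> a' = rotate_a R a k h))))"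
  unfolding rotate_com_def
proof (rule wp_Cond, goal_cases)
  case 1
  show ?case using e q k by simp
next
  case 2
  note get = rep_get[OF r]
  have ak: "a k \<noteq> 0" using 2 e q k get(1)[of q k] by auto
  define h where "h = sqrt ((R k k)\<^sup>2 + (a k)\<^sup>2)"
  have h2: "h\<^sup>2 = (R k k)\<^sup>2 + (a k)\<^sup>2" by (simp add: h_def)
  have "0 < (R k k)\<^sup>2 + (a k)\<^sup>2" using ak by (simp add: add_nonneg_pos)
  then have h0: "h \<noteq> 0" using h2 by auto
  have h_eq: "\<bar>R k k * R k k + a k * a k\<bar> powr (1 / 2) = h"
    "(R k k * R k k + a k * a k) powr (1 / 2) = h"
    by (simp_all add: h_def powr_half_sqrt power2_eq_square)
  define cs sn where "cs = R k k / h" and "sn = a k / h"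
  define M1 where "M1 = (mem s)(Cb + d := h)"
  define M2 where "M2 = M1(Cb + Suc d := cs)"
  define M3 where "M3 = M2(Cb + d := sn)"
  have CbS: "Cb < S" using lay by simp
  have r3: "rep M0 (U(q := a)) R (c(d := h, Suc d := cs, d := sn)) M3"
    unfolding M1_def M2_def M3_def by (intro rep_set_c r) auto
  define J where "J = (\<lambda>j M. \<exists>v. rep M0
    (U(q := (\<lambda>j'. if j' < j then rotate_a R a k h j' else a j')))
    (\<lambda>i j'. if j' < j then rotate_R R a k h i j' else R i j')
    (c(d := sn, Suc d := cs, 0 := v)) M)"
  have main: "wp S W (For 14 (IReg 1)
       (Seq (RStore cell_zero (RCell (cell_F 13 14)))
       (Seq (RStore (cell_F 13 14) (RAdd (RMul (RCell cell_tmp) (RCell cell_zero))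
          (RMul (RCell cell_acc) (RCell (cell_U 12 14)))))
       (RStore (cell_U 12 14) (RSub (RMul (RCell cell_tmp) (RCell (cell_U 12 14)))
          (RMul (RCell cell_acc) (RCell cell_zero))))))) (s\<lparr>mem := M3\<rparr>)
     (\<lambda>t s'. t \<le> 222 * ud \<and> frame 14 s s' \<and>
       (\<exists>c. rep M0 (U(q := rotate_a R a k h)) (rotate_R R a k h) c (mem s')))" (is "wp S W ?P ?s _")
  proof (rule wp_For_frame[where J = J and N = d and a = 200 and X = 1 and D = ud], goal_cases)
    case 1
    have "rep M0 (U(q := a)) R (c(d := sn, Suc d := cs, 0 := c 0)) M3"
      by (rule rep_cong[OF r3]) (use d in auto)
    then show ?case by (auto simp: J_def)
  next
    case (2 s')
    then show ?case using bound_reg_d[OF 2] e by simp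
  next
    case (5 j s')
    note j = 5(1) and J = 5(2) and r14 = 5(3) and f = 5(4)
    have e': "env s'" using env_frame[OF f] e by simp
    have regs: "regs s' 12 = q" "regs s' 13 = k" using f q k by (simp_all add: frame_def)
    let ?U = "U(q := (\<lambda>j'. if j' < j then rotate_a R a k h j' else a j'))"
    let ?R = "\<lambda>i j'. if j' < j then rotate_R R a k h i j' else R i j'"
    obtain v where J': "rep M0 ?U ?R (c(d := sn, Suc d := cs, 0 := v)) (mem s')"
      using J by (auto simp: J_def)
    let ?c = "c(d := sn, Suc d := cs, 0 := v)"
    define N1 where "N1 = (mem s')(Cb := R k j)"
    define N2 where "N2 = N1(Fb + (k * d + j) := cs * R k j + sn * a j)"
    define N3 where "N3 = N2(B + (q * d + j) := cs * a j - sn * R k j)"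
    have n1: "rep M0 ?U ?R (?c(0 := R k j)) N1"
      using rep_set_c[OF J', of 0 "R k j"] by (simp add: N1_def)
    note n2 = rep_set_F[OF n1 k(2) j, of "cs * R k j + sn * a j", folded N2_def]
    note n3 = rep_set_U[OF n2 q(2) j, of "cs * a j - sn * R k j", folded N3_def]
    have g0: "mem s' (Fb + (k * d + j)) = R k j"
      using rep_get(2)[OF J' k(2) j] by simp
    have g1: "N1 (Suc (Cb + d)) = cs" "N1 (Cb + d) = sn" "N1 (B + (q * d + j)) = a j"
      "N1 Cb = R k j"
      using rep_get(3)[OF n1, of "Suc d"] rep_get(3)[OF n1, of d] rep_get(1)[OF n1 q(2) j]
        rep_get(3)[OF n1, of 0] d by auto
    have g2: "N2 (Suc (Cb + d)) = cs" "N2 (Cb + d) = sn" "N2 (B + (q * d + j)) = a j"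
      "N2 Cb = R k j"
      using rep_get(3)[OF n2, of "Suc d"] rep_get(3)[OF n2, of d] rep_get(1)[OF n2 q(2) j]
        rep_get(3)[OF n2, of 0] d by auto
    have J3: "J (Suc j) N3"
      unfolding J_def
      by (intro exI, rule rep_cong[OF n3])
        (use d in \<open>auto simp: less_Suc_eq rotate_R_def rotate_a_def cs_def sn_def split: if_splits\<close>)
    have w3: "wp S W (RStore (cell_U 12 14) (RSub (RMul (RCell cell_tmp) (RCell (cell_U 12 14)))
          (RMul (RCell cell_acc) (RCell cell_zero)))) (s'\<lparr>mem := N2\<rparr>)
        (\<lambda>t s''. t \<le> 60 \<and> frame 15 s' s'' \<and> J (Suc j) (mem s''))"
      apply (rule wp_RStore)
      using J3 e' by (simp_all add: regs r14 q k j g2 CbS N3_def[symmetric] del: fun_upd_apply)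
    have w2: "wp S W (Seq (RStore (cell_F 13 14) (RAdd (RMul (RCell cell_tmp) (RCell cell_zero))
          (RMul (RCell cell_acc) (RCell (cell_U 12 14)))))
       (RStore (cell_U 12 14) (RSub (RMul (RCell cell_tmp) (RCell (cell_U 12 14)))
          (RMul (RCell cell_acc) (RCell cell_zero))))) (s'\<lparr>mem := N1\<rparr>)
        (\<lambda>t s''. t \<le> 120 \<and> frame 15 s' s'' \<and> J (Suc j) (mem s''))"
      by (rule wp_RStore_Seq[OF _ _ _ _ w3])
        (use e' in \<open>simp_all add: regs r14 q k j g1 CbS N2_def[symmetric] del: fun_upd_apply\<close>)
    show ?case
      by (rule wp_RStore_Seq[OF _ _ _ _ w2])
        (use e' in \<open>simp_all add: regs r14 q k j g0 CbS N1_def[symmetric] del: fun_upd_apply\<close>)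
  next
    case (9 t s')
    obtain v where "rep M0
      (U(q := (\<lambda>j'. if j' < d then rotate_a R a k h j' else a j')))
      (\<lambda>i j'. if j' < d then rotate_R R a k h i j' else R i j') (c(d := sn, Suc d := cs, 0 := v)) (mem s')"
      using 9(3) by (auto simp: J_def)
    then have "rep M0 (U(q := rotate_a R a k h)) (rotate_R R a k h) (c(d := sn, Suc d := cs, 0 := v)) (mem s')"
      by (rule rep_cong) auto
    then show ?case using 9(1,2) by (auto simp: frame_def)
  qed (use units in auto)
  have g0: "mem s (Fb + (k * d + k)) = R k k" "mem s (B + (q * d + k)) = a k"
    using get(2)[OF k(2) k(2)] get(1)[OF q(2) k(2)] by auto
  have r1: "rep M0 (U(q := a)) R (c(d := h)) M1" unfolding M1_def by (intro rep_set_c r) auto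
  have r2: "rep M0 (U(q := a)) R (c(d := h, Suc d := cs)) M2" unfolding M1_def M2_def by (intro rep_set_c r) auto
  have g1: "M1 (Fb + (k * d + k)) = R k k" "M1 (Cb + d) = h"
    using rep_get(2)[OF r1 k(2) k(2)] rep_get(3)[OF r1, of d] by auto
  have g2: "M2 (B + (q * d + k)) = a k" "M2 (Cb + d) = h"
    using rep_get(1)[OF r2 q(2) k(2)] rep_get(3)[OF r2, of d] by auto
  have w3: "wp S W (Seq (RStore cell_acc (RDiv (RCell (cell_U 12 13)) (RCell cell_acc))) ?P)
      (s\<lparr>mem := M2\<rparr>) (\<lambda>t s'. t \<le> 20 + 222 * ud \<and> frame 14 s s' \<and>
       (\<exists>c. rep M0 (U(q := rotate_a R a k h)) (rotate_R R a k h) c (mem s')))"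
    by (rule wp_RStore_Seq[OF _ _ _ _ main])
      (use e h0 in \<open>simp_all add: q k g2 M3_def[symmetric] sn_def[symmetric] del: fun_upd_apply\<close>)
  have w2: "wp S W (Seq (RStore cell_tmp (RDiv (RCell (cell_F 13 13)) (RCell cell_acc)))
      (Seq (RStore cell_acc (RDiv (RCell (cell_U 12 13)) (RCell cell_acc))) ?P))
      (s\<lparr>mem := M1\<rparr>) (\<lambda>t s'. t \<le> 40 + 222 * ud \<and> frame 14 s s' \<and>
       (\<exists>c. rep M0 (U(q := rotate_a R a k h)) (rotate_R R a k h) c (mem s')))"
    by (rule wp_RStore_Seq[OF _ _ _ _ w3])
      (use e h0 in \<open>simp_all add: q k g1 M2_def[simplified, symmetric] cs_def[symmetric] del: fun_upd_apply\<close>)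
  show ?case
    by (rule wp_RStore_Seq[OF _ _ _ _ w2])
      (use e ak h2 units(1) in \<open>auto simp: q k g0 h_eq M1_def[symmetric] simp del: fun_upd_apply\<close>)
next
  case 3
  have "a k = 0" using 3 e q k rep_get(1)[OF r, of q k] by auto
  then show ?case using r units(1) by (intro wp_Skip) auto
qed

lemma wp_insert_row:
  assumes e: "env s" and q: "regs s 12 = q" "q < m" and \<sigma>: "regs s 7 = \<sigma>" "0 < \<sigma>" "\<sigma> \<le> W"
    and R: "upper d R" and r: "rep M0 U R c (mem s)"
  shows "wp S W insert_row s (\<lambda>t s'. t \<le> 600 * (ud * ud) \<and> frame 13 s s' \<and>
    (\<exists>U' R' c. rep M0 U' R' c (mem s') \<and> upper d R' \<and> (\<forall>k. k \<noteq> q \<longrightarrow> U' k = U k) \<and>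
      (\<forall>x. sq_mass d d R' x = sq_mass d d R x + (\<Sum>j<d. U q j / \<sigma> * x j)\<^sup>2)))"
proof -
  define a0 where "a0 = (\<lambda>j. U q j / \<sigma>)"
  define J where "J = (\<lambda>j. rep M0 (U(q := (\<lambda>j'. if j' < j then a0 j' else U q j'))) R c)"
  \<comment> \<open>The row \<open>a\<close> carries the square mass not yet absorbed by
    \<open>R'\<close>. With each rotation it gains a leading zero, so at \<open>k = d\<close>
    everything has moved to \<open>R'\<close>.\<close>
  define K where "K = (\<lambda>k M. \<exists>a R' c. rep M0 (U(q := a)) R' c M \<and> upper d R' \<and> (\<forall>j<k. a j = 0) \<and>
    (\<forall>x. sq_mass d d R' x + (\<Sum>j<d. a j * x j)\<^sup>2 = sq_mass d d R x + (\<Sum>j<d. a0 j * x j)\<^sup>2))"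
  show ?thesis
    unfolding insert_row_def
  proof (rule wp_Seq, rule wp_For_frame[where J = J and N = d and a = 100 and X = 1 and D = ud], goal_cases)
    case 1
    show ?case using r by (simp add: J_def)
  next
    case (5 j s')
    note j = 5(1) and J = 5(2) and r14 = 5(3) and f = 5(4)
    have e': "env s'" using env_frame[OF f _ e] by simp
    have regs: "regs s' 12 = q" "regs s' 7 = \<sigma>" using f q \<sigma> by (simp_all add: frame_def)
    have g: "mem s' (B + (q * d + j)) = U q j" using rep_get(1)[OF J[unfolded J_def] q(2) j] by simp
    show ?case
      apply (rule wp_RStore)
         apply (use e' \<sigma> in \<open>simp_all add: regs r14 q j g\<close>)
      unfolding J_def
      by (rule rep_cong[OF rep_set_U[OF J[unfolded J_def] q(2) j]]) (auto simp: a0_def less_Suc_eq)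
  next
    case (9 t1 s1)
    note t1 = 9(1) and f1 = 9(2)
    have e1: "env s1" using env_frame[OF f1 _ e] by simp
    have q1: "regs s1 12 = q" using f1 q by (simp add: frame_def)
    have r1: "rep M0 (U(q := a0)) R c (mem s1)"
      by (rule rep_cong[OF 9(3)[unfolded J_def]]) auto
    show ?case
    proof (rule wp_For_frame[where J = K and N = d and a = 400 and X = ud and D = ud], goal_cases)
      case 1
      show ?case unfolding K_def using r1 R by (intro exI[of _ a0] exI[of _ R] exI[of _ c]) simp
    next
      case (5 k s')
      note k = 5(1) and K = 5(2) and r13 = 5(3) and f = 5(4)
      have e': "env s'" using env_frame[OF f _ e1] by simp
      have q': "regs s' 12 = q" using f q1 by (simp add: frame_def)
      obtain a R' c where 1: "rep M0 (U(q := a)) R' c (mem s')" "upper d R'" "\<And>j. j < k \<Longrightarrow> a j = 0"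
        "\<And>x. sq_mass d d R' x + (\<Sum>j<d. a j * x j)\<^sup>2 = sq_mass d d R x + (\<Sum>j<d. a0 j * x j)\<^sup>2"
        using K by (auto simp: K_def)
      show ?case
      proof (rule wp_mono[OF wp_rotate[OF e' q' q(2) r13 k 1(1)]], elim conjE exE, intro conjI, goal_cases)
        case (3 t s'' R'' a' c')
        show ?case
        proof (cases "a k = 0")
          case True
          then have "R'' = R'" "a' = a" using 3 by auto
          then have "\<forall>j<Suc k. a' j = 0" using True 1(3) by (auto simp: less_Suc_eq)
          with 3(3) 1(2,4) \<open>R'' = R'\<close> \<open>a' = a\<close> show ?thesis
            unfolding K_def by blast
        next
          case False
          then obtain h where h: "h\<^sup>2 = (R' k k)\<^sup>2 + (a k)\<^sup>2" "R'' = rotate_R R' a k h" "a' = rotate_a R' a k h"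
            using 3 by auto
          have zero: "R' i j = 0" if "j < i" "i < d" for i j using 1(2) that by (simp add: upper_def)
          have "upper d R''" using zero 1(3) by (auto simp: upper_def h(2) rotate_R_def)
          moreover have "\<forall>j<Suc k. a' j = 0"
            using zero 1(3) k by (auto simp: h(3) rotate_a_def less_Suc_eq)
          moreover have "sq_mass d d R'' x + (\<Sum>j<d. a' j * x j)\<^sup>2 = sq_mass d d R x + (\<Sum>j<d. a0 j * x j)\<^sup>2" for x
            using sq_rotate[where R = R' and a = a and x = x, OF k h(1) False] 1(4)[of x] by (simp add: h)
          ultimately show ?thesis unfolding K_def using 3(3) by blast
        qed
      qed simp_all
    next
      case (9 t2 s2)
      obtain a R' c where 1: "rep M0 (U(q := a)) R' c (mem s2)" "upper d R'" "\<And>j. j < d \<Longrightarrow> a j = 0"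
        "\<And>x. sq_mass d d R' x + (\<Sum>j<d. a j * x j)\<^sup>2 = sq_mass d d R x + (\<Sum>j<d. a0 j * x j)\<^sup>2"
        using 9(3) by (auto simp: K_def)
      have "t2 \<le> 422 * (ud * ud)" "t1 \<le> 122 * ud" using 9(1) t1 by simp_all
      then have "t1 + t2 \<le> 600 * (ud * ud)" using D_mult(1)[of ud] by linarith
      moreover have "frame 13 s s2" using f1 9(2) by (simp add: frame_def)
      moreover have "sq_mass d d R' x = sq_mass d d R x + (\<Sum>j<d. U q j / \<sigma> * x j)\<^sup>2" for x
        using 1(4)[of x] 1(3) by (simp add: a0_def)
      ultimately show ?case using 1(1,2) by (intro conjI exI[of _ "U(q := a)"] exI[of _ R'] exI[of _ c]) auto
    qed (use units bound_reg_d[OF _ _ e1] in auto)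
  qed (use units bound_reg_d[OF _ _ e] in auto)
qed

theorem wp_triangularize:
  assumes e: "env s" and \<sigma>: "regs s 7 = \<sigma>" "0 < \<sigma>" "\<sigma> \<le> W" and r: "rep M0 U F c (mem s)"
  shows "wp S W triangularize s (\<lambda>t s'. t \<le> 800 * (um * (ud * ud)) \<and> frame 12 s s' \<and>
    (\<exists>U' R c. rep M0 U' R c (mem s') \<and> (\<forall>x. sq_mass d d R x = sq_mass m d U x / (real \<sigma>)\<^sup>2)))"
proof -
  define J where "J = (\<lambda>q M. \<exists>U' R c. rep M0 U' R c M \<and> upper d R \<and> (\<forall>k\<ge>q. U' k = U k) \<and>
    (\<forall>x. sq_mass d d R x = (\<Sum>k<q. (\<Sum>j<d. U k j / \<sigma> * x j)\<^sup>2)))"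
  show ?thesis
    unfolding triangularize_def
  proof (rule wp_Seq, rule wp_mono[OF wp_zero_F[OF e r]], elim conjE, goal_cases)
    case (1 t1 s1)
    note t1 = 1(1) and f1 = 1(2) and r1 = 1(3)
    have e1: "env s1" using env_frame[OF f1 _ e] by simp
    have \<sigma>1: "regs s1 7 = \<sigma>" using f1 \<sigma> by (simp add: frame_def)
    show ?case
    proof (rule wp_For_frame[where J = J and N = m and a = 600 and X = "ud * ud" and D = um], goal_cases)
      case 1
      show ?case unfolding J_def using r1
        by (intro exI[of _ U] exI[of _ "\<lambda>_ _. 0"] exI[of _ c]) (simp add: upper_def sq_mass_def mat_app_def)
    next
      case (5 q s')
      note q = 5(1) and J = 5(2) and r12 = 5(3) and f = 5(4)
      have e': "env s'" using env_frame[OF f _ e1] by simp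
      have \<sigma>': "regs s' 7 = \<sigma>" using f \<sigma>1 by (simp add: frame_def)
      obtain U' R c where 1: "rep M0 U' R c (mem s')" "upper d R" "\<And>k. q \<le> k \<Longrightarrow> U' k = U k"
        "\<And>x. sq_mass d d R x = (\<Sum>k<q. (\<Sum>j<d. U k j / \<sigma> * x j)\<^sup>2)"
        using J by (auto simp: J_def)
      show ?case
      proof (rule wp_mono[OF wp_insert_row[OF e' r12 q \<sigma>' \<sigma>(2,3) 1(2,1)]], elim conjE exE, intro conjI, goal_cases)
        case (3 t s'' U'' R' c')
        have "U'' k = U k" if "Suc q \<le> k" for k using 3(5) 1(3)[of k] that by simp
        moreover have "sq_mass d d R' x = (\<Sum>k<Suc q. (\<Sum>j<d. U k j / \<sigma> * x j)\<^sup>2)" for x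
          using 3(6) 1(4)[of x] 1(3)[of q] by simp
        ultimately show ?case using 3(3,4) unfolding J_def by blast
      qed simp_all
    next
      case (9 t2 s2)
      obtain U' R c where 1: "rep M0 U' R c (mem s2)"
        "\<And>x. sq_mass d d R x = (\<Sum>k<m. (\<Sum>j<d. U k j / \<sigma> * x j)\<^sup>2)"
        using 9(3) by (auto simp: J_def)
      have "sq_mass d d R x = sq_mass m d U x / (real \<sigma>)\<^sup>2" for x
        unfolding 1(2) unfolding sq_mass_def mat_app_def
        by (simp add: power_divide[symmetric] sum_divide_distrib)
      moreover have "t1 + t2 \<le> 800 * (um * (ud * ud))"
      proof -
        have "t2 \<le> 622 * (um * (ud * ud))" using 9(1) by simp
        then show ?thesis using t1 D_mult(2)[of "ud * ud"] by linarith
      qed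
      moreover have "frame 12 s s2" using f1 9(2) by (simp add: frame_def)
      ultimately show ?case using 1(1) by blast
    qed (use units D_mult(1)[of ud] m_le_W bound_reg_m[OF _ _ e1] in auto)
  qed
qed

end

section \<open>Distributed summaries\<close>

text \<open>The expression \<open>e\<close> is the divisor of \<open>insert_row\<close>:
  \<open>n * d\<close> at the leaves and 1 at inner nodes, so every input row is scaled exactly
  once. The result stays where \<open>F\<close> was built, behind the input.\<close>

definition node_com :: "real \<Rightarrow> real \<Rightarrow> iexp \<Rightarrow> com" where
  "node_com p \<gamma> e =
     Seq (ISet 8 (IReg 2)) (Seq (ISet 9 (IConst 0)) (Seq (ISet 10 (IMul (IReg 2) (IReg 1)))
     (Seq (ISet 11 (IAdd (IReg 10) (IMul (IReg 1) (IReg 1))))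
     (Seq (Cond (BRLess (RPow (RIndex (IReg 0)) \<gamma>) (RIndex (IMul (IReg 1) (IReg 1))))
         (Seq (ISet 7 e) triangularize) (compress p))
     (Seq (ISet 2 (IReg 1)) (ISet 3 (IReg 10)))))))"

lemma node_run:
  assumes p: "1 \<le> p" and M: "M \<in> carrier_mat m d" and ly: "layout S W m d 0 (m * d) (m * d + d * d)"
    and n: "n \<le> W"
    and e: "\<And>s. regs s 0 = n \<Longrightarrow> regs s 1 = d \<Longrightarrow> isafe W s e \<and> ival s e = \<sigma>" "icost e \<le> 3"
    and \<sigma>: "0 < \<sigma>" "\<sigma> \<le> W"
    and \<tau>: "real (60 + 3000 * ((2 * d) ^ 4 * (m + 2 * d))) \<le> \<tau>"
  shows "\<exists>T. node_outputs S W \<tau> (node_com p \<gamma> e) n d M T \<and> T \<in> carrier_mat d d \<and>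
    (if real n powr \<gamma> < real (d * d)
     then \<forall>x. sq_mass d d (\<lambda>i j. T $$ (i, j)) x = sq_mass m d (\<lambda>i j. M $$ (i, j)) x / (real \<sigma>)\<^sup>2
     else \<forall>i<d. \<forall>j<d. T $$ (i, j) = summary_fun p m d (\<lambda>i j. M $$ (i, j)) i j)"
proof -
  interpret layout S W m d 0 "m * d" "m * d + d * d" by (rule ly)
  define Fb where "Fb = m * d"
  define Cb where "Cb = m * d + d * d"
  define s where "s = node_state n d M"
  define s1 where "s1 = s\<lparr>regs := (regs s)(8 := m, 9 := 0, 10 := Fb, 11 := Cb)\<rparr>"
  define A where "A = (\<lambda>i j. M $$ (i, j))"
  define Rel where "Rel = (\<lambda>T. if real n powr \<gamma> < real (d * d)
     then \<forall>x. sq_mass d d T x = sq_mass m d A x / (real \<sigma>)\<^sup>2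
     else \<forall>i<d. \<forall>j<d. T i j = summary_fun p m d A i j)"
  have mdS: "m * d + d * d + d + 2 \<le> S" "S \<le> W" "2 * d * d + 2 \<le> W" and d1: "1 \<le> d"
    using lay d by auto
  have dimM: "dim_row M = m" using M by simp
  have regs: "regs s 0 = n" "regs s (Suc 0) = d" "regs s 2 = m"
    by (simp_all add: s_def node_state_def dimM)
  have mem: "mem s1 (k * d + l) = A k l" if "k < m" "l < d" for k l
    using that mat_index_less[OF that] by (simp add: s1_def s_def node_state_def dimM A_def)
  have e1: "env s1" by (simp add: env_def s1_def regs Fb_def Cb_def)
  have rep: "rep (mem s1) A (\<lambda>i j. mem s1 (Fb + (i * d + j))) (\<lambda>l. mem s1 (Cb + l)) (mem s1)"
    unfolding rep_def using mem by (auto simp: Fb_def Cb_def)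
  define X where "X = (2 * d) ^ 4 * (m + 2 * d)"
  have X: "ud * ud * ud * ud * um = X" "um * (ud * ud) \<le> X"
  proof -
    show 1: "ud * ud * ud * ud * um = X"
      by (simp add: X_def ud_def um_def power4_eq_xxxx mult.assoc)
    have "um * (ud * ud) * 1 \<le> um * (ud * ud) * (ud * ud)"
      using units(1) by (intro mult_le_mono2) simp
    then show "um * (ud * ud) \<le> X" unfolding 1[symmetric] by (simp only: mult_ac mult_1_right)
  qed
  have main: "wp S W (Cond (BRLess (RPow (RIndex (IReg 0)) \<gamma>) (RIndex (IMul (IReg 1) (IReg 1))))
         (Seq (ISet 7 e) triangularize) (compress p)) s1
     (\<lambda>t s'. t \<le> 20 + 3000 * X \<and> regs s' 1 = d \<and> regs s' 10 = Fb \<and>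
       Rel (\<lambda>i j. mem s' (Fb + i * d + j)))"
  proof (rule wp_Cond, goal_cases)
    case 1
    show ?case using n mdS d_le_W by (simp add: s1_def regs)
  next
    case 2
    have large: "real n powr \<gamma> < real (d * d)" using 2 by (simp add: s1_def regs)
    define s2 where "s2 = s1\<lparr>regs := (regs s1)(7 := \<sigma>)\<rparr>"
    have e2: "env s2" using e1 by (simp add: s2_def env_def)
    have rep2: "rep (mem s1) A (\<lambda>i j. mem s1 (Fb + (i * d + j))) (\<lambda>l. mem s1 (Cb + l)) (mem s2)"
      using rep by (simp add: s2_def)
    have "ival s1 e = \<sigma>" "isafe W s1 e" using e(1)[of s1] by (simp_all add: s1_def regs)
    moreover have "wp S W triangularize s2
      (\<lambda>t s'. 10 + icost e + t \<le> 20 + 3000 * X \<and> regs s' 1 = d \<and> regs s' 10 = Fb \<and>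
       Rel (\<lambda>i j. mem s' (Fb + i * d + j)))"
    proof (rule wp_mono[OF wp_triangularize[OF e2 _ \<sigma> rep2]], goal_cases)
      case (2 t s')
      then obtain U' R c where 4: "rep (mem s1) U' R c (mem s')"
        "\<And>x. sq_mass d d R x = sq_mass m d A x / (real \<sigma>)\<^sup>2" "t \<le> 800 * (um * (ud * ud))" by auto
      have "mem s' (Fb + i * d + j) = R i j" if "i < d" "j < d" for i j
        using rep_get(2)[OF 4(1) that] by (simp add: Fb_def add.assoc)
      then have "sq_mass d d (\<lambda>i j. mem s' (Fb + i * d + j)) x = sq_mass d d R x" for x
        by (simp add: sq_mass_def mat_app_def)
      then have "Rel (\<lambda>i j. mem s' (Fb + i * d + j))" using 4(2) large by (simp add: Rel_def)
      moreover have "env s'" using 2 env_frame[OF _ _ e2] by blast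
      ultimately show ?case using 4(3) X(2) e(2) by (simp add: env_def Fb_def)
    qed (simp add: s2_def)
    ultimately show ?case
      by (intro wp_Seq wp_ISet) (simp_all add: s2_def add.assoc)
  next
    case 3
    have small: "\<not> real n powr \<gamma> < real (d * d)" using 3 by (simp add: s1_def regs)
    show ?case
    proof (rule wp_mono[OF wp_compress[OF p e1 rep]], goal_cases)
      case (1 t s')
      then obtain U c where 4: "rep (mem s1) U (summary_fun p m d A) c (mem s')"
        "t \<le> 3000 * (ud * ud * ud * ud * um)" by auto
      have "mem s' (Fb + i * d + j) = summary_fun p m d A i j" if "i < d" "j < d" for i j
        using rep_get(2)[OF 4(1) that] by (simp add: Fb_def add.assoc)
      then have "Rel (\<lambda>i j. mem s' (Fb + i * d + j))" using small by (simp add: Rel_def)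
      moreover have "env s'" using 1 env_frame[OF _ _ e1] by blast
      ultimately show ?case using 4(2) X(1) by (simp add: env_def Fb_def)
    qed
  qed
  have mW: "m \<le> W" "m * d \<le> W" "m * d + d * d \<le> W" "d \<le> W" "d * d \<le> W"
    using mdS m_le_W by auto
  let ?Q = "\<lambda>s'. regs s' 2 = d \<and> regs s' 3 = Fb \<and> Rel (\<lambda>i j. mem s' (Fb + i * d + j))"
  let ?c5 = "Seq (Cond (BRLess (RPow (RIndex (IReg 0)) \<gamma>) (RIndex (IMul (IReg 1) (IReg 1))))
         (Seq (ISet 7 e) triangularize) (compress p)) (Seq (ISet 2 (IReg 1)) (ISet 3 (IReg 10)))"
  let ?s2 = "s\<lparr>regs := (regs s)(8 := m)\<rparr>"
  let ?s3 = "s\<lparr>regs := (regs s)(8 := m, 9 := 0)\<rparr>"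
  let ?s4 = "s\<lparr>regs := (regs s)(8 := m, 9 := 0, 10 := Fb)\<rparr>"
  have w5: "wp S W ?c5 s1 (\<lambda>t s'. t \<le> 30 + 3000 * X \<and> ?Q s')"
    by (rule wp_Seq, rule wp_mono[OF main], rule wp_Seq, rule wp_ISet, use mW in simp, rule wp_ISet)
      (use mW in \<open>simp_all add: Fb_def\<close>)
  have w4: "wp S W (Seq (ISet 11 (IAdd (IReg 10) (IMul (IReg 1) (IReg 1)))) ?c5) ?s4
      (\<lambda>t s'. t \<le> 36 + 3000 * X \<and> ?Q s')"
    by (rule wp_ISet_Seq[OF _ _ w5]) (use mW in \<open>simp_all add: regs s1_def Fb_def Cb_def\<close>)
  have w3: "wp S W (Seq (ISet 10 (IMul (IReg 2) (IReg 1)))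
      (Seq (ISet 11 (IAdd (IReg 10) (IMul (IReg 1) (IReg 1)))) ?c5)) ?s3
      (\<lambda>t s'. t \<le> 40 + 3000 * X \<and> ?Q s')"
    by (rule wp_ISet_Seq[OF _ _ w4]) (use mW in \<open>simp_all add: regs Fb_def\<close>)
  have w2: "wp S W (Seq (ISet 9 (IConst 0)) (Seq (ISet 10 (IMul (IReg 2) (IReg 1)))
      (Seq (ISet 11 (IAdd (IReg 10) (IMul (IReg 1) (IReg 1)))) ?c5))) ?s2
      (\<lambda>t s'. t \<le> 42 + 3000 * X \<and> ?Q s')"
    by (rule wp_ISet_Seq[OF _ _ w3]) simp_all
  have "wp S W (node_com p \<gamma> e) s (\<lambda>t s'. t \<le> 60 + 3000 * X \<and> ?Q s')"
    unfolding node_com_def by (rule wp_ISet_Seq[OF _ _ w2]) (use mW in \<open>simp_all add: regs\<close>)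
  then have "wp S W (node_com p \<gamma> e) s (\<lambda>t s'. real t \<le> \<tau> \<and> ?Q s')"
  proof (rule wp_mono)
    fix t s' assume a: "t \<le> 60 + 3000 * X \<and> ?Q s'"
    then have "real t \<le> real (60 + 3000 * X)" by (simp only: of_nat_le_iff)
    also have "\<dots> \<le> \<tau>" using \<tau> by (simp only: X_def)
    finally show "real t \<le> \<tau> \<and> ?Q s'" using a by blast
  qed
  from wp_runs[OF this] obtain s' where s': "runs S W \<tau> (node_com p \<gamma> e) s s'" "regs s' 2 = d"
    "regs s' 3 = Fb" "Rel (\<lambda>i j. mem s' (Fb + i * d + j))" by blast
  define T where "T = mat d d (\<lambda>(i, j). mem s' (Fb + i * d + j))"
  have "result S d s' T" using mdS by (simp add: result_def s' T_def Fb_def)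
  then have "node_outputs S W \<tau> (node_com p \<gamma> e) n d M T"
    using s'(1) mdS M unfolding node_outputs_def s_def by auto
  moreover have "Rel (\<lambda>i j. T $$ (i, j))"
  proof -
    have "T $$ (i, j) = mem s' (Fb + i * d + j)" if "i < d" "j < d" for i j
      using that by (simp add: T_def)
    then show ?thesis using s'(4) by (auto simp: Rel_def sq_mass_def mat_app_def)
  qed
  ultimately show ?thesis
    unfolding Rel_def A_def by (intro exI[of _ T]) (simp add: T_def)
qed

text \<open>Lists of rows replace matrices here, because sums over lists are additive under stacking
  and insensitive to the order in which blocks reach the tree.\<close>

definition row_mass :: "real \<Rightarrow> real vec \<Rightarrow> real vec list \<Rightarrow> real" where
  "row_mass p x vs = (\<Sum>v\<leftarrow>vs. \<bar>v \<bullet> x\<bar> powr p)"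

definition row_sq :: "real vec \<Rightarrow> real vec list \<Rightarrow> real" where
  "row_sq x vs = (\<Sum>v\<leftarrow>vs. (v \<bullet> x)\<^sup>2)"

lemma row_scalar_prod:
  assumes "M \<in> carrier_mat m d" "x \<in> carrier_vec d" "k < m"
  shows "row M k \<bullet> x = mat_app d (\<lambda>i j. M $$ (i, j)) (vec_index x) k"
  using assms by (auto simp: mat_app_def scalar_prod_def atLeast0LessThan intro!: sum.cong)

lemma row_mass_rows:
  assumes "M \<in> carrier_mat m d" "x \<in> carrier_vec d"
  shows "row_mass p x (rows M) = mass p m (mat_app d (\<lambda>i j. M $$ (i, j)) (vec_index x))"
proof -
  have "row_mass p x (rows M) = (\<Sum>k<m. \<bar>row M k \<bullet> x\<bar> powr p)"
    using assms by (simp add: row_mass_def rows_def comp_def interv_sum_list_conv_sum_set_nat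
        atLeast0LessThan)
  then show ?thesis using row_scalar_prod[OF assms] by (simp add: mass_def)
qed

lemma row_sq_rows:
  assumes "M \<in> carrier_mat m d" "x \<in> carrier_vec d"
  shows "row_sq x (rows M) = sq_mass m d (\<lambda>i j. M $$ (i, j)) (vec_index x)"
proof -
  have "row_sq x (rows M) = (\<Sum>k<m. (row M k \<bullet> x)\<^sup>2)"
    using assms by (simp add: row_sq_def rows_def comp_def interv_sum_list_conv_sum_set_nat
        atLeast0LessThan)
  then show ?thesis using row_scalar_prod[OF assms] by (simp add: sq_mass_def)
qed

text \<open>The bounds of \<open>nrm_summary_fun\<close> raised to the power \<open>p\<close>, the
  form in which they survive stacking.\<close>

lemma mass_summary:
  assumes p: "1 \<le> p" and d: "1 \<le> d"
  shows "mass p d (mat_app d (summary_fun p m d A) x) \<le> mass p m (mat_app d A x)"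
    and "mass p m (mat_app d A x) \<le> real d powr (3 * p) * mass p d (mat_app d (summary_fun p m d A) x)"
proof -
  note N = nrm_summary_fun[OF p d, of m A x]
  have "nrm p d (mat_app d (summary_fun p m d A) x) powr p \<le> nrm p m (mat_app d A x) powr p"
    using N(1) p by (intro powr_mono2) auto
  then show "mass p d (mat_app d (summary_fun p m d A) x) \<le> mass p m (mat_app d A x)"
    by (simp add: nrm_powr[OF p])
  have "nrm p m (mat_app d A x) powr p \<le> (real d ^ 3 * nrm p d (mat_app d (summary_fun p m d A) x)) powr p"
    using N(2) p by (intro powr_mono2) auto
  also have "\<dots> = (real d ^ 3) powr p * nrm p d (mat_app d (summary_fun p m d A) x) powr p"
    by (simp add: powr_mult)
  also have "(real d ^ 3) powr p = real d powr (3 * p)"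
  proof -
    have "real d ^ 3 = real d powr 3" using powr_realpow[of "real d" 3] d by simp
    then show ?thesis by (simp only: powr_powr)
  qed
  finally show "mass p m (mat_app d A x) \<le> real d powr (3 * p) * mass p d (mat_app d (summary_fun p m d A) x)"
    by (simp add: nrm_powr[OF p])
qed

lemma lp_norm_mult_mat_vec:
  assumes "A \<in> carrier_mat n d" "x \<in> carrier_vec d"
  shows "lp_norm p (A *\<^sub>v x) = nrm p n (mat_app d (\<lambda>i j. A $$ (i, j)) (vec_index x))"
  using assms row_scalar_prod[OF assms] by (simp add: lp_norm_def nrm_def mass_def)

text \<open>Here \<open>h\<close> counts compressions: the root of order \<open>p\<close> turns
  \<open>(d powr (3 * p)) ^ h\<close> into \<open>d powr (3 * h)\<close>.\<close>

lemma subspace_embedding_of_mass: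
  assumes p: "1 \<le> p" and d: "1 \<le> d" and A: "A \<in> carrier_mat n d" and T: "T \<in> carrier_mat m d"
    and le: "\<And>x. x \<in> carrier_vec d \<Longrightarrow> row_mass p x (rows T) \<le> row_mass p x (rows A)"
    and ge: "\<And>x. x \<in> carrier_vec d \<Longrightarrow>
      row_mass p x (rows A) \<le> (real d powr (3 * p)) ^ h * row_mass p x (rows T)"
    and h: "3 * real h \<le> e"
  shows "subspace_embedding p (1 / real d powr e) 1 A T"
  unfolding subspace_embedding_def
proof (intro conjI ballI)
  show "dim_col T = dim_col A" using A T by simp
next
  fix x :: "real vec" assume "x \<in> carrier_vec (dim_col A)"
  then have x: "x \<in> carrier_vec d" using A by simp
  let ?a = "row_mass p x (rows A)" and ?t = "row_mass p x (rows T)"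
  have norms: "lp_norm p (A *\<^sub>v x) = ?a powr (1 / p)" "lp_norm p (T *\<^sub>v x) = ?t powr (1 / p)"
    and nonneg: "0 \<le> ?a" "0 \<le> ?t"
    using lp_norm_mult_mat_vec[OF A x] lp_norm_mult_mat_vec[OF T x] row_mass_rows[OF A x]
      row_mass_rows[OF T x] by (simp_all add: nrm_def)
  show "lp_norm p (T *\<^sub>v x) \<le> 1 * lp_norm p (A *\<^sub>v x)"
    unfolding norms using le[OF x] nonneg p by (simp add: powr_mono2)
  have "?a powr (1 / p) \<le> ((real d powr (3 * p)) ^ h * ?t) powr (1 / p)"
    using ge[OF x] nonneg p by (intro powr_mono2) auto
  also have "\<dots> = ((real d powr (3 * p)) ^ h) powr (1 / p) * ?t powr (1 / p)"
    using nonneg by (simp add: powr_mult)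
  also have "((real d powr (3 * p)) ^ h) powr (1 / p) = real d powr (3 * real h)"
  proof -
    have "(real d powr (3 * p)) ^ h = (real d powr (3 * p)) powr real h"
      using powr_realpow[of "real d powr (3 * p)" h] d by simp
    then show ?thesis using p by (simp add: powr_powr)
  qed
  also have "\<dots> \<le> real d powr e" using h d by (intro powr_mono) auto
  finally have "?a powr (1 / p) \<le> real d powr e * ?t powr (1 / p)"
    by (simp add: mult_right_mono)
  moreover have "0 < real d powr e" using d by simp
  ultimately show "1 / real d powr e * lp_norm p (A *\<^sub>v x) \<le> lp_norm p (T *\<^sub>v x)"
    unfolding norms by (simp add: divide_le_eq mult.commute)
qed

text \<open>A crude comparison through the sum of absolute values. The factor \<open>m\<close> is
  affordable, as this is used only where \<open>n\<close> is bounded by a power of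
  \<open>d\<close>.\<close>

lemma nrm_le_mult_nrm:
  assumes "1 \<le> p" "1 \<le> q"
  shows "nrm p m y \<le> real m * nrm q m y"
proof -
  have "nrm p m y \<le> (\<Sum>k<m. \<bar>y k\<bar>)" by (rule nrm_le_sum_components[OF assms(1)])
  also have "\<dots> \<le> (\<Sum>k<m. nrm q m y)" using component_le_nrm[OF assms(2)] by (intro sum_mono) auto
  finally show ?thesis by simp
qed

lemma nrm_2: "nrm 2 m y = sqrt (\<Sum>k<m. (y k)\<^sup>2)"
  by (simp add: nrm_def mass_def powr_half_sqrt sum_nonneg)

text \<open>Changing norms costs a factor \<open>d\<close> on the side of \<open>T\<close> and
  \<open>n\<close> on the side of \<open>A\<close>, in either direction. The divisor
  \<open>n * d\<close> compensates this for the upper bound, so the lower bound loses it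
  twice.\<close>

lemma subspace_embedding_of_sq:
  assumes p: "1 \<le> p" and d: "1 \<le> d" and n: "1 \<le> n"
    and A: "A \<in> carrier_mat n d" and T: "T \<in> carrier_mat d d"
    and eq: "\<And>x. x \<in> carrier_vec d \<Longrightarrow> row_sq x (rows T) = row_sq x (rows A) / (real (n * d))\<^sup>2"
    and e: "real (n * d) ^ 2 \<le> real d powr e"
  shows "subspace_embedding p (1 / real d powr e) 1 A T"
  unfolding subspace_embedding_def
proof (intro conjI ballI)
  show "dim_col T = dim_col A" using A T by simp
next
  fix x :: "real vec" assume "x \<in> carrier_vec (dim_col A)"
  then have x: "x \<in> carrier_vec d" using A by simp
  define y where "y = mat_app d (\<lambda>i j. A $$ (i, j)) (vec_index x)"
  define z where "z = mat_app d (\<lambda>i j. T $$ (i, j)) (vec_index x)"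
  have norms: "lp_norm p (A *\<^sub>v x) = nrm p n y" "lp_norm p (T *\<^sub>v x) = nrm p d z"
    using lp_norm_mult_mat_vec[OF A x] lp_norm_mult_mat_vec[OF T x] by (simp_all add: y_def z_def)
  have nd: "0 < real (n * d)" using n d by simp
  have "(\<Sum>k<d. (z k)\<^sup>2) = (\<Sum>k<n. (y k)\<^sup>2) / (real (n * d))\<^sup>2"
    using eq[OF x] row_sq_rows[OF A x] row_sq_rows[OF T x] by (simp only: sq_mass_def y_def z_def)
  then have 2: "nrm 2 d z * real (n * d) = nrm 2 n y"
    using n d unfolding nrm_2 by (simp add: real_sqrt_divide)
  have "nrm p d z \<le> real d * nrm 2 d z" by (rule nrm_le_mult_nrm) (use p in auto)
  then have "nrm p d z * real (n * d) \<le> real d * nrm 2 n y"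
    using nd by (simp add: 2[symmetric] mult.assoc[symmetric] mult_right_mono)
  also have "\<dots> \<le> real d * (real n * nrm p n y)"
    by (intro mult_left_mono nrm_le_mult_nrm) (use p in auto)
  also have "\<dots> = nrm p n y * real (n * d)" by simp
  finally have "nrm p d z \<le> nrm p n y" using nd mult_le_cancel_right_pos by blast
  then show "lp_norm p (T *\<^sub>v x) \<le> 1 * lp_norm p (A *\<^sub>v x)" by (simp add: norms)
  have "nrm p n y \<le> real n * nrm 2 n y" by (rule nrm_le_mult_nrm) (use p in auto)
  also have "\<dots> = real n * real (n * d) * nrm 2 d z" by (simp add: 2[symmetric])
  also have "\<dots> \<le> real n * real (n * d) * (real d * nrm p d z)"
    by (intro mult_left_mono nrm_le_mult_nrm) (use p in auto)
  also have "\<dots> = real (n * d) ^ 2 * nrm p d z" by (simp add: power2_eq_square)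
  also have "\<dots> \<le> real d powr e * nrm p d z" using e by (intro mult_right_mono) auto
  finally have "nrm p n y \<le> real d powr e * nrm p d z" .
  moreover have "0 < real d powr e" using d by simp
  ultimately show "1 / real d powr e * lp_norm p (A *\<^sub>v x) \<le> lp_norm p (T *\<^sub>v x)"
    unfolding norms by (simp add: divide_le_eq mult.commute)
qed

section \<open>Balanced computation trees and induction along them\<close>

inductive balanced :: "nat \<Rightarrow> nat \<Rightarrow> ctree \<Rightarrow> bool" for b where
  leaf: "balanced b 0 (Leaf i)"
| node: "(\<And>t. t \<in> set ts \<Longrightarrow> balanced b h t) \<Longrightarrow> length ts \<le> b \<Longrightarrow> balanced b (Suc h) (Node ts)"

lemma chunks:
  "xs \<noteq> [] \<Longrightarrow> length xs \<le> b * c \<Longrightarrow> \<exists>yss. concat yss = xs \<and> length yss \<le> b \<and>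
    (\<forall>ys \<in> set yss. ys \<noteq> [] \<and> length ys \<le> c)"
proof (induction b arbitrary: xs)
  case (Suc b)
  then have c: "0 < c" by (cases c) auto
  show ?case
  proof (cases "length xs \<le> c")
    case True
    then show ?thesis using Suc.prems by (intro exI[of _ "[xs]"]) auto
  next
    case False
    then have "drop c xs \<noteq> []" "length (drop c xs) \<le> b * c" using Suc.prems by auto
    from Suc.IH[OF this] obtain yss where "concat yss = drop c xs" "length yss \<le> b"
      "\<forall>ys \<in> set yss. ys \<noteq> [] \<and> length ys \<le> c" by blast
    then show ?thesis using c Suc.prems by (intro exI[of _ "take c xs # yss"]) auto
  qed
qed simp

lemma balanced_exists:
  "xs \<noteq> [] \<Longrightarrow> length xs \<le> b ^ h \<Longrightarrow> \<exists>t. balanced b h t \<and> leaves t = xs"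
proof (induction h arbitrary: xs)
  case 0
  then obtain i where "xs = [i]" by (cases xs) auto
  then show ?case using balanced.leaf[of b i] by (intro exI[of _ "Leaf i"]) simp
next
  case (Suc h)
  obtain yss where yss: "concat yss = xs" "length yss \<le> b"
    "\<forall>ys \<in> set yss. ys \<noteq> [] \<and> length ys \<le> b ^ h" using chunks[of xs b "b ^ h"] Suc.prems by auto
  then have "\<forall>ys \<in> set yss. \<exists>t. balanced b h t \<and> leaves t = ys" using Suc.IH by blast
  then obtain f where f: "\<And>ys. ys \<in> set yss \<Longrightarrow> balanced b h (f ys) \<and> leaves (f ys) = ys" by metis
  have "leaves (Node (map f yss)) = concat (map id yss)"
    using f by (simp add: comp_def cong: map_cong)
  moreover have "balanced b (Suc h) (Node (map f yss))" using f yss by (intro balanced.node) auto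
  ultimately show ?case using yss(1) by auto
qed

text \<open>\<open>G\<close> relates the height of a node, the input rows below it and its summary,
  so that lossy and exact summaries share one induction. As all leaves have the same depth, one
  height fits all children.\<close>

lemma distributed_outputs_exists:
  assumes A: "A \<in> carrier_mat n d"
    and leaf: "\<And>i. i < length bs \<Longrightarrow> \<exists>T. node_outputs S W \<tau> (fst P) n d
      (mat_of_rows d (map (row A) (bs ! i))) T \<and> G 0 (map (row A) (bs ! i)) T"
    and node: "\<And>h vss Ts. list_all2 (G h) vss Ts \<Longrightarrow> length Ts \<le> b \<Longrightarrow>
      \<exists>T. node_outputs S W \<tau> (snd P) n d (mat_of_rows d (concat (map rows Ts))) T \<and> G (Suc h) (concat vss) T"
  shows "balanced b h t \<Longrightarrow> set (leaves t) \<subseteq> {..<length bs} \<Longrightarrow>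
    \<exists>T. distributed_outputs S W \<tau> P bs A t T \<and>
      G h (concat (map (\<lambda>i. map (row A) (bs ! i)) (leaves t))) T"
proof (induction rule: balanced.induct)
  case (leaf i)
  then show ?case using assms(2)[of i] A by (auto intro!: distributed_outputs.Leaf)
next
  case (node ts h)
  let ?v = "\<lambda>t. concat (map (\<lambda>i. map (row A) (bs ! i)) (leaves t))"
  have "\<forall>t \<in> set ts. \<exists>T. distributed_outputs S W \<tau> P bs A t T \<and> G h (?v t) T"
  proof
    fix t assume t: "t \<in> set ts"
    then have "set (leaves t) \<subseteq> {..<length bs}" using node.prems by auto
    then show "\<exists>T. distributed_outputs S W \<tau> P bs A t T \<and> G h (?v t) T" using node.IH[OF t] by blast
  qed
  then obtain f where f: "\<And>t. t \<in> set ts \<Longrightarrow> distributed_outputs S W \<tau> P bs A t (f t) \<and> G h (?v t) (f t)"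
    by metis
  have "list_all2 (G h) (map ?v ts) (map f ts)"
    using f by (simp add: list_all2_map1 list_all2_map2 list_all2_same)
  from assms(3)[OF this] node.hyps obtain T where T: "node_outputs S W \<tau> (snd P) n d
      (mat_of_rows d (concat (map rows (map f ts)))) T" "G (Suc h) (concat (map ?v ts)) T" by auto
  have "list_all2 (distributed_outputs S W \<tau> P bs A) ts (map f ts)"
    using f by (simp add: list_all2_map2 list_all2_same)
  then have "distributed_outputs S W \<tau> P bs A (Node ts) T"
    using T(1) A by (intro distributed_outputs.Node) auto
  moreover have "concat (map (\<lambda>i. map (row A) (bs ! i)) (leaves (Node ts))) = concat (map ?v ts)"
    by (induction ts) auto
  ultimately show ?case using T(2) by auto
qed

section \<open>Arithmetic of the parameters and the resource bounds\<close>

lemma parameters: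
  assumes \<gamma>: "0 < \<gamma>" "\<gamma> < 1" and d: "1 \<le> d" "real d \<le> real n powr \<gamma>"
  shows "1 \<le> n" "1 \<le> real n powr \<gamma>" "real n powr \<gamma> \<le> real n" "d \<le> n"
proof -
  show n: "1 \<le> n" using d by (cases n) auto
  show "1 \<le> real n powr \<gamma>" using d by linarith
  have "real n powr \<gamma> \<le> real n powr 1" using n \<gamma> by (intro powr_mono) auto
  then show "real n powr \<gamma> \<le> real n" using n by simp
  then show "d \<le> n" using d by linarith
qed

text \<open>For \<open>d \<ge> 2\<close> also \<open>n powr \<gamma> \<ge> 2\<close>, so the
  logarithm is at least 1/2 and the term with \<open>d ^ 5\<close> dominates. For
  \<open>d = 1\<close>, where the logarithm may vanish, the term with \<open>d ^ 2\<close>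
  suffices.\<close>

lemma time_bound_ge:
  assumes d: "1 \<le> d" "real d \<le> real n powr \<gamma>" and C: "0 \<le> C"
  shows "C * (real n powr \<gamma> * real d ^ 4) \<le> time_bound (2 * C) \<gamma> n d"
proof -
  define N where "N = real n powr \<gamma>"
  have N: "1 \<le> N" using d by (simp add: N_def)
  have "N * real d ^ 4 \<le> 2 * (N * real d ^ 2 + N * real d ^ 5 * ln N)"
  proof (cases "d = 1")
    case True
    then show ?thesis using N by simp
  next
    case False
    then have d2: "2 \<le> real d" using d by simp
    have "ln (1 / 2) \<le> 1 / 2 - (1::real)" by (rule ln_le_minus_one) simp
    then have "1 / 2 \<le> ln (2::real)" by (simp add: ln_div)
    also have "ln 2 \<le> ln N"
    proof -
      have "2 \<le> N" using d2 d(2) unfolding N_def by linarith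
      then show ?thesis by simp
    qed
    finally have ln: "1 / 2 \<le> ln N" .
    have "real d ^ 4 \<le> real d ^ 5" using d2 by (intro power_increasing) auto
    then have "N * real d ^ 4 \<le> N * real d ^ 5" using N by simp
    also have "\<dots> \<le> N * real d ^ 5 * (2 * ln N)"
      using ln N mult_left_mono[of 1 "2 * ln N" "N * real d ^ 5"] by simp
    also have "\<dots> \<le> 2 * (N * real d ^ 2) + N * real d ^ 5 * (2 * ln N)" using N by simp
    also have "\<dots> = 2 * (N * real d ^ 2 + N * real d ^ 5 * ln N)" by (simp add: algebra_simps)
    finally show ?thesis .
  qed
  from mult_left_mono[OF this C] show ?thesis
    by (simp add: time_bound_def N_def mult.left_commute mult.assoc)
qed

lemma space_bound_ge: "real X \<le> C * (real n powr \<gamma> * real d) \<Longrightarrow> X \<le> space_bound C \<gamma> n d"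
  unfolding space_bound_def by (rule le_nat_floor)

text \<open>As \<open>n + d\<close> is at least 2, a constant \<open>2 ^ k\<close> is absorbed by
  raising the exponent.\<close>

lemma word_bound_ge:
  assumes n: "1 \<le> n" and d: "1 \<le> d" and X: "X \<le> 2 ^ k * (n + d) ^ 2"
  shows "X \<le> word_bound (k + 2) n d"
proof -
  have "(2::nat) ^ k \<le> (n + d) ^ k" using n d by (intro power_mono) auto
  then have "2 ^ k * (n + d) ^ 2 \<le> (n + d) ^ (k + 2)"
    unfolding power_add by (rule mult_le_mono1)
  then show ?thesis using X by (simp add: word_bound_def)
qed

lemma word_bound_facts:
  assumes n: "1 \<le> n" and d: "1 \<le> d" and k: "(4::real) \<le> 2 ^ k"
  shows "n \<le> word_bound (k + 2) n d" "d \<le> word_bound (k + 2) n d" "n * d \<le> word_bound (k + 2) n d"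
    "2 * d * d + 2 \<le> word_bound (k + 2) n d" "1 \<le> word_bound (k + 2) n d"
proof -
  define Q where "Q = (n + d) ^ 2"
  have "real 4 \<le> real (2 ^ k)" using k by simp
  then have "(4::nat) \<le> 2 ^ k" by (simp only: of_nat_le_iff)
  then have Q: "4 * Q \<le> 2 ^ k * Q" by (rule mult_le_mono1)
  have W: "X \<le> word_bound (k + 2) n d" if "X \<le> 4 * Q" for X
    by (rule word_bound_ge[OF n d le_trans[OF that Q, unfolded Q_def]])
  have "n + d \<le> Q" unfolding Q_def by (rule self_le_power) (use d in auto)
  moreover have "n * d \<le> Q" "d * d \<le> Q"
    unfolding Q_def power2_eq_square by (intro mult_le_mono; simp)+
  moreover have "2 * d * d + 2 \<le> 4 * Q" using calculation d by (simp only: mult.assoc)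
  ultimately show "n \<le> word_bound (k + 2) n d" "d \<le> word_bound (k + 2) n d"
    "n * d \<le> word_bound (k + 2) n d" "2 * d * d + 2 \<le> word_bound (k + 2) n d"
    "1 \<le> word_bound (k + 2) n d"
    using n d by (intro W; linarith)+
qed

lemma space_bound_le_word_bound:
  assumes \<gamma>: "0 < \<gamma>" "\<gamma> < 1" and d: "1 \<le> d" "real d \<le> real n powr \<gamma>" and C: "0 \<le> C" "C \<le> 2 ^ k"
  shows "space_bound C \<gamma> n d \<le> word_bound (k + 2) n d"
proof (rule word_bound_ge)
  note par = parameters[OF \<gamma> d]
  show "1 \<le> n" "1 \<le> d" by (fact par(1) d(1))+
  have "real (space_bound C \<gamma> n d) \<le> C * (real n powr \<gamma> * real d)"
    unfolding space_bound_def using C by (intro of_nat_floor) auto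
  also have "\<dots> \<le> 2 ^ k * (real (n + d) * real (n + d))"
    using C par by (intro mult_mono) auto
  also have "\<dots> = real (2 ^ k * (n + d) ^ 2)" by (simp add: power2_eq_square)
  finally show "space_bound C \<gamma> n d \<le> 2 ^ k * (n + d) ^ 2" by (simp only: of_nat_le_iff)
qed

lemma node_run_within_bounds:
  assumes p: "1 \<le> p" and \<gamma>: "0 < \<gamma>" "\<gamma> < 1" and d: "1 \<le> d" "real d \<le> real n powr \<gamma>"
    and C: "400000 \<le> C" "C \<le> 2 ^ k"
    and M: "M \<in> carrier_mat m d" and m: "real m \<le> 2 * real n powr \<gamma>"
    and e: "e = IMul (IReg 0) (IReg 1) \<and> \<sigma> = n * d \<or> e = IConst 1 \<and> \<sigma> = 1"
  shows "\<exists>T. node_outputs (space_bound C \<gamma> n d) (word_bound (k + 2) n d) (time_bound C \<gamma> n d)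
      (node_com p \<gamma> e) n d M T \<and> T \<in> carrier_mat d d \<and>
    (if real n powr \<gamma> < real (d * d)
     then \<forall>x. sq_mass d d (\<lambda>i j. T $$ (i, j)) x = sq_mass m d (\<lambda>i j. M $$ (i, j)) x / (real \<sigma>)\<^sup>2
     else \<forall>i<d. \<forall>j<d. T $$ (i, j) = summary_fun p m d (\<lambda>i j. M $$ (i, j)) i j)"
proof -
  note par = parameters[OF \<gamma> d]
  define N where "N = real n powr \<gamma>"
  have N: "1 \<le> N" "real d \<le> N" "real m \<le> 2 * N" using par d m by (simp_all add: N_def)
  have k: "(4::real) \<le> 2 ^ k" using C by linarith
  note W = word_bound_facts[OF par(1) d(1) k]
  have lay: "layout (space_bound C \<gamma> n d) (word_bound (k + 2) n d) m d 0 (m * d) (m * d + d * d)"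
  proof
    have "real (m * d + d * d + d + 2) = real m * real d + real d * real d + real d + 2" by simp
    also have "\<dots> \<le> 2 * N * real d + N * real d + N * real d + 2 * (N * real d)"
    proof -
      have "1 * 1 \<le> N * real d" "1 * real d \<le> N * real d" "real d * real d \<le> N * real d"
        "real m * real d \<le> 2 * N * real d"
        using N d by (intro mult_mono; simp)+
      then show ?thesis by simp
    qed
    also have "\<dots> = 6 * (N * real d)" by simp
    also have "\<dots> \<le> C * (N * real d)" using C N by (intro mult_right_mono) auto
    finally show "m * d + d * d + d + 2 \<le> space_bound C \<gamma> n d"
      by (intro space_bound_ge) (simp add: N_def)
    show "space_bound C \<gamma> n d \<le> word_bound (k + 2) n d"
      using space_bound_le_word_bound[OF \<gamma> d _ C(2)] C by simp
    show "2 * d * d + 2 \<le> word_bound (k + 2) n d" by (rule W(4))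
  qed (use d in auto)
  have "real (60 + 3000 * ((2 * d) ^ 4 * (m + 2 * d)))
      = 60 + 48000 * (real d ^ 4 * (real m + 2 * real d))"
    by (simp add: power_mult_distrib)
  also have "\<dots> \<le> 60 * (N * real d ^ 4) + 48000 * (real d ^ 4 * (4 * N))"
  proof -
    have "1 \<le> real d ^ 4" using d by (intro one_le_power) simp
    then have "1 * 1 \<le> N * real d ^ 4" using N by (intro mult_mono) auto
    moreover have "real d ^ 4 * (real m + 2 * real d) \<le> real d ^ 4 * (4 * N)"
      using N by (intro mult_left_mono) auto
    ultimately show ?thesis by linarith
  qed
  also have "\<dots> \<le> C / 2 * (N * real d ^ 4)"
  proof -
    \<comment> \<open>\<open>60 + 48000 * 4 = 192060\<close>, which is covered by half of
      \<open>400000 \<le> C\<close>; the other half pays the factor 2 of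
      \<open>time_bound_ge\<close>.\<close>
    have "192060 * (N * real d ^ 4) \<le> C / 2 * (N * real d ^ 4)"
      using C N by (intro mult_right_mono) auto
    then show ?thesis by (simp add: mult.commute mult.left_commute)
  qed
  also have "\<dots> \<le> time_bound C \<gamma> n d"
    using time_bound_ge[OF d, of "C / 2"] C by (simp add: N_def)
  finally have \<tau>: "real (60 + 3000 * ((2 * d) ^ 4 * (m + 2 * d))) \<le> time_bound C \<gamma> n d" .
  show ?thesis
  proof (rule node_run[OF p M lay W(1) _ _ _ _ \<tau>])
    show "isafe (word_bound (k + 2) n d) s e \<and> ival s e = \<sigma>" if "regs s 0 = n" "regs s 1 = d" for s
      using e W that by auto
    show "icost e \<le> 3" "0 < \<sigma>" "\<sigma> \<le> word_bound (k + 2) n d"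
      using e W par(1) d(1) by auto
  qed
qed

lemma row_mass_append: "row_mass p x (vs @ ws) = row_mass p x vs + row_mass p x ws"
  by (simp add: row_mass_def)

lemma row_sq_append: "row_sq x (vs @ ws) = row_sq x vs + row_sq x ws"
  by (simp add: row_sq_def)

lemma row_sum_partition:
  fixes f :: "real vec \<Rightarrow> real"
  assumes A: "A \<in> carrier_mat n d" and bs: "distinct (concat bs)" "set (concat bs) = {..<n}"
  shows "(\<Sum>v\<leftarrow>concat (map (\<lambda>i. map (row A) (bs ! i)) [0..<length bs]). f v) = (\<Sum>v\<leftarrow>rows A. f v)"
proof -
  have "map (\<lambda>i. map (row A) (bs ! i)) [0..<length bs] = map (map (row A)) (map ((!) bs) [0..<length bs])"
    by simp
  also have "\<dots> = map (map (row A)) bs" by (simp only: map_nth)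
  finally have "concat (map (\<lambda>i. map (row A) (bs ! i)) [0..<length bs]) = map (row A) (concat bs)"
    by (simp only: map_concat)
  then have "(\<Sum>v\<leftarrow>concat (map (\<lambda>i. map (row A) (bs ! i)) [0..<length bs]). f v) =
      (\<Sum>i\<leftarrow>concat bs. f (row A i))" by (simp add: comp_def)
  also have "\<dots> = (\<Sum>i\<in>{..<n}. f (row A i))"
    using bs by (metis sum_list_distinct_conv_sum_set)
  also have "\<dots> = (\<Sum>v\<leftarrow>rows A. f v)"
    using A by (simp add: rows_def comp_def interv_sum_list_conv_sum_set_nat atLeast0LessThan)
  finally show ?thesis .
qed

lemma nat_ceiling_powr_half:
  assumes "1 \<le> real n powr \<gamma>"
  shows "real n powr (\<gamma> / 2) \<le> real (nat \<lceil>real n powr (\<gamma> / 2)\<rceil>)"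
    "real (nat \<lceil>real n powr (\<gamma> / 2)\<rceil>) \<le> 2 * real n powr (\<gamma> / 2)"
    "real n powr (\<gamma> / 2) * real n powr (\<gamma> / 2) = real n powr \<gamma>"
proof -
  show sq_mass: "real n powr (\<gamma> / 2) * real n powr (\<gamma> / 2) = real n powr \<gamma>"
    by (simp add: powr_add[symmetric])
  have "1 \<le> real n powr (\<gamma> / 2)"
  proof (rule ccontr)
    assume "\<not> ?thesis"
    then have "real n powr (\<gamma> / 2) * real n powr (\<gamma> / 2) < 1 * 1"
      by (intro mult_strict_mono) auto
    then show False using sq_mass assms by simp
  qed
  then show "real n powr (\<gamma> / 2) \<le> real (nat \<lceil>real n powr (\<gamma> / 2)\<rceil>)"
    "real (nat \<lceil>real n powr (\<gamma> / 2)\<rceil>) \<le> 2 * real n powr (\<gamma> / 2)"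
    by linarith+
qed

text \<open>If \<open>d * d\<close> is at most \<open>n powr \<gamma>\<close>, then \<open>d\<close>
  is at most \<open>n powr (\<gamma> / 2)\<close>, so a node has room for as many summaries of
  \<open>d\<close> rows as the fan-out requires.\<close>

lemma ceiling_times_dim_le:
  assumes N: "1 \<le> real n powr \<gamma>" and small: "\<not> real n powr \<gamma> < real (d * d)"
  shows "real (nat \<lceil>real n powr (\<gamma> / 2)\<rceil> * d) \<le> 2 * real n powr \<gamma>"
proof -
  note half = nat_ceiling_powr_half[OF N]
  have "real d * real d \<le> real n powr (\<gamma> / 2) * real n powr (\<gamma> / 2)"
    using small half(3) by simp
  then have "real d \<le> real n powr (\<gamma> / 2)"
    by (metis abs_le_square_iff abs_of_nat abs_of_nonneg power2_eq_square powr_ge_zero)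
  then have "real (nat \<lceil>real n powr (\<gamma> / 2)\<rceil>) * real d \<le>
      (2 * real n powr (\<gamma> / 2)) * real n powr (\<gamma> / 2)"
    using half(2) by (intro mult_mono) auto
  then show ?thesis using half(3) by simp
qed

lemma le_ceiling_power:
  assumes \<gamma>: "0 < \<gamma>" and n: "1 \<le> n" and b: "real n powr (\<gamma> / 2) \<le> real b"
  shows "n \<le> b ^ nat \<lceil>2 / \<gamma>\<rceil>"
proof -
  define L where "L = nat \<lceil>2 / \<gamma>\<rceil>"
  have L: "2 / \<gamma> \<le> real L" unfolding L_def by linarith
  have "1 \<le> \<gamma> / 2 * real L" using mult_left_mono[OF L, of "\<gamma> / 2"] \<gamma> by simp
  then have "real n powr 1 \<le> real n powr (\<gamma> / 2 * real L)" using n by (intro powr_mono) auto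
  also have "\<dots> = (real n powr (\<gamma> / 2)) powr real L" by (simp only: powr_powr)
  also have "\<dots> = (real n powr (\<gamma> / 2)) ^ L" by (rule powr_realpow) (use n in simp)
  also have "\<dots> \<le> real b ^ L" using b by (intro power_mono) auto
  finally have "real n \<le> real (b ^ L)" using n by simp
  then show ?thesis unfolding L_def by (simp only: of_nat_le_iff)
qed

text \<open>Here \<open>n\<close> is at most \<open>d powr (2 / \<gamma>)\<close>, so the square of
  \<open>n * d\<close> has exponent \<open>4 / \<gamma> + 2\<close>, below the
  \<open>12 / \<gamma>\<close> that the lossy case dictates.\<close>

lemma large_dimension:
  assumes \<gamma>: "0 < \<gamma>" "\<gamma> < 1" and d: "1 \<le> d" "real d \<le> real n powr \<gamma>"
    and large: "real n powr \<gamma> < real (d * d)"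
  shows "real (n * d) ^ 2 \<le> real d powr (12 / \<gamma>)"
proof -
  note par = parameters[OF \<gamma> d]
  have "real n = (real n powr \<gamma>) powr (1 / \<gamma>)" using \<gamma> par by (simp add: powr_powr)
  also have "\<dots> \<le> (real d powr 2) powr (1 / \<gamma>)"
    using large \<gamma> d by (intro powr_mono2) (auto simp: power2_eq_square)
  also have "\<dots> = real d powr (2 / \<gamma>)" by (simp only: powr_powr) simp
  finally have "real n * real d \<le> real d powr (2 / \<gamma>) * real d powr 1"
    using d by (intro mult_mono) auto
  then have "real (n * d) ^ 2 \<le> (real d powr (2 / \<gamma>) * real d powr 1) ^ 2"
    by (intro power_mono) auto
  also have "\<dots> = real d powr (2 * (2 / \<gamma> + 1))"
    unfolding power2_eq_square powr_add[symmetric] by simp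
  also have "\<dots> \<le> real d powr (12 / \<gamma>)"
    using \<gamma> d by (intro powr_mono) (auto simp: field_simps)
  finally show ?thesis .
qed

text \<open>The exponent is \<open>Suc h\<close> because a leaf, at height 0, has already compressed
  its block.\<close>

definition small_summary :: "real \<Rightarrow> nat \<Rightarrow> nat \<Rightarrow> real vec list \<Rightarrow> real mat \<Rightarrow> bool" where
  "small_summary p d h vs T \<longleftrightarrow> T \<in> carrier_mat d d \<and> (\<forall>x \<in> carrier_vec d.
     row_mass p x (rows T) \<le> row_mass p x vs \<and>
     row_mass p x vs \<le> (real d powr (3 * p)) ^ Suc h * row_mass p x (rows T))"

text \<open>The factor is the same at all heights: only leaves divide by \<open>n * d\<close>, and
  merging is exact.\<close>

definition large_summary :: "nat \<Rightarrow> nat \<Rightarrow> nat \<Rightarrow> real vec list \<Rightarrow> real mat \<Rightarrow> bool" where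
  "large_summary n d h vs T \<longleftrightarrow> T \<in> carrier_mat d d \<and> (\<forall>x \<in> carrier_vec d.
     row_sq x (rows T) = row_sq x vs / (real (n * d))\<^sup>2)"

lemma rows_summary:
  assumes p: "1 \<le> p" and d: "1 \<le> d" and M: "M \<in> carrier_mat m d" and T: "T \<in> carrier_mat d d"
    and eq: "\<forall>i<d. \<forall>j<d. T $$ (i, j) = summary_fun p m d (\<lambda>i j. M $$ (i, j)) i j"
    and x: "x \<in> carrier_vec d"
  shows "row_mass p x (rows T) \<le> row_mass p x (rows M)"
    "row_mass p x (rows M) \<le> real d powr (3 * p) * row_mass p x (rows T)"
proof -
  have "mass p d (mat_app d (\<lambda>i j. T $$ (i, j)) (vec_index x)) =
      mass p d (mat_app d (summary_fun p m d (\<lambda>i j. M $$ (i, j))) (vec_index x))"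
    using eq by (intro mass_cong) (simp add: mat_app_def)
  then show "row_mass p x (rows T) \<le> row_mass p x (rows M)"
    "row_mass p x (rows M) \<le> real d powr (3 * p) * row_mass p x (rows T)"
    using mass_summary[OF p d] by (simp_all add: row_mass_rows[OF M x] row_mass_rows[OF T x])
qed

lemma list_all2_small_summary:
  assumes "list_all2 (small_summary p d h) vss Ts" and x: "x \<in> carrier_vec d"
  shows "row_mass p x (concat (map rows Ts)) \<le> row_mass p x (concat vss) \<and>
    row_mass p x (concat vss) \<le> (real d powr (3 * p)) ^ Suc h * row_mass p x (concat (map rows Ts))"
  using assms(1)
proof (induction rule: list_all2_induct)
  case Nil
  show ?case by (simp add: row_mass_def)
next
  case (Cons vs vss T Ts)
  then show ?case using x unfolding small_summary_def
    by (simp add: row_mass_append distrib_left add_mono del: power_Suc)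
qed

lemma list_all2_large_summary:
  assumes "list_all2 (large_summary n d h) vss Ts" and x: "x \<in> carrier_vec d"
  shows "row_sq x (concat (map rows Ts)) = row_sq x (concat vss) / (real (n * d))\<^sup>2"
  using assms(1)
proof (induction rule: list_all2_induct)
  case Nil
  show ?case by (simp add: row_sq_def)
next
  case (Cons vs vss T Ts)
  then show ?case using x unfolding large_summary_def
    by (simp add: row_sq_append add_divide_distrib)
qed

lemma stacked_carrier:
  assumes "\<And>T. T \<in> set Ts \<Longrightarrow> T \<in> carrier_mat d d"
  shows "mat_of_rows d (concat (map rows Ts)) \<in> carrier_mat (length Ts * d) d"
    "rows (mat_of_rows d (concat (map rows Ts))) = concat (map rows Ts)"
proof -
  have "length (concat (map rows Ts)) = length Ts * d"
    using assms by (induction Ts) auto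
  then show "mat_of_rows d (concat (map rows Ts)) \<in> carrier_mat (length Ts * d) d" by auto
  have "set (concat (map rows Ts)) \<subseteq> carrier_vec d"
  proof -
    have "set (rows T) \<subseteq> carrier_vec d" if "T \<in> set Ts" for T
      using rows_carrier[of T] assms[OF that] by auto
    then show ?thesis by auto
  qed
  then show "rows (mat_of_rows d (concat (map rows Ts))) = concat (map rows Ts)"
    by (rule rows_mat_of_rows)
qed

lemma stacked_summaries_carrier:
  assumes "list_all2 G vss Ts" and "\<And>vs T. G vs T \<Longrightarrow> T \<in> carrier_mat d d"
  shows "T \<in> set Ts \<Longrightarrow> T \<in> carrier_mat d d"
  using assms by (auto simp: list_all2_conv_all_nth in_set_conv_nth)

theorem distributed_algorithm:
  assumes p: "1 \<le> p" and \<gamma>: "0 < \<gamma>" "\<gamma> < 1" and d: "1 \<le> d" "real d \<le> real n powr \<gamma>"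
    and C: "400000 \<le> C" "C \<le> 2 ^ k" and bs: "block_partition n (real n powr \<gamma>) bs"
  shows "\<exists>t. computation_tree bs t \<and> (\<forall>A \<in> carrier_mat n d.
    \<exists>T. distributed_outputs (space_bound C \<gamma> n d) (word_bound (k + 2) n d) (time_bound C \<gamma> n d)
       (node_com p \<gamma> (IMul (IReg 0) (IReg 1)), node_com p \<gamma> (IConst 1)) bs A t T \<and>
       subspace_embedding p (1 / real d powr (12 / \<gamma>)) 1 A T)"
proof -
  note par = parameters[OF \<gamma> d]
  define large where "large \<longleftrightarrow> real n powr \<gamma> < real (d * d)"
  \<comment> \<open>Exact merging makes depth harmless, so in the large case a binary tree of height
    \<open>n\<close> will do, and two summaries of \<open>d\<close> rows fit into any node. In the
    small case every level costs a factor, so the fan-out must be large and the height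
    constant.\<close>
  define b where "b = (if large then 2 else nat \<lceil>real n powr (\<gamma> / 2)\<rceil>)"
  define h where "h = (if large then n else nat \<lceil>2 / \<gamma>\<rceil>)"
  note run = node_run_within_bounds[OF p \<gamma> d C, folded large_def]
  have part: "distinct (concat bs)" "set (concat bs) = {..<n}"
    "\<And>b. b \<in> set bs \<Longrightarrow> b \<noteq> [] \<and> real (length b) \<le> real n powr \<gamma>"
    using bs by (auto simp: block_partition_def)
  have len: "length (concat bs) = n" using part(1,2) by (metis card_lessThan distinct_card)
  have "length bs \<le> n"
  proof -
    have "length bs = sum_list (map (\<lambda>b. 1) bs)" by (simp add: sum_list_triv)
    also have "\<dots> \<le> sum_list (map length bs)"
      using part(3) by (intro sum_list_mono) (simp add: Suc_le_eq)
    finally show ?thesis using len by (simp add: length_concat)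
  qed
  also have "n \<le> b ^ h"
    using le_ceiling_power[OF \<gamma>(1) par(1) nat_ceiling_powr_half(1)[OF par(2)]]
    by (auto simp: b_def h_def less_imp_le)
  finally have "length [0..<length bs] \<le> b ^ h" by simp
  moreover have "bs \<noteq> []" using len par(1) by auto
  ultimately obtain t where t: "balanced b h t" "leaves t = [0..<length bs]"
    using balanced_exists[of "[0..<length bs]" b h] by auto
  have bd: "real (b * d) \<le> 2 * real n powr \<gamma>"
  proof (cases large)
    case True
    then show ?thesis using d by (simp add: b_def)
  next
    case False
    then show ?thesis using ceiling_times_dim_le[OF par(2)] by (simp add: b_def large_def)
  qed
  have tree: "computation_tree bs t" by (auto simp: computation_tree_def t(2))
  show ?thesis
  proof (intro exI[of _ t] conjI tree ballI)
    fix A :: "real mat" assume A: "A \<in> carrier_mat n d"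
    define G where "G = (if large then large_summary n d else small_summary p d)"
    let ?P = "(node_com p \<gamma> (IMul (IReg 0) (IReg 1)), node_com p \<gamma> (IConst 1))"
    let ?S = "space_bound C \<gamma> n d" and ?W = "word_bound (k + 2) n d" and ?\<tau> = "time_bound C \<gamma> n d"
    have leaf: "\<exists>T. node_outputs ?S ?W ?\<tau> (fst ?P) n d (mat_of_rows d (map (row A) (bs ! i))) T \<and>
        G 0 (map (row A) (bs ! i)) T" if i: "i < length bs" for i
    proof -
      let ?M = "mat_of_rows d (map (row A) (bs ! i))"
      have M: "?M \<in> carrier_mat (length (bs ! i)) d" by auto
      have rows: "rows ?M = map (row A) (bs ! i)" using A by (intro rows_mat_of_rows) auto
      have "real (length (bs ! i)) \<le> 2 * real n powr \<gamma>" using part(3)[of "bs ! i"] i par(2) by auto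
      from run[OF M this, of "IMul (IReg 0) (IReg 1)" "n * d"] obtain T where
        T: "node_outputs ?S ?W ?\<tau> (fst ?P) n d ?M T" "T \<in> carrier_mat d d"
        "if large then \<forall>x. sq_mass d d (\<lambda>i j. T $$ (i, j)) x =
            sq_mass (length (bs ! i)) d (\<lambda>i j. ?M $$ (i, j)) x / (real (n * d))\<^sup>2
         else \<forall>i'<d. \<forall>j<d. T $$ (i', j) = summary_fun p (length (bs ! i)) d (\<lambda>i j. ?M $$ (i, j)) i' j"
        by auto
      have "G 0 (rows ?M) T"
      proof (cases large)
        case True
        then show ?thesis using T(2,3)
          by (simp add: G_def large_summary_def row_sq_rows[OF M] row_sq_rows[OF T(2)])
      next
        case False
        then show ?thesis using T(2,3) rows_summary[OF p d(1) M T(2)]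
          by (simp add: G_def small_summary_def)
      qed
      then show ?thesis using T(1) unfolding rows by blast
    qed
    have node: "\<exists>T. node_outputs ?S ?W ?\<tau> (snd ?P) n d (mat_of_rows d (concat (map rows Ts))) T \<and>
        G (Suc h) (concat vss) T" if G: "list_all2 (G h) vss Ts" and lb: "length Ts \<le> b" for h vss Ts
    proof -
      let ?M = "mat_of_rows d (concat (map rows Ts))"
      have "T \<in> carrier_mat d d" if "T \<in> set Ts" for T
        by (rule stacked_summaries_carrier[OF G _ that])
          (auto simp: G_def small_summary_def large_summary_def split: if_splits)
      note M = stacked_carrier[of Ts d, OF this]
      have "real (length Ts * d) \<le> real (b * d)" using lb by (simp add: mult_right_mono)
      then have "real (length Ts * d) \<le> 2 * real n powr \<gamma>" using bd by linarith
      from run[OF M(1) this, of "IConst 1" 1] obtain T where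
        T: "node_outputs ?S ?W ?\<tau> (snd ?P) n d ?M T" "T \<in> carrier_mat d d"
        "if large then \<forall>x. sq_mass d d (\<lambda>i j. T $$ (i, j)) x =
            sq_mass (length Ts * d) d (\<lambda>i j. ?M $$ (i, j)) x / (real 1)\<^sup>2
         else \<forall>i'<d. \<forall>j<d. T $$ (i', j) = summary_fun p (length Ts * d) d (\<lambda>i j. ?M $$ (i, j)) i' j"
        by auto
      have "G (Suc h) (concat vss) T"
      proof (cases large)
        case True
        have "row_sq x (rows T) = row_sq x (concat vss) / (real (n * d))\<^sup>2" if x: "x \<in> carrier_vec d" for x
        proof -
          have "row_sq x (rows T) = row_sq x (rows ?M)"
            using T(3) True by (simp add: row_sq_rows[OF M(1) x] row_sq_rows[OF T(2) x])
          also have "\<dots> = row_sq x (concat vss) / (real (n * d))\<^sup>2"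
            using list_all2_large_summary[OF _ x, of n h vss Ts] G True by (simp add: M(2) G_def)
          finally show ?thesis .
        qed
        then show ?thesis using T(2) True by (simp add: G_def large_summary_def)
      next
        case False
        have "row_mass p x (rows T) \<le> row_mass p x (concat vss) \<and>
            row_mass p x (concat vss) \<le> (real d powr (3 * p)) ^ Suc (Suc h) * row_mass p x (rows T)"
          if x: "x \<in> carrier_vec d" for x
        proof -
          have 1: "row_mass p x (rows T) \<le> row_mass p x (rows ?M)"
            "row_mass p x (rows ?M) \<le> real d powr (3 * p) * row_mass p x (rows T)"
            using rows_summary[OF p d(1) M(1) T(2) _ x] T(3) False by simp_all
          have 2: "row_mass p x (rows ?M) \<le> row_mass p x (concat vss)"
            "row_mass p x (concat vss) \<le> (real d powr (3 * p)) ^ Suc h * row_mass p x (rows ?M)"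
            using list_all2_small_summary[OF _ x, of p h vss Ts] G False by (simp_all add: M(2) G_def)
          have "(real d powr (3 * p)) ^ Suc h * row_mass p x (rows ?M) \<le>
              (real d powr (3 * p)) ^ Suc h * (real d powr (3 * p) * row_mass p x (rows T))"
            using 1(2) by (intro mult_left_mono) auto
          then show ?thesis using 1 2 by (simp add: mult_ac)
        qed
        then show ?thesis using T(2) False by (simp add: G_def small_summary_def)
      qed
      then show ?thesis using T(1) by blast
    qed
    obtain T where T: "distributed_outputs ?S ?W ?\<tau> ?P bs A t T"
      "G h (concat (map (\<lambda>i. map (row A) (bs ! i)) [0..<length bs])) T"
    proof -
      have "set (leaves t) \<subseteq> {..<length bs}" using t(2) by auto
      from distributed_outputs_exists[OF A leaf node t(1) this] show ?thesis
        using that unfolding t(2) by blast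
    qed
    have "subspace_embedding p (1 / real d powr (12 / \<gamma>)) 1 A T"
    proof (cases large)
      case True
      show ?thesis
        using T(2) True large_dimension[OF \<gamma> d] row_sum_partition[OF A part(1,2)]
        by (intro subspace_embedding_of_sq[OF p d(1) par(1) A])
          (auto simp: G_def large_def large_summary_def row_sq_def)
    next
      case False
      \<comment> \<open>A row passes \<open>Suc h\<close> compressions, the leaf included, and
        \<open>\<gamma> < 1\<close> bounds this by \<open>4 / \<gamma>\<close>: the origin of the
        exponent 12.\<close>
      have "real h \<le> 2 / \<gamma> + 1" using False \<gamma> by (simp add: h_def)
      also have "\<dots> \<le> 4 / \<gamma> - 1" using \<gamma> by (simp add: field_simps)
      finally have "3 * real (Suc h) \<le> 12 / \<gamma>" by simp
      then show ?thesis
        using T(2) False row_sum_partition[OF A part(1,2)]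
        by (intro subspace_embedding_of_mass[OF p d(1) A, where h = "Suc h" and m = d])
          (auto simp: G_def small_summary_def row_mass_def)
    qed
    then show "\<exists>T. distributed_outputs ?S ?W ?\<tau> ?P bs A t T \<and>
        subspace_embedding p (1 / real d powr (12 / \<gamma>)) 1 A T" using T(1) by blast
  qed
qed

section \<open>The streaming buffer\<close>

text \<open>
  The buffer of the streaming algorithm has levels \<open>0, \<dots>, L\<close> of \<open>b\<close> slots, a slot being a \<open>d\<close> by \<open>d\<close>
  matrix. Slot \<open>i\<close> of level \<open>l\<close> occupies rows \<open>(l * b + i) * d\<close> onwards.
\<close>

definition put :: "nat \<Rightarrow> (nat \<Rightarrow> nat \<Rightarrow> real) \<Rightarrow> nat \<Rightarrow> (nat \<Rightarrow> nat \<Rightarrow> real) \<Rightarrow> nat \<Rightarrow> nat \<Rightarrow> real" where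
  "put d R s T r j = (if s * d \<le> r \<and> r < s * d + d then T (r - s * d) j else R r j)"

definition clear :: "nat \<Rightarrow> nat \<Rightarrow> (nat \<Rightarrow> nat \<Rightarrow> real) \<Rightarrow> nat \<Rightarrow> nat \<Rightarrow> nat \<Rightarrow> real" where
  "clear b d R l r j = (if l * (b * d) \<le> r \<and> r < l * (b * d) + b * d then 0 else R r j)"

definition level_mass ::
  "real \<Rightarrow> nat \<Rightarrow> nat \<Rightarrow> (nat \<Rightarrow> nat \<Rightarrow> real) \<Rightarrow> nat \<Rightarrow> (nat \<Rightarrow> real) \<Rightarrow> real" where
  "level_mass p b d R l x = mass p (b * d) (\<lambda>r. mat_app d R x (l * (b * d) + r))"

text \<open>An empty slot is a zero matrix and contributes no mass. So levels and the whole buffer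
  can be treated as matrices of fixed size, without storing how full they are.\<close>

definition empty_slot :: "nat \<Rightarrow> (nat \<Rightarrow> nat \<Rightarrow> real) \<Rightarrow> nat \<Rightarrow> bool" where
  "empty_slot d R s \<longleftrightarrow> (\<forall>r<d. \<forall>j<d. R (s * d + r) j = 0)"

section \<open>Index arithmetic and masses of slots and levels\<close>

lemma slot_in_level:
  fixes i b d l :: nat
  assumes "i < b"
  shows "l * (b * d) \<le> (l * b + i) * d" "(l * b + i) * d + d \<le> l * (b * d) + b * d"
    "(l * b + i) * d = l * (b * d) + i * d"
proof -
  show "(l * b + i) * d = l * (b * d) + i * d" by (simp add: algebra_simps)
  then show "l * (b * d) \<le> (l * b + i) * d" by simp
  have "Suc i * d \<le> b * d" using assms by (intro mult_le_mono1) simp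
  then have "i * d + d \<le> b * d" by simp
  with \<open>(l * b + i) * d = l * (b * d) + i * d\<close>
  show "(l * b + i) * d + d \<le> l * (b * d) + b * d" by simp
qed

lemma level_separate:
  fixes l l' N r :: nat
  assumes "l \<noteq> l'" "r < N"
  shows "\<not> (l * N \<le> l' * N + r \<and> l' * N + r < l * N + N)"
proof
  assume "l * N \<le> l' * N + r \<and> l' * N + r < l * N + N"
  then have "(l' * N + r) div N = l" by (intro div_nat_eqI) (auto simp: algebra_simps)
  moreover have "(l' * N + r) div N = l'" using assms by simp
  ultimately show False using assms by simp
qed

lemma level_mass_put:
  assumes i: "i < b" and e: "empty_slot d R (l * b + i)"
  shows "level_mass p b d (put d R (l * b + i) T) l x = level_mass p b d R l x + mass p d (mat_app d T x)"
proof -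
  note s = slot_in_level[OF i, where l = l and d = d]
  let ?I = "{i * d..<i * d + d}"
  let ?R = "put d R (l * b + i) T"
  have split: "(\<Sum>r<b * d. f r) = (\<Sum>r\<in>{..<b * d} - ?I. f r) + (\<Sum>r<d. f (i * d + r))" for f :: "nat \<Rightarrow> real"
  proof -
    have "(\<Sum>r<b * d. f r) = (\<Sum>r\<in>{..<b * d} - ?I. f r) + (\<Sum>r\<in>?I. f r)"
      using slot_in_level(2)[OF i, of 0 d] by (intro sum.subset_diff) auto
    also have "(\<Sum>r\<in>?I. f r) = (\<Sum>r<d. f (i * d + r))"
      using sum.shift_bounds_nat_ivl[of f 0 "i * d" d] by (simp add: atLeast0LessThan add.commute)
    finally show ?thesis .
  qed
  have out: "?R (l * (b * d) + r) j = R (l * (b * d) + r) j" if "r \<in> {..<b * d} - ?I" for r j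
    using that by (auto simp: put_def s(3))
  have ins: "?R (l * (b * d) + (i * d + r)) j = T r j" if "r < d" for r j
    using that by (simp add: put_def s(3))
  have old: "R (l * (b * d) + (i * d + r)) j = 0" if "r < d" "j < d" for r j
    using e that by (simp add: empty_slot_def s(3) add.assoc)
  show ?thesis
    unfolding level_mass_def mass_def split mat_app_def
    using ins old by (simp add: out)
qed

lemma level_mass_put_other:
  assumes i: "i < b" and l: "l \<noteq> l'"
  shows "level_mass p b d (put d R (l * b + i) T) l' x = level_mass p b d R l' x"
proof -
  note s = slot_in_level[OF i, where l = l and d = d]
  have "put d R (l * b + i) T (l' * (b * d) + r) j = R (l' * (b * d) + r) j" if "r < b * d" for r j
  proof -
    have "\<not> ((l * b + i) * d \<le> l' * (b * d) + r \<and> l' * (b * d) + r < (l * b + i) * d + d)"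
      using level_separate[OF l that] s(1,2) by linarith
    then show ?thesis unfolding put_def by (rule if_not_P)
  qed
  then show ?thesis unfolding level_mass_def mat_app_def by (intro mass_cong) simp
qed

lemma level_mass_clear:
  "level_mass p b d (clear b d R l) l x = 0"
  by (simp add: level_mass_def mass_def mat_app_def clear_def)

lemma level_mass_clear_other:
  assumes l: "l \<noteq> l'"
  shows "level_mass p b d (clear b d R l) l' x = level_mass p b d R l' x"
proof -
  have "clear b d R l (l' * (b * d) + r) j = R (l' * (b * d) + r) j" if "r < b * d" for r j
    using level_separate[OF l that] unfolding clear_def by auto
  then show ?thesis unfolding level_mass_def mat_app_def by (intro mass_cong) simp
qed

lemma empty_slot_put:
  assumes "s \<noteq> s'" "empty_slot d R s'"
  shows "empty_slot d (put d R s T) s'"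
  using level_separate[OF assms(1), of _ d] assms(2) unfolding empty_slot_def put_def by auto

lemma empty_slot_clear:
  assumes "empty_slot d R s"
  shows "empty_slot d (clear b d R l) s"
  using assms unfolding empty_slot_def clear_def by auto

lemma empty_slot_cleared:
  assumes i: "i < b"
  shows "empty_slot d (clear b d R l) (l * b + i)"
  using slot_in_level[OF i, where l = l and d = d] unfolding empty_slot_def clear_def by auto

text \<open>The number of occupied slots of level \<open>l\<close> after \<open>t\<close> rows: the
  digits of \<open>t\<close> in base \<open>b\<close>, except that the last level \<open>L\<close>
  never carries.\<close>

definition digit :: "nat \<Rightarrow> nat \<Rightarrow> nat \<Rightarrow> nat \<Rightarrow> nat" where
  "digit b L t l = (if l = L then t div b ^ L else t div b ^ l mod b)"

lemma digit_Suc: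
  assumes b: "1 \<le> b" and l: "l \<le> L" and n: "l < L \<Longrightarrow> \<not> b ^ Suc l dvd Suc t"
  shows "digit b L (Suc t) l = digit b L t l + (if b ^ l dvd Suc t then 1 else 0)"
proof (cases "b ^ l dvd Suc t")
  case False
  then show ?thesis by (auto simp: digit_def div_Suc mod_eq_0_iff_dvd)
next
  case True
  then have q: "Suc t div b ^ l = Suc (t div b ^ l)" by (simp add: div_Suc mod_eq_0_iff_dvd)
  show ?thesis
  proof (cases "l = L")
    case False
    then have "\<not> b ^ Suc l dvd Suc t" using n l by simp
    then have "\<not> b dvd Suc t div b ^ l"
      using True b by (auto simp: dvd_div_iff_mult mult.commute)
    then have "Suc (t div b ^ l) mod b = Suc (t div b ^ l mod b)"
      unfolding q by (simp add: mod_Suc mod_eq_0_iff_dvd[symmetric] split: if_splits)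
    then show ?thesis using False True by (simp add: digit_def q)
  qed (use True q in \<open>simp add: digit_def\<close>)
qed

text \<open>The left side is how the program finds the next free slot from the row counter alone,
  after its increment. At the top level the digit has no \<open>mod\<close>, and
  \<open>Suc t \<le> b ^ L\<close> makes both sides 0.\<close>

lemma digit_carry:
  assumes b: "1 \<le> b" and l: "l < L" and dvd: "b ^ Suc l dvd Suc t" and t: "Suc t \<le> b ^ L"
  shows "(Suc t div b ^ Suc l - 1) mod b = digit b L t (Suc l)"
proof -
  have "Suc t div b ^ Suc l - 1 = t div b ^ Suc l" using dvd by (simp add: div_Suc mod_eq_0_iff_dvd del: power_Suc)
  then show ?thesis using t by (auto simp: digit_def simp del: power_Suc)
qed

text \<open>Occupancy while the carry is at level \<open>c\<close>: lower levels have their new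
  digit, level \<open>c\<close> may hold one slot more than its old digit and thus be full, and
  higher levels are as before.\<close>

definition level_bound :: "nat \<Rightarrow> nat \<Rightarrow> nat \<Rightarrow> nat \<Rightarrow> nat \<Rightarrow> nat" where
  "level_bound b L t c l = (if l < c then digit b L (Suc t) l
     else if l = c then digit b L t l + (if b ^ l dvd Suc t then 1 else 0) else digit b L t l)"

definition slots_invariant :: "nat \<Rightarrow> nat \<Rightarrow> nat \<Rightarrow> (nat \<Rightarrow> nat) \<Rightarrow> (nat \<Rightarrow> nat \<Rightarrow> real) \<Rightarrow> bool" where
  "slots_invariant b d L z R \<longleftrightarrow> (\<forall>l\<le>L. \<forall>i<b. z l \<le> i \<longrightarrow> empty_slot d R (l * b + i))"

text \<open>\<open>g l\<close> is the true mass of the input rows represented at level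
  \<open>l\<close>; such a row has been compressed \<open>l\<close> times.\<close>

definition mass_invariant :: "real \<Rightarrow> nat \<Rightarrow> nat \<Rightarrow> nat \<Rightarrow> ((nat \<Rightarrow> real) \<Rightarrow> real) \<Rightarrow> (nat \<Rightarrow> nat \<Rightarrow> real) \<Rightarrow> bool" where
  "mass_invariant p b d L f R \<longleftrightarrow> (\<exists>g. \<forall>x. (\<Sum>l\<le>L. g l x) = f x \<and>
     (\<forall>l\<le>L. level_mass p b d R l x \<le> g l x \<and> g l x \<le> (real d powr (3 * p)) ^ l * level_mass p b d R l x))"

lemma slots_put:
  assumes s: "slots_invariant b d L z R" and l: "l \<le> L" and i: "i < b" and z: "z l \<le> i"
    and z': "\<And>l'. l' \<noteq> l \<Longrightarrow> z l' \<le> z' l'" "Suc i \<le> z' l"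
  shows "slots_invariant b d L z' (put d R (l * b + i) T)"
  unfolding slots_invariant_def
proof (intro allI impI)
  fix l' i' assume l': "l' \<le> L" and i': "i' < b" and le: "z' l' \<le> i'"
  have "l * b + i \<noteq> l' * b + i'"
    using mat_index_inj[OF i i', of l l'] z' le by auto
  moreover have "z l' \<le> i'" using z z' le by (cases "l' = l") (auto intro: le_trans)
  ultimately show "empty_slot d (put d R (l * b + i) T) (l' * b + i')"
    using s l' i' by (intro empty_slot_put) (auto simp: slots_invariant_def)
qed

lemma slots_clear:
  assumes s: "slots_invariant b d L z R" and z': "\<And>l'. l' \<noteq> l \<Longrightarrow> z l' \<le> z' l'"
  shows "slots_invariant b d L z' (clear b d R l)"
  unfolding slots_invariant_def
proof (intro allI impI)
  fix l' i' assume l': "l' \<le> L" and i': "i' < b" and le: "z' l' \<le> i'"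
  show "empty_slot d (clear b d R l) (l' * b + i')"
  proof (cases "l' = l")
    case True
    then show ?thesis using i' empty_slot_cleared by blast
  next
    case False
    then have "z l' \<le> i'" using z'[OF False] le by simp
    then show ?thesis using s l' i' by (intro empty_slot_clear) (auto simp: slots_invariant_def)
  qed
qed

lemma mass_invariant_insert:
  assumes inv: "mass_invariant p b d L f R" and i: "i < b" and e: "empty_slot d R i"
  shows "mass_invariant p b d L (\<lambda>x. f x + mass p d (mat_app d T x)) (put d R i T)"
proof -
  obtain g where g: "\<And>x. (\<Sum>l\<le>L. g l x) = f x" "\<And>x l. l \<le> L \<Longrightarrow> level_mass p b d R l x \<le> g l x"
    "\<And>x l. l \<le> L \<Longrightarrow> g l x \<le> (real d powr (3 * p)) ^ l * level_mass p b d R l x"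
    using inv by (auto simp: mass_invariant_def)
  define g' where "g' = (\<lambda>l x. g l x + (if l = 0 then mass p d (mat_app d T x) else 0))"
  have "(\<Sum>l\<le>L. g' l x) = f x + mass p d (mat_app d T x)" for x
    by (simp add: g'_def sum.distrib g(1) sum.delta)
  moreover have "level_mass p b d (put d R i T) l x =
      level_mass p b d R l x + (if l = 0 then mass p d (mat_app d T x) else 0)" for l x
    using level_mass_put[OF i, where l = 0 and R = R] level_mass_put_other[OF i, where l = 0 and l' = l] e
    by auto
  moreover have "g' l x \<le> (real d powr (3 * p)) ^ l * (level_mass p b d R l x +
      (if l = 0 then mass p d (mat_app d T x) else 0))" if "l \<le> L" for l x
    using g(3)[OF that, of x] by (cases "l = 0") (simp_all add: g'_def)
  ultimately show ?thesis
    unfolding mass_invariant_def using g(2)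
    by (intro exI[of _ g']) (auto simp: g'_def)
qed

text \<open>The rows of level \<open>l\<close> move to level \<open>Suc l\<close> together with
  their true mass, and the compression on the way accounts for the additional factor there.\<close>

lemma mass_invariant_carry:
  assumes inv: "mass_invariant p b d L f R" and l: "l < L" and i: "i < b"
    and e: "empty_slot d R (Suc l * b + i)" and d: "1 \<le> d"
    and T: "\<And>x. mass p d (mat_app d T x) \<le> level_mass p b d R l x"
      "\<And>x. level_mass p b d R l x \<le> real d powr (3 * p) * mass p d (mat_app d T x)"
  shows "mass_invariant p b d L f (put d (clear b d R l) (Suc l * b + i) T)"
proof -
  let ?k = "real d powr (3 * p)" and ?R = "put d (clear b d R l) (Suc l * b + i) T"
  obtain g where g: "\<And>x. (\<Sum>l\<le>L. g l x) = f x" "\<And>x l. l \<le> L \<Longrightarrow> level_mass p b d R l x \<le> g l x"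
    "\<And>x l. l \<le> L \<Longrightarrow> g l x \<le> ?k ^ l * level_mass p b d R l x"
    using inv by (auto simp: mass_invariant_def)
  define g' where "g' = (\<lambda>l' x. if l' = l then 0 else g l' x + (if l' = Suc l then g l x else 0))"
  have sum: "(\<Sum>l\<le>L. g' l x) = f x" for x
  proof -
    have "(\<Sum>l'\<le>L. g' l' x) = (\<Sum>l'\<le>L. g l' x - (if l' = l then g l x else 0) + (if l' = Suc l then g l x else 0))"
      by (rule sum.cong) (auto simp: g'_def)
    also have "\<dots> = f x" using l by (simp add: sum.distrib sum_subtractf sum.delta g(1))
    finally show ?thesis .
  qed
  have e': "empty_slot d (clear b d R l) (Suc l * b + i)" using e by (rule empty_slot_clear)
  have lm: "level_mass p b d ?R l' x = (if l' = l then 0 else level_mass p b d R l' x +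
      (if l' = Suc l then mass p d (mat_app d T x) else 0))" for l' x
  proof (cases "l' = Suc l")
    case True
    then show ?thesis using level_mass_put[OF i e'] level_mass_clear_other[of l "Suc l"] by simp
  next
    case False
    then have "level_mass p b d ?R l' x = level_mass p b d (clear b d R l) l' x"
      using level_mass_put_other[OF i, of "Suc l" l'] by metis
    then show ?thesis using False level_mass_clear level_mass_clear_other by auto
  qed
  have "level_mass p b d ?R l' x \<le> g' l' x \<and> g' l' x \<le> ?k ^ l' * level_mass p b d ?R l' x" if l': "l' \<le> L" for l' x
  proof (cases "l' = Suc l")
    case True
    have "g l x \<le> ?k ^ l * level_mass p b d R l x" using g(3) l by simp
    also have "\<dots> \<le> ?k ^ l * (?k * mass p d (mat_app d T x))" using T(2) by (intro mult_left_mono) auto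
    finally have "g l x \<le> ?k ^ Suc l * mass p d (mat_app d T x)" by (simp add: mult_ac)
    moreover have "mass p d (mat_app d T x) \<le> g l x" using T(1)[of x] g(2)[of l x] l by linarith
    ultimately show ?thesis using g(2,3)[OF l', of x] True
      unfolding lm g'_def by (simp add: distrib_left del: power_Suc)
  next
    case False
    then show ?thesis using g(2,3)[OF l', of x] unfolding lm g'_def by simp
  qed
  then show ?thesis unfolding mass_invariant_def using sum by (intro exI[of _ g']) auto
qed

lemma mass_levels:
  "mass p (Suc L * (b * d)) (mat_app d R x) = (\<Sum>l\<le>L. level_mass p b d R l x)"
proof -
  have "(\<Sum>l\<le>L. level_mass p b d R l x) = (\<Sum>l<Suc L. \<Sum>r<b * d. \<bar>mat_app d R x (l * (b * d) + r)\<bar> powr p)"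
    by (simp only: level_mass_def mass_def lessThan_Suc_atMost)
  also have "\<dots> = (\<Sum>l<Suc L. \<Sum>r\<in>{l * (b * d)..<l * (b * d) + b * d}. \<bar>mat_app d R x r\<bar> powr p)"
    by (rule sum.cong[OF refl])
      (metis (no_types, lifting) sum.shift_bounds_nat_ivl[of _ 0] add.commute add_0 atLeast0LessThan sum.cong)
  also have "\<dots> = (\<Sum>r<Suc L * (b * d). \<bar>mat_app d R x r\<bar> powr p)" by (rule sum.nat_group)
  finally show ?thesis by (simp only: mass_def)
qed

text \<open>The factors of all levels are weakened to that of level \<open>L\<close>, the largest.
  So the buffer as a whole is a valid output, without a last compression.\<close>

lemma mass_invariant_total:
  assumes inv: "mass_invariant p b d L f R" and d: "1 \<le> d" and p: "1 \<le> p"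
  shows "mass p (Suc L * (b * d)) (mat_app d R x) \<le> f x"
    "f x \<le> (real d powr (3 * p)) ^ L * mass p (Suc L * (b * d)) (mat_app d R x)"
proof -
  let ?k = "real d powr (3 * p)"
  obtain g where g: "(\<Sum>l\<le>L. g l x) = f x" "\<And>l. l \<le> L \<Longrightarrow> level_mass p b d R l x \<le> g l x"
    "\<And>l. l \<le> L \<Longrightarrow> g l x \<le> ?k ^ l * level_mass p b d R l x"
    using inv by (auto simp: mass_invariant_def)
  show "mass p (Suc L * (b * d)) (mat_app d R x) \<le> f x"
    unfolding mass_levels g(1)[symmetric] using g(2) by (intro sum_mono) auto
  have k: "1 \<le> ?k" using d p by (intro ge_one_powr_ge_zero) auto
  have "g l x \<le> ?k ^ L * level_mass p b d R l x" if "l \<le> L" for l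
    using g(3)[OF that] power_increasing[OF that k]
      mult_right_mono[of "?k ^ l" "?k ^ L" "level_mass p b d R l x"] by (simp add: level_mass_def)
  then show "f x \<le> ?k ^ L * mass p (Suc L * (b * d)) (mat_app d R x)"
    unfolding mass_levels g(1)[symmetric] sum_distrib_left by (intro sum_mono) auto
qed

section \<open>Programs on the buffer and their running times\<close>

definition copy_block :: "iexp \<Rightarrow> iexp \<Rightarrow> com" where
  "copy_block src len = For 12 len (RStore (IAdd (IReg 9) (IReg 12)) (RCell (IAdd src (IReg 12))))"

definition zero_block :: "iexp \<Rightarrow> com" where
  "zero_block len = For 12 len (RStore (IAdd (IReg 9) (IReg 12)) (RConst 0))"

lemma wp_copy_block:
  assumes D: "regs s 9 = D" and src: "\<And>s'. frame 12 s s' \<Longrightarrow> isafe W s' src \<and> ival s' src = A"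
    and len: "\<And>s'. frame 12 s s' \<Longrightarrow> isafe W s' len \<and> ival s' len = N"
    and W: "N \<le> W" "1 \<le> W" "S \<le> W" and S: "D + N \<le> S" "A + N \<le> S"
    and disj: "A + N \<le> D \<or> D + N \<le> A" and cost: "icost src \<le> 5" "icost len \<le> 5"
  shows "wp S W (copy_block src len) s (\<lambda>t s'. t \<le> 122 * (N + 1) \<and> frame 12 s s' \<and>
    mem s' = (\<lambda>a. if D \<le> a \<and> a < D + N then mem s (A + (a - D)) else mem s a))"
proof -
  define J where "J = (\<lambda>i M. M = (\<lambda>a. if D \<le> a \<and> a < D + i then mem s (A + (a - D)) else mem s a))"
  show ?thesis
    unfolding copy_block_def
  proof (rule wp_For_frame[where J = J and N = N and a = 100 and X = 1 and D = "N + 1"], goal_cases)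
    case 1
    show ?case by (auto simp: J_def)
  next
    case (5 i s')
    have r: "regs s' 9 = D" "regs s' 12 = i" using 5 D by (auto simp: frame_def)
    have m: "mem s' (A + i) = mem s (A + i)" using 5(1,2) disj by (auto simp: J_def)
    have "J (Suc i) ((mem s')(D + i := mem s (A + i)))"
      using 5(2) by (auto simp: J_def fun_eq_iff less_Suc_eq)
    then show ?case
      using src[OF 5(4)] 5(1) W S cost by (intro wp_RStore) (auto simp: r m)
  next
    case (9 t s')
    then show ?case by (simp add: J_def)
  qed (use len W cost in auto)
qed

lemma wp_zero_block:
  assumes D: "regs s 9 = D" and len: "\<And>s'. frame 12 s s' \<Longrightarrow> isafe W s' len \<and> ival s' len = N"
    and W: "N \<le> W" "1 \<le> W" "S \<le> W" and S: "D + N \<le> S" and cost: "icost len \<le> 5"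
  shows "wp S W (zero_block len) s (\<lambda>t s'. t \<le> 122 * (N + 1) \<and> frame 12 s s' \<and>
    mem s' = (\<lambda>a. if D \<le> a \<and> a < D + N then 0 else mem s a))"
proof -
  define J where "J = (\<lambda>i M. M = (\<lambda>a. if D \<le> a \<and> a < D + i then 0 else mem s a))"
  show ?thesis
    unfolding zero_block_def
  proof (rule wp_For_frame[where J = J and N = N and a = 100 and X = 1 and D = "N + 1"], goal_cases)
    case 1
    show ?case by (auto simp: J_def)
  next
    case (5 i s')
    have r: "regs s' 9 = D" "regs s' 12 = i" using 5 D by (auto simp: frame_def)
    have "J (Suc i) ((mem s')(D + i := 0))"
      using 5(2) by (auto simp: J_def fun_eq_iff less_Suc_eq)
    then show ?case
      using 5(1) W S by (intro wp_RStore) (auto simp: r)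
  next
    case (9 t s')
    then show ?case by (simp add: J_def)
  qed (use len W cost in auto)
qed

text \<open>The machine offers division of indices but no remainder.\<close>

definition mod_iexp :: "iexp \<Rightarrow> iexp \<Rightarrow> iexp" where
  "mod_iexp e f = ISub e (IMul (IDiv e f) f)"

lemma mod_iexp [simp]:
  "ival s (mod_iexp e f) = ival s e mod ival s f"
  "icost (mod_iexp e f) = 3 + 2 * icost e + 2 * icost f"
  by (simp_all add: mod_iexp_def minus_div_mult_eq_mod)

lemma isafe_mod_iexp [simp]: "isafe W s (mod_iexp e f) \<longleftrightarrow> isafe W s e \<and> isafe W s f \<and> ival s f \<noteq> 0"
  by (auto simp: mod_iexp_def intro: le_trans[OF div_times_less_eq_dividend] isafe_ival_le)

text \<open>
  Register 4 counts the rows read so far, register 5 holds the number \<open>b\<close> of slots per level,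
  register 6 the current level \<open>l\<close> and register 7 the power \<open>b ^ Suc l\<close>.
\<close>

definition slot_addr :: "iexp \<Rightarrow> iexp" where
  "slot_addr e = IAdd (IReg 1) (IMul (IMul e (IReg 1)) (IReg 1))"

text \<open>\<open>compress\<close> destroys the block on which it works, so the level is zeroed as
  a whole before \<open>F\<close> is copied upwards. The target index is the one of
  \<open>digit_carry\<close>.\<close>

definition carry_level :: "real \<Rightarrow> com" where
  "carry_level p = Seq (ISet 8 (IMul (IReg 5) (IReg 1)))
     (Seq (ISet 9 (slot_addr (IMul (IReg 6) (IReg 5))))
     (Seq (compress p)
     (Seq (zero_block (IMul (IReg 8) (IReg 1)))
     (Seq (ISet 9 (slot_addr (IAdd (IMul (IAdd (IReg 6) (IConst 1)) (IReg 5))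
        (mod_iexp (ISub (IDiv (IReg 4) (IReg 7)) (IConst 1)) (IReg 5)))))
     (copy_block (IReg 10) (IMul (IReg 1) (IReg 1)))))))"

definition keep :: "state \<Rightarrow> state \<Rightarrow> bool" where
  "keep s s' \<longleftrightarrow> frame 8 s s' \<and> regs s' 10 = regs s 10 \<and> regs s' 11 = regs s 11"

lemma row_in_block:
  fixes r j d k N :: nat
  assumes j: "j < d"
  shows "k * d \<le> r * d + j \<and> r * d + j < (k + N) * d \<longleftrightarrow> k \<le> r \<and> r < k + N"
proof
  assume a: "k * d \<le> r * d + j \<and> r * d + j < (k + N) * d"
  have "\<not> r < k" using a mat_index_less[OF _ j, of r k] by auto
  moreover have "\<not> k + N \<le> r" using a mult_le_mono1[of "k + N" r d] by linarith
  ultimately show "k \<le> r \<and> r < k + N" by simp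
next
  assume "k \<le> r \<and> r < k + N"
  then show "k * d \<le> r * d + j \<and> r * d + j < (k + N) * d"
    using mat_index_less[OF _ j, of r "k + N"] by (simp add: trans_le_add1)
qed

text \<open>The cells below \<open>d\<close> receive the rows; then come the
  \<open>Suc L * b\<close> slots, \<open>F\<close> and the scratch vector. Register 7 is multiplied
  by \<open>b\<close> once more after the last carry level, hence
  \<open>b ^ Suc L \<le> W\<close>.\<close>

locale buffer =
  fixes p :: real and b d L S W :: nat
  assumes p: "1 \<le> p" and b: "1 \<le> b" and d: "1 \<le> d" and L: "1 \<le> L"
    and space: "d + Suc L * b * d * d + d * d + d + 2 \<le> S" and SW: "S \<le> W"
    and W: "2 * d * d + 2 \<le> W" "b ^ Suc L \<le> W" "L + 1 \<le> W"
begin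

definition Fb :: nat where "Fb = d + Suc L * b * d * d"
definition Cb :: nat where "Cb = Fb + d * d"

definition srep :: "(nat \<Rightarrow> real) \<Rightarrow> (nat \<Rightarrow> nat \<Rightarrow> real) \<Rightarrow> bool" where
  "srep M R \<longleftrightarrow> (\<forall>r<Suc L * b * d. \<forall>j<d. M (d + (r * d + j)) = R r j)"

text \<open>The cost unit of compressing one level: \<open>ud ^ 4 * um\<close> in the layout with
  \<open>m = b * d\<close>.\<close>

definition X :: nat where "X = (2 * d) ^ 4 * (b * d + 2 * d)"

lemma level_layout:
  assumes "l \<le> L"
  shows "layout S W (b * d) d (d + l * b * d * d) Fb Cb"
proof
  have "Suc l * (b * d * d) \<le> Suc L * (b * d * d)" using assms by (intro mult_le_mono1) simp
  then show "d + l * b * d * d + b * d * d \<le> Fb" by (simp add: Fb_def algebra_simps)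
  show "Cb + d + 2 \<le> S" using space by (simp add: Cb_def Fb_def)
qed (use SW W d in \<open>auto simp: Cb_def\<close>)

lemma X_bounds: "1 \<le> X" "b * d * d + 1 \<le> X" "d * d + 1 \<le> X"
proof -
  have b1: "1 * d \<le> b * d" using b by (intro mult_le_mono1)
  have "2 * d * 1 \<le> (2 * d) * (2 * d) ^ 3" using d by (intro mult_le_mono2) simp
  then have "2 * d \<le> (2 * d) ^ 4" by (simp add: power_numeral_reduce)
  then have "2 * d * (b * d + 2 * d) \<le> X" unfolding X_def by (rule mult_le_mono1)
  moreover have "1 \<le> d * d" using d by simp
  moreover have "2 * d * (b * d + 2 * d) = 2 * (b * d * d) + 4 * (d * d)" by (simp add: algebra_simps)
  moreover have "d * d \<le> b * d * d" using mult_le_mono1[OF b1, of d] by simp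
  ultimately show "1 \<le> X" "b * d * d + 1 \<le> X" "d * d + 1 \<le> X" by linarith+
qed

lemma slot_addr_safe:
  assumes "isafe W s e" "ival s e < Suc L * b" "regs s 1 = d"
  shows "isafe W s (slot_addr e)" "ival s (slot_addr e) = d + ival s e * d * d"
    "d + ival s e * d * d + d * d \<le> Fb"
proof -
  have "Suc (ival s e) * (d * d) \<le> Suc L * b * (d * d)" using assms(2) by (intro mult_le_mono1) simp
  then show 1: "d + ival s e * d * d + d * d \<le> Fb" by (simp add: Fb_def algebra_simps)
  then have 2: "d + ival s e * d * d \<le> W" using space SW unfolding Fb_def by linarith
  have "ival s e * d \<le> ival s e * d * d" using d by simp
  then have "ival s e * d \<le> W" using 2 by linarith
  then show "isafe W s (slot_addr e)" "ival s (slot_addr e) = d + ival s e * d * d"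
    using assms 2 by (auto simp: slot_addr_def)
qed

lemma wp_carry_level:
  assumes regs: "regs s 1 = d" "regs s 4 = u" "regs s 5 = b" "regs s 6 = l" "regs s 7 = b ^ Suc l"
      "regs s 10 = Fb" "regs s 11 = Cb"
    and l: "l < L" and u: "u \<le> W" and R: "srep (mem s) R"
  shows "wp S W (carry_level p) s (\<lambda>t s'. t \<le> 4000 * X \<and> keep s s' \<and>
    srep (mem s') (put d (clear b d R l) (Suc l * b + (u div b ^ Suc l - 1) mod b)
      (summary_fun p (b * d) d (\<lambda>k j. R (l * (b * d) + k) j))))"
proof -
  interpret lay: layout S W "b * d" d "d + l * b * d * d" Fb Cb
    using level_layout l by simp
  have "regs s (Suc 0) = d" using regs by simp
  note regs = regs this
  define A where "A = (\<lambda>k j. R (l * (b * d) + k) j)"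
  define T where "T = summary_fun p (b * d) d A"
  define x where "x = (u div b ^ Suc l - 1) mod b"
  define B where "B = d + l * b * d * d"
  define E where "E = d + (Suc l * b + x) * d * d"
  have x: "x < b" unfolding x_def using b by simp
  have slot: "Suc l * b + x < Suc L * b"
  proof -
    have "Suc (Suc l) * b \<le> Suc L * b" using l by (intro mult_le_mono1) simp
    then show ?thesis using x by simp
  qed
  have bl: "l * b < Suc L * b" using b l by (intro mult_less_mono1) auto
  have SlW: "Suc L * b \<le> Fb"
  proof -
    have "Suc L * b * 1 \<le> Suc L * b * (d * d)" using d by (intro mult_le_mono2) simp
    then show ?thesis unfolding Fb_def by (simp only: mult.assoc mult_1_right)
  qed
  have FbW: "Fb \<le> W" using space SW unfolding Fb_def by linarith
  have dW: "d \<le> W" "b \<le> W" "l + 1 \<le> W" "b * d \<le> W" "d * d \<le> W"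
    using lay.d_le_W lay.m_le_W W(1,3) l SlW FbW by (auto simp: algebra_simps)
  have bddW: "b * d * d \<le> W" using lay.lay(1) FbW by linarith
  let ?s1 = "s\<lparr>regs := (regs s)(8 := b * d)\<rparr>"
  define s2 where "s2 = s\<lparr>regs := (regs s)(8 := b * d, 9 := B)\<rparr>"
  have e2: "lay.env s2" by (simp add: lay.env_def s2_def regs B_def)
  have R2: "lay.rep (mem s) A (\<lambda>i j. mem s (Fb + (i * d + j))) (\<lambda>l. mem s (Cb + l)) (mem s2)"
  proof -
    have "mem s (d + l * b * d * d + (k * d + j)) = A k j" if "k < b * d" "j < d" for k j
    proof -
      have "Suc l * (b * d) \<le> Suc L * (b * d)" using l by (intro mult_le_mono1) simp
      moreover have "Suc l * (b * d) = l * (b * d) + b * d" by simp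
      ultimately have "l * (b * d) + k < Suc L * (b * d)" using that(1) by linarith
      then have "l * (b * d) + k < Suc L * b * d" by (simp only: mult.assoc)
      then have "mem s (d + ((l * (b * d) + k) * d + j)) = A k j"
        using R that(2) by (simp add: srep_def A_def)
      then show ?thesis by (simp add: algebra_simps)
    qed
    then show ?thesis by (simp add: lay.rep_def s2_def)
  qed
  have X_eq: "lay.ud * lay.ud * lay.ud * lay.ud * lay.um = X"
    by (simp add: X_def lay.ud_def lay.um_def power4_eq_xxxx mult.assoc)
  \<comment> \<open>The program is treated from its end backwards, so that each piece only has to
    establish the precondition of the rest.\<close>
  have copy: "wp S W (Seq (ISet 9 (slot_addr (IAdd (IMul (IAdd (IReg 6) (IConst 1)) (IReg 5))
        (mod_iexp (ISub (IDiv (IReg 4) (IReg 7)) (IConst 1)) (IReg 5)))))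
     (copy_block (IReg 10) (IMul (IReg 1) (IReg 1)))) s4
     (\<lambda>t s'. t \<le> 200 + 122 * (d * d + 1) \<and> keep s s' \<and>
       srep (mem s') (put d (clear b d R l) (Suc l * b + x) T))"
    if k4: "keep s s4" and F4: "\<And>i j. i < d \<Longrightarrow> j < d \<Longrightarrow> mem s4 (Fb + (i * d + j)) = T i j"
      and R4: "srep (mem s4) (clear b d R l)" for s4
  proof -
    let ?e = "IAdd (IMul (IAdd (IReg 6) (IConst 1)) (IReg 5))
        (mod_iexp (ISub (IDiv (IReg 4) (IReg 7)) (IConst 1)) (IReg 5))"
    have r4: "regs s4 (Suc 0) = d" "regs s4 4 = u" "regs s4 5 = b" "regs s4 6 = l" "regs s4 7 = b ^ Suc l"
      "regs s4 10 = Fb" "regs s4 11 = Cb"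
      using k4 regs by (simp_all add: keep_def frame_def)
    have "b ^ Suc l \<le> b ^ Suc L" using b l by (intro power_increasing) auto
    then have "b ^ Suc l \<le> W" using W(2) by linarith
    moreover have "b + l * b \<le> W" using slot SlW FbW by simp
    moreover have "Suc l * b + x \<le> W" using slot SlW FbW by linarith
    ultimately have e: "isafe W s4 ?e" "ival s4 ?e = Suc l * b + x"
      using r4 u dW b unfolding x_def by (simp_all add: algebra_simps)
    note addr = slot_addr_safe[OF e(1)]
    have E: "isafe W s4 (slot_addr ?e)" "ival s4 (slot_addr ?e) = E" "E + d * d \<le> Fb"
      using addr slot r4 unfolding e(2) E_def by simp_all
    let ?s5 = "s4\<lparr>regs := (regs s4)(9 := E)\<rparr>"
    have "wp S W (copy_block (IReg 10) (IMul (IReg 1) (IReg 1))) ?s5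
      (\<lambda>t s'. t \<le> 122 * (d * d + 1) \<and> frame 12 ?s5 s' \<and>
        mem s' = (\<lambda>a. if E \<le> a \<and> a < E + d * d then mem ?s5 (Fb + (a - E)) else mem ?s5 a))"
    proof (rule wp_copy_block)
      fix s' assume "frame 12 ?s5 s'"
      then show "isafe W s' (IReg 10) \<and> ival s' (IReg 10) = Fb"
        "isafe W s' (IMul (IReg 1) (IReg 1)) \<and> ival s' (IMul (IReg 1) (IReg 1)) = d * d"
        using r4 dW FbW by (auto simp: frame_def)
    qed (use E(3) lay.lay dW SW in auto)
    then have w: "wp S W (copy_block (IReg 10) (IMul (IReg 1) (IReg 1))) ?s5
      (\<lambda>t s'. t \<le> 122 * (d * d + 1) \<and> keep s s' \<and>
        srep (mem s') (put d (clear b d R l) (Suc l * b + x) T))"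
    proof (rule wp_mono)
      fix t s'
      assume a: "t \<le> 122 * (d * d + 1) \<and> frame 12 ?s5 s' \<and>
        mem s' = (\<lambda>a. if E \<le> a \<and> a < E + d * d then mem ?s5 (Fb + (a - E)) else mem ?s5 a)"
      have "keep s s'" using a k4 by (simp add: keep_def frame_def)
      moreover have "srep (mem s') (put d (clear b d R l) (Suc l * b + x) T)"
        unfolding srep_def
      proof (intro allI impI)
        fix r j assume r: "r < Suc L * b * d" and j: "j < d"
        let ?q = "Suc l * b + x"
        show "mem s' (d + (r * d + j)) = put d (clear b d R l) ?q T r j"
        proof (cases "?q * d \<le> r \<and> r < ?q * d + d")
          case True
          define i where "i = r - ?q * d"
          have i: "i < d" "r = ?q * d + i" using True by (auto simp: i_def)
          have "d + (r * d + j) = E + (i * d + j)" by (simp add: E_def i(2) algebra_simps)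
          moreover have "mem s' (E + (i * d + j)) = T i j"
            using a F4[OF i(1) j] mat_index_less[OF i(1) j] by simp
          ultimately have "mem s' (d + (r * d + j)) = T i j" by (simp only:)
          then show ?thesis using True by (simp add: put_def i_def del: mult_Suc)
        next
          case False
          have "E = d + ?q * d * d" "E + d * d = d + (?q * d + d) * d"
            by (simp_all add: E_def algebra_simps)
          then have "\<not> (E \<le> d + (r * d + j) \<and> d + (r * d + j) < E + d * d)"
            using False row_in_block[OF j, of "?q * d" r d] by linarith
          then show ?thesis using a False R4 r j by (auto simp: put_def srep_def)
        qed
      qed
      ultimately show "t \<le> 122 * (d * d + 1) \<and> keep s s' \<and>
        srep (mem s') (put d (clear b d R l) (Suc l * b + x) T)" using a by simp
    qed
    show ?thesis
      by (rule wp_ISet_Seq[OF E(1) _ w]) (use E(2) in \<open>simp_all add: slot_addr_def\<close>)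
  qed
  have zero: "wp S W (Seq (zero_block (IMul (IReg 8) (IReg 1)))
     (Seq (ISet 9 (slot_addr (IAdd (IMul (IAdd (IReg 6) (IConst 1)) (IReg 5))
        (mod_iexp (ISub (IDiv (IReg 4) (IReg 7)) (IConst 1)) (IReg 5)))))
     (copy_block (IReg 10) (IMul (IReg 1) (IReg 1))))) s3
     (\<lambda>t s'. t \<le> 200 + 122 * (d * d + 1) + 122 * (b * d * d + 1) \<and> keep s s' \<and>
       srep (mem s') (put d (clear b d R l) (Suc l * b + x) T))"
    if f3: "frame 12 s2 s3" and R3: "lay.rep (mem s) V T c (mem s3)" for s3 V c
  proof (rule wp_Seq, rule wp_mono[OF wp_zero_block[where D = B and N = "b * d * d"]], goal_cases)
    case 1
    show ?case using f3 by (simp add: frame_def s2_def)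
  next
    case (2 s')
    then show ?case using f3 bddW dW regs by (simp add: frame_def s2_def)
  next
    case (8 t s4)
    have 4: "t \<le> 122 * (b * d * d + 1)" "frame 12 s3 s4"
      "mem s4 = (\<lambda>a. if B \<le> a \<and> a < B + b * d * d then 0 else mem s3 a)" using 8 by auto
    have BF: "B + b * d * d \<le> Fb" using lay.lay(1) by (simp add: B_def)
    show ?case
    proof (rule wp_mono[OF copy], goal_cases)
      case 1
      show ?case using f3 4(2) by (simp add: keep_def frame_def s2_def)
    next
      case (2 i j)
      then show ?case using BF lay.rep_get(2)[OF R3, of i j] by (simp add: 4(3))
    next
      case 3
      show ?case unfolding srep_def
      proof (intro allI impI)
        fix r j assume r: "r < Suc L * b * d" and j: "j < d"
        have in_level: "B \<le> d + (r * d + j) \<and> d + (r * d + j) < B + b * d * d \<longleftrightarrow>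
            l * (b * d) \<le> r \<and> r < l * (b * d) + b * d"
        proof -
          have "B = d + l * (b * d) * d" "B + b * d * d = d + (l * (b * d) + b * d) * d"
            by (simp_all add: B_def algebra_simps)
          then show ?thesis using row_in_block[OF j, of "l * (b * d)" r "b * d"] by linarith
        qed
        show "mem s4 (d + (r * d + j)) = clear b d R l r j"
        proof (cases "l * (b * d) \<le> r \<and> r < l * (b * d) + b * d")
          case True
          then show ?thesis using in_level by (simp add: 4(3) clear_def)
        next
          case False
          have "r * d + j < Suc L * b * d * d" using mat_index_less[OF r j] .
          then have "d + (r * d + j) < Fb" by (simp add: Fb_def)
          moreover have "\<not> (B \<le> d + (r * d + j) \<and> d + (r * d + j) < B + b * d * d)"
            using False in_level by blast
          ultimately have "mem s3 (d + (r * d + j)) = mem s (d + (r * d + j))"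
            using R3 unfolding lay.rep_def B_def by auto
          then show ?thesis using False in_level R r j by (auto simp: 4(3) clear_def srep_def)
        qed
      qed
    next
      case (4 t' s')
      then show ?case using \<open>t \<le> _\<close> by simp
    qed
  qed (use lay.lay bddW SW dW in \<open>auto simp: B_def\<close>)
  have w2: "wp S W (Seq (compress p) (Seq (zero_block (IMul (IReg 8) (IReg 1)))
     (Seq (ISet 9 (slot_addr (IAdd (IMul (IAdd (IReg 6) (IConst 1)) (IReg 5))
        (mod_iexp (ISub (IDiv (IReg 4) (IReg 7)) (IConst 1)) (IReg 5)))))
     (copy_block (IReg 10) (IMul (IReg 1) (IReg 1)))))) s2
     (\<lambda>t s'. t \<le> 3500 * X + 200 \<and> keep s s' \<and>
       srep (mem s') (put d (clear b d R l) (Suc l * b + x) T))"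
  proof (rule wp_Seq, rule wp_mono[OF lay.wp_compress[OF p e2 R2]], goal_cases)
    case (1 t1 s3)
    then obtain V c where 3: "frame 12 s2 s3" "lay.rep (mem s) V T c (mem s3)"
      "t1 \<le> 3000 * X" by (auto simp: T_def X_eq)
    show ?case
      by (rule wp_mono[OF zero[OF 3(1,2)]]) (use 3(3) X_bounds in auto)
  qed
  have w1: "wp S W (Seq (ISet 9 (slot_addr (IMul (IReg 6) (IReg 5)))) (Seq (compress p) (Seq (zero_block (IMul (IReg 8) (IReg 1)))
     (Seq (ISet 9 (slot_addr (IAdd (IMul (IAdd (IReg 6) (IConst 1)) (IReg 5))
        (mod_iexp (ISub (IDiv (IReg 4) (IReg 7)) (IConst 1)) (IReg 5)))))
     (copy_block (IReg 10) (IMul (IReg 1) (IReg 1))))))) ?s1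
     (\<lambda>t s'. t \<le> 3500 * X + 250 \<and> keep s s' \<and>
       srep (mem s') (put d (clear b d R l) (Suc l * b + x) T))"
  proof -
    have e: "isafe W ?s1 (IMul (IReg 6) (IReg 5))" "ival ?s1 (IMul (IReg 6) (IReg 5)) = l * b"
      using regs dW bl SlW FbW by auto
    note addr = slot_addr_safe[OF e(1), unfolded e(2), OF bl]
    show ?thesis
      by (rule wp_ISet_Seq[OF _ _ w2])
        (use addr regs in \<open>simp_all add: s2_def B_def icost.simps slot_addr_def\<close>)
  qed
  show ?thesis
    unfolding carry_level_def T_def[symmetric, unfolded A_def] x_def[symmetric]
    by (rule wp_ISet_Seq[OF _ _ w1]) (use regs dW X_bounds in \<open>auto simp: T_def A_def\<close>)
qed

end

text \<open>With \<open>q\<close> in register 7 and \<open>u\<close> rows read,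
  \<open>q * (u div q) < u\<close> fails exactly if \<open>q\<close> divides \<open>u\<close>, that
  is, if level \<open>l\<close> has just become full.\<close>

definition level_step :: "real \<Rightarrow> com" where
  "level_step p = Seq (Cond (BNot (BILess (IMul (IReg 7) (IDiv (IReg 4) (IReg 7))) (IReg 4)))
      (carry_level p) Skip)
    (ISet 7 (IMul (IReg 7) (IReg 5)))"

text \<open>There is no early exit from the loop: at a level that is not full the step merely
  multiplies register 7, and no higher level can then be full.\<close>

definition append_row :: "real \<Rightarrow> nat \<Rightarrow> com" where
  "append_row p L = Seq (ISet 9 (slot_addr (mod_iexp (IReg 4) (IReg 5))))
     (Seq (copy_block (IConst 0) (IReg 1))
     (Seq (ISet 4 (IAdd (IReg 4) (IConst 1)))
     (Seq (ISet 7 (IReg 5))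
     (For 6 (IConst L) (level_step p)))))"

definition same :: "state \<Rightarrow> state \<Rightarrow> bool" where
  "same s s' \<longleftrightarrow> (\<forall>r\<in>{0,1,2,3,4,5,10,11}. regs s' r = regs s r)"

context buffer begin

definition buffer_invariant :: "nat \<Rightarrow> ((nat \<Rightarrow> real) \<Rightarrow> real) \<Rightarrow> (nat \<Rightarrow> nat) \<Rightarrow> (nat \<Rightarrow> real) \<Rightarrow> bool" where
  "buffer_invariant t f z M \<longleftrightarrow>
     (\<exists>R. srep M R \<and> slots_invariant b d L z R \<and> mass_invariant p b d L f R)"

lemma b_le_W: "b \<le> W"
  using self_le_power[of b "Suc L"] b W(2) by linarith

lemma wp_level_step:
  assumes regs: "regs s 1 = d" "regs s 4 = Suc t" "regs s 5 = b" "regs s 6 = l" "regs s 7 = b ^ Suc l"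
      "regs s 10 = Fb" "regs s 11 = Cb"
    and l: "l < L" and u: "Suc t \<le> W" "Suc t \<le> b ^ L"
    and inv: "buffer_invariant t f (level_bound b L t l) (mem s)"
  shows "wp S W (level_step p) s (\<lambda>\<tau> s'. \<tau> \<le> 4100 * X \<and> same s s' \<and> regs s' 6 = l \<and>
    regs s' 7 = b ^ Suc (Suc l) \<and> buffer_invariant t f (level_bound b L t (Suc l)) (mem s'))"
proof -
  obtain R where R: "srep (mem s) R" "slots_invariant b d L (level_bound b L t l) R"
    "mass_invariant p b d L f R" using inv by (auto simp: buffer_invariant_def)
  let ?q = "b ^ Suc l"
  have q: "1 \<le> ?q" "?q \<le> W" "?q * b \<le> W"
  proof -
    show "1 \<le> ?q" using b by simp
    have "?q \<le> b ^ Suc L" "b ^ Suc (Suc l) \<le> b ^ Suc L" using b l by (intro power_increasing; simp)+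
    moreover have "?q * b = b ^ Suc (Suc l)" by simp
    ultimately show "?q \<le> W" "?q * b \<le> W" using W(2) by linarith+
  qed
  note bW = b_le_W
  define x where "x = (Suc t div ?q - 1) mod b"
  define A where "A = (\<lambda>k j. R (l * (b * d) + k) j)"
  define T where "T = summary_fun p (b * d) d A"
  define R' where "R' = (if ?q dvd Suc t then put d (clear b d R l) (Suc l * b + x) T else R)"
  \<comment> \<open>Without a carry, \<open>level_bound\<close> is the same for \<open>l\<close> and
    \<open>Suc l\<close>. With one, level \<open>l\<close> becomes empty and the slot at the old
    digit of level \<open>Suc l\<close> is filled.\<close>
  have next_inv: "slots_invariant b d L (level_bound b L t (Suc l)) R' \<and> mass_invariant p b d L f R'"
  proof (cases "?q dvd Suc t")
    case False
    have "level_bound b L t (Suc l) l' = level_bound b L t l l'" for l'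
      using digit_Suc[of b l L t] b l False by (auto simp: level_bound_def simp del: power_Suc)
    then show ?thesis using R False by (simp add: R'_def slots_invariant_def del: power_Suc)
  next
    case True
    have xb: "x < b" using b by (simp add: x_def)
    have x: "x = digit b L t (Suc l)" unfolding x_def by (rule digit_carry[OF b l True u(2)])
    have empty: "empty_slot d R (Suc l * b + x)"
      using R(2)[unfolded slots_invariant_def, rule_format, of "Suc l" x] l xb x
      by (simp add: level_bound_def)
    let ?z = "(level_bound b L t l)(l := 0)"
    have "slots_invariant b d L ?z (clear b d R l)" by (rule slots_clear[OF R(2)]) simp
    then have "slots_invariant b d L (level_bound b L t (Suc l)) (put d (clear b d R l) (Suc l * b + x) T)"
      by (rule slots_put) (use l xb x True in \<open>auto simp: level_bound_def simp del: power_Suc\<close>)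
    moreover have "level_mass p b d R l y = mass p (b * d) (mat_app d A y)" for y
      by (simp add: level_mass_def A_def mat_app_def[abs_def])
    then have "mass_invariant p b d L f (put d (clear b d R l) (Suc l * b + x) T)"
      using mass_summary[OF p d] by (intro mass_invariant_carry[OF R(3) l xb empty d]) (simp_all add: T_def)
    ultimately show ?thesis using True by (simp add: R'_def)
  qed
  have test: "?q * (Suc t div ?q) < Suc t \<longleftrightarrow> \<not> ?q dvd Suc t"
  proof -
    have "?q * (Suc t div ?q) + Suc t mod ?q = Suc t" by (rule mult_div_mod_eq)
    then show ?thesis by (metis dvd_eq_mod_eq_0 add_0_right less_add_same_cancel1 neq0_conv nat_neq_iff)
  qed
  have finish: "wp S W (ISet 7 (IMul (IReg 7) (IReg 5))) s'
      (\<lambda>t' s''. t' + n \<le> 4100 * X \<and> same s s'' \<and> regs s'' 6 = l \<and>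
        regs s'' 7 = b ^ Suc (Suc l) \<and> buffer_invariant t f (level_bound b L t (Suc l)) (mem s''))"
    if k: "keep s s'" and R: "srep (mem s') R'" and n: "n \<le> 4050 * X" for s' n
  proof -
    have "regs s' 5 = b" "regs s' 6 = l" "regs s' 7 = ?q" using k regs by (simp_all add: keep_def frame_def)
    then show ?thesis
      using R next_inv k n q bW X_bounds(1)
      by (intro wp_ISet) (auto simp: buffer_invariant_def same_def keep_def frame_def mult.commute)
  qed
  show ?thesis
    unfolding level_step_def
  proof (rule wp_Seq, rule wp_Cond, goal_cases)
    case 1
    have "?q * (Suc t div ?q) \<le> W" using u by (meson le_trans times_div_less_eq_dividend)
    then show ?case using regs u q by simp
  next
    case 2
    then have dvd: "?q dvd Suc t" using test regs by (simp del: power_Suc)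
    show ?case
    proof (rule wp_mono[OF wp_carry_level[OF regs l u(1) R(1)]], elim conjE, goal_cases)
      case (1 \<tau> s')
      show ?case
        by (rule wp_mono[OF finish[of s' "9 + \<tau>"]])
          (use 1 dvd X_bounds in \<open>auto simp: R'_def x_def T_def A_def simp del: power_Suc\<close>)
    qed
  next
    case 3
    then have dvd: "\<not> ?q dvd Suc t" using test regs by (simp del: power_Suc)
    show ?case
      by (rule wp_Skip, rule wp_mono[OF finish[of s 50]])
        (use dvd X_bounds R in \<open>auto simp: R'_def keep_def simp del: power_Suc\<close>)
  qed
qed

text \<open>The factor \<open>Suc L\<close> pays for a carry through all levels. Such a row must
  itself meet the limit, since the bound holds for each update and not on average.\<close>

lemma wp_append_row:
  assumes regs: "regs s 1 = d" "regs s 4 = t" "regs s 5 = b" "regs s 10 = Fb" "regs s 11 = Cb"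
    and u: "Suc t \<le> W" "Suc t \<le> b ^ L" and row: "\<And>j. j < d \<Longrightarrow> mem s j = a j"
    and inv: "buffer_invariant t f (digit b L t) (mem s)"
  shows "wp S W (append_row p L) s (\<lambda>\<tau> s'. \<tau> \<le> 5000 * (Suc L * X) \<and>
    (\<forall>r\<in>{0,1,2,3,5,10,11}. regs s' r = regs s r) \<and> regs s' 4 = Suc t \<and>
    buffer_invariant (Suc t) (\<lambda>x. f x + \<bar>\<Sum>j<d. a j * x j\<bar> powr p) (digit b L (Suc t)) (mem s'))"
proof -
  let ?f = "\<lambda>x. f x + \<bar>\<Sum>j<d. a j * x j\<bar> powr p"
  obtain R where R: "srep (mem s) R" "slots_invariant b d L (digit b L t) R" "mass_invariant p b d L f R"
    using inv by (auto simp: buffer_invariant_def)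
  define x where "x = t mod b"
  have x: "x < b" "x = digit b L t 0" using b L by (simp_all add: x_def digit_def)
  \<comment> \<open>A row enters as a matrix whose other rows are zero. The program copies only
    \<open>d\<close> cells, because the rest of the empty slot is zero already.\<close>
  define T where "T = (\<lambda>(r::nat) j. if r = 0 then a j else (0::real))"
  define E where "E = d + x * d * d"
  have bL: "b \<le> Suc L * b" by simp
  have empty: "empty_slot d R (0 * b + x)" using R(2) x unfolding slots_invariant_def by blast
  have T: "mass p d (mat_app d T y) = \<bar>\<Sum>j<d. a j * y j\<bar> powr p" for y
  proof -
    have "mass p d (mat_app d T y) = (\<Sum>k<d. if k = 0 then \<bar>\<Sum>j<d. a j * y j\<bar> powr p else 0)"
      unfolding mass_def by (rule sum.cong) (auto simp: mat_app_def T_def)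
    then show ?thesis using d by (simp add: sum.delta)
  qed
  have R1: "slots_invariant b d L (level_bound b L t 0) (put d R (0 * b + x) T)"
    by (rule slots_put[OF R(2)]) (use x in \<open>auto simp: level_bound_def\<close>)
  have R2: "mass_invariant p b d L ?f (put d R (0 * b + x) T)"
    using mass_invariant_insert[OF R(3) x(1), of T] empty by (simp add: T)
  have lay: "layout S W (b * d) d (d + 0 * b * d * d) Fb Cb" by (rule level_layout) simp
  have FbW: "Fb \<le> W" using space SW unfolding Fb_def by linarith
  have dW: "d \<le> W" using layout.d_le_W[OF lay] .
  note bW = b_le_W
  define I where "I = (\<lambda>l (s'::state). (\<forall>r\<in>{0,1,2,3,5,10,11}. regs s' r = regs s r) \<and> regs s' 4 = Suc t \<and>
    regs s' 7 = b ^ Suc l \<and> buffer_invariant t ?f (level_bound b L t l) (mem s'))"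
  have loop: "wp S W (For 6 (IConst L) (level_step p)) s'
     (\<lambda>\<tau> s'. \<tau> \<le> 4122 * (Suc L * X) \<and> (\<forall>r\<in>{0,1,2,3,5,10,11}. regs s' r = regs s r) \<and> regs s' 4 = Suc t \<and>
       buffer_invariant (Suc t) ?f (digit b L (Suc t)) (mem s'))" if I: "I 0 s'" for s'
  proof (rule wp_For[where I = I and N = L and a = 4100 and X = X and D = "Suc L"], goal_cases)
    case 1
    show ?case using I by (simp add: I_def)
  next
    case (5 l s1)
    have r: "regs s1 1 = d" "regs s1 4 = Suc t" "regs s1 5 = b" "regs s1 6 = l" "regs s1 7 = b ^ Suc l"
      "regs s1 10 = Fb" "regs s1 11 = Cb"
      using 5(2,3) regs by (simp_all add: I_def)
    have "buffer_invariant t ?f (level_bound b L t l) (mem s1)" using 5(2) by (simp add: I_def)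
    from wp_level_step[OF r 5(1) u this]
    show ?case by (rule wp_mono) (use 5(2) in \<open>auto simp: I_def same_def\<close>)
  next
    case (9 \<tau> s1)
    obtain R' where R': "srep (mem s1) R'" "slots_invariant b d L (level_bound b L t L) R'"
      "mass_invariant p b d L ?f R'" using 9(2) by (auto simp: I_def buffer_invariant_def)
    have "level_bound b L t L l = digit b L (Suc t) l" if "l \<le> L" for l
      using that digit_Suc[of b L L t] b by (auto simp: level_bound_def)
    then have "slots_invariant b d L (digit b L (Suc t)) R'" using R'(2) by (simp add: slots_invariant_def)
    then have "buffer_invariant (Suc t) ?f (digit b L (Suc t)) (mem s1)"
      using R' by (auto simp: buffer_invariant_def)
    then show ?case using 9(1,2) by (simp add: I_def)
  qed (use W X_bounds in auto)
  have regs': "regs s (Suc 0) = d" using regs by simp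
  have e: "isafe W s (mod_iexp (IReg 4) (IReg 5))" "ival s (mod_iexp (IReg 4) (IReg 5)) = x"
    using regs u bW b by (simp_all add: x_def)
  have "x < Suc L * b" using x bL by linarith
  note addr = slot_addr_safe[OF e(1), unfolded e(2), OF this regs(1)]
  let ?s1 = "s\<lparr>regs := (regs s)(9 := E)\<rparr>"
  have copy: "wp S W (copy_block (IConst 0) (IReg 1)) ?s1 (\<lambda>\<tau> s'. \<tau> \<le> 122 * (d + 1) \<and> frame 12 ?s1 s' \<and>
    mem s' = (\<lambda>a. if E \<le> a \<and> a < E + d then mem ?s1 (0 + (a - E)) else mem ?s1 a))"
  proof (rule wp_copy_block)
    fix s' assume "frame 12 ?s1 s'"
    then show "isafe W s' (IReg 1) \<and> ival s' (IReg 1) = d" using regs' dW by (simp add: frame_def)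
  next
    have "d \<le> d * d" using d by simp
    then show "E + d \<le> S" using addr(3) space unfolding E_def Fb_def by linarith
  qed (use dW SW space W in \<open>auto simp: E_def\<close>)
  have srep: "srep M (put d R (0 * b + x) T)"
    if M: "M = (\<lambda>a. if E \<le> a \<and> a < E + d then mem s (a - E) else mem s a)" for M
    unfolding srep_def
  proof (intro allI impI)
    fix r j assume r: "r < Suc L * b * d" and j: "j < d"
    have E: "E = d + (x * d) * d" "E + d = d + (x * d + 1) * d" by (simp_all add: E_def algebra_simps)
    have iff: "E \<le> d + (r * d + j) \<and> d + (r * d + j) < E + d \<longleftrightarrow> r = x * d"
      using row_in_block[OF j, of "x * d" r 1] E by linarith
    show "M (d + (r * d + j)) = put d R (0 * b + x) T r j"
    proof (cases "r = x * d")
      case True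
      then have "M (d + (r * d + j)) = mem s j" using iff by (simp add: M E_def)
      then show ?thesis using True d row[OF j] by (simp add: put_def T_def)
    next
      case False
      then have "M (d + (r * d + j)) = R r j" using iff R(1) r j by (auto simp: M srep_def)
      moreover have "R r j = 0" if "x * d \<le> r" "r < x * d + d"
      proof -
        have "R ((0 * b + x) * d + (r - x * d)) j = 0"
          using empty that j unfolding empty_slot_def by (metis less_diff_conv2 add.commute)
        then show ?thesis using that(1) by simp
      qed
      ultimately show ?thesis using False by (auto simp: put_def T_def)
    qed
  qed
  have w3: "wp S W (Seq (ISet 4 (IAdd (IReg 4) (IConst 1))) (Seq (ISet 7 (IReg 5))
      (For 6 (IConst L) (level_step p)))) s2
     (\<lambda>\<tau> s'. \<tau> \<le> 10 + 4122 * (Suc L * X) \<and> (\<forall>r\<in>{0,1,2,3,5,10,11}. regs s' r = regs s r) \<and> regs s' 4 = Suc t \<and>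
       buffer_invariant (Suc t) ?f (digit b L (Suc t)) (mem s'))"
    if f: "frame 12 ?s1 s2" and M: "srep (mem s2) (put d R (0 * b + x) T)" for s2
  proof -
    let ?s3 = "s2\<lparr>regs := (regs s2)(4 := Suc t)\<rparr>"
    let ?s4 = "s2\<lparr>regs := (regs s2)(4 := Suc t, 7 := b)\<rparr>"
    have r: "regs s2 4 = t" "regs s2 5 = b" using f regs by (simp_all add: frame_def)
    have "I 0 ?s4" using f M R1 R2 by (auto simp: I_def frame_def buffer_invariant_def)
    note w = loop[OF this]
    have "wp S W (Seq (ISet 7 (IReg 5)) (For 6 (IConst L) (level_step p))) ?s3
     (\<lambda>\<tau> s'. \<tau> \<le> 2 + 4122 * (Suc L * X) \<and> (\<forall>r\<in>{0,1,2,3,5,10,11}. regs s' r = regs s r) \<and> regs s' 4 = Suc t \<and>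
       buffer_invariant (Suc t) ?f (digit b L (Suc t)) (mem s'))"
      by (rule wp_ISet_Seq[OF _ _ w]) (use r bW in auto)
    then show ?thesis
      by (rule wp_ISet_Seq[rotated 2]) (use r u in auto)
  qed
  have w1: "wp S W (Seq (copy_block (IConst 0) (IReg 1)) (Seq (ISet 4 (IAdd (IReg 4) (IConst 1)))
      (Seq (ISet 7 (IReg 5)) (For 6 (IConst L) (level_step p))))) ?s1
     (\<lambda>\<tau> s'. \<tau> \<le> 10 + 122 * (d + 1) + 4122 * (Suc L * X) \<and>
       (\<forall>r\<in>{0,1,2,3,5,10,11}. regs s' r = regs s r) \<and> regs s' 4 = Suc t \<and>
       buffer_invariant (Suc t) ?f (digit b L (Suc t)) (mem s'))"
  proof (rule wp_Seq, rule wp_mono[OF copy], elim conjE, goal_cases)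
    case (1 \<tau> s2)
    have "srep (mem s2) (put d R (0 * b + x) T)" by (rule srep) (simp add: 1(3) fun_eq_iff)
    from w3[OF 1(2) this] show ?case by (rule wp_mono) (use 1(1) in auto)
  qed
  have "d + 1 \<le> X"
  proof -
    have "d \<le> d * d" using d by simp
    then show ?thesis using X_bounds(3) by linarith
  qed
  then have "100 + 122 * (d + 1) \<le> 222 * X" using X_bounds(1) by simp
  also have "\<dots> \<le> 222 * (Suc L * X)" by simp
  finally have "100 + 122 * (d + 1) + 4122 * (Suc L * X) \<le> 5000 * (Suc L * X)" by simp
  then show ?thesis
    unfolding append_row_def
    by (intro wp_ISet_Seq[OF addr(1) _ w1]) (use addr in \<open>auto simp: E_def slot_addr_def\<close>)
qed

end

section \<open>The streaming algorithm\<close>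

definition large_test :: "real \<Rightarrow> bexp" where
  "large_test \<gamma> = BRLess (RPow (RIndex (IReg 0)) \<gamma>) (RIndex (IMul (IReg 1) (IReg 1)))"

text \<open>Reals cannot be rounded to indices, so the loop finds the ceiling of
  \<open>n powr (\<gamma> / 2)\<close> by counting. In the large case register 5 stays 0, and the
  same address formula places \<open>R\<close> directly behind the row cells. The result registers
  are set here, as the final program is \<open>Skip\<close>.\<close>

definition stream_init :: "real \<Rightarrow> nat \<Rightarrow> com" where
  "stream_init \<gamma> L = Seq (Cond (large_test \<gamma>) Skip
       (While (BRLess (RIndex (IReg 5)) (RPow (RIndex (IReg 0)) (\<gamma> / 2))) (ISet 5 (IAdd (IReg 5) (IConst 1)))))
     (Seq (ISet 10 (slot_addr (IMul (IConst (Suc L)) (IReg 5))))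
     (Seq (ISet 11 (IAdd (IReg 10) (IMul (IReg 1) (IReg 1))))
     (Cond (large_test \<gamma>)
       (Seq (ISet 2 (IReg 1)) (Seq (ISet 3 (IReg 10)) (Seq (ISet 7 (IMul (IReg 0) (IReg 1))) (ISet 8 (IConst 1)))))
       (Seq (ISet 2 (IMul (IMul (IConst (Suc L)) (IReg 5)) (IReg 1))) (ISet 3 (IReg 1))))))"

text \<open>Register 12 selects row 0 of the block of one row formed by the cells that receive the
  input.\<close>

definition stream_update :: "real \<Rightarrow> real \<Rightarrow> nat \<Rightarrow> com" where
  "stream_update p \<gamma> L = Cond (large_test \<gamma>) (Seq (ISet 12 (IConst 0)) insert_row) (append_row p L)"

lemma streaming_outputsI:
  assumes A: "A \<in> carrier_mat n d" and d: "d \<le> S"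
    and init: "wp S W c0 (initial_state n d) (\<lambda>t s. real t \<le> \<tau> \<and> I 0 s)"
    and pivot_step: "\<And>i s. i < n \<Longrightarrow> I i s \<Longrightarrow>
      wp S W c1 (receive_row (row A i) s) (\<lambda>t s'. real t \<le> \<tau> \<and> I (Suc i) s')"
    and \<tau>: "1 \<le> \<tau>" and res: "\<And>s. I n s \<Longrightarrow> \<exists>T. result S d s T \<and> E T"
  shows "\<exists>T. streaming_outputs S W \<tau> (c0, c1, Skip) A T \<and> E T"
proof -
  have "m \<le> n \<Longrightarrow> \<exists>\<sigma>. runs S W \<tau> c0 (initial_state n d) (\<sigma> 0) \<and>
    (\<forall>i<m. runs S W \<tau> c1 (receive_row (row A i) (\<sigma> i)) (\<sigma> (Suc i))) \<and> I m (\<sigma> m)" for m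
  proof (induction m)
    case 0
    from wp_runs[OF init] obtain s where "runs S W \<tau> c0 (initial_state n d) s" "I 0 s" by blast
    then show ?case by (intro exI[of _ "\<lambda>_. s"]) simp
  next
    case (Suc m)
    then obtain \<sigma> where \<sigma>: "runs S W \<tau> c0 (initial_state n d) (\<sigma> 0)" "I m (\<sigma> m)"
      "\<And>i. i < m \<Longrightarrow> runs S W \<tau> c1 (receive_row (row A i) (\<sigma> i)) (\<sigma> (Suc i))" by auto
    have "m < n" using Suc.prems by simp
    from wp_runs[OF pivot_step[OF this \<sigma>(2)]] obtain s where
      "runs S W \<tau> c1 (receive_row (row A m) (\<sigma> m)) s" "I (Suc m) s" by blast
    then show ?case using \<sigma> by (intro exI[of _ "\<sigma>(Suc m := s)"]) (auto simp: less_Suc_eq)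
  qed
  from this[OF order_refl] obtain \<sigma> where \<sigma>: "runs S W \<tau> c0 (initial_state n d) (\<sigma> 0)" "I n (\<sigma> n)"
      "\<forall>i<n. runs S W \<tau> c1 (receive_row (row A i) (\<sigma> i)) (\<sigma> (Suc i))" by blast
  obtain T where T: "result S d (\<sigma> n) T" "E T" using res[OF \<sigma>(2)] by blast
  have "runs S W \<tau> Skip (\<sigma> n) (\<sigma> n)"
    unfolding runs_def using exec.Skip \<tau> by (intro exI[of _ 1]) auto
  then have "streaming_outputs S W \<tau> (c0, c1, Skip) A T"
    using A d \<sigma> T(1) by auto
  then show ?thesis using T(2) by blast
qed

lemma large_test:
  assumes "regs s 0 = n" "regs s (Suc 0) = d" "n \<le> W" "d \<le> W" "d * d \<le> W"
  shows "bsafe S W s (large_test \<gamma>)" "bval s (large_test \<gamma>) \<longleftrightarrow> real n powr \<gamma> < real (d * d)"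
    "bcost (large_test \<gamma>) = 8"
  using assms by (auto simp: large_test_def)

lemma wp_stream_init:
  assumes b: "b = (if real n powr \<gamma> < real (d * d) then 0 else nat \<lceil>real n powr (\<gamma> / 2)\<rceil>)"
    and d: "1 \<le> d" and W: "n \<le> W" "n * d \<le> W" "b \<le> W" "Suc L \<le> W" "1 \<le> W"
    and Fb: "Fb = d + Suc L * b * d * d" "Fb + d * d \<le> W"
  shows "wp S W (stream_init \<gamma> L) (initial_state n d) (\<lambda>t s. t \<le> 100 + 11 * (b + 1) \<and> mem s = (\<lambda>_. 0) \<and>
    regs s 0 = n \<and> regs s 1 = d \<and> regs s 4 = 0 \<and> regs s 5 = b \<and> regs s 10 = Fb \<and> regs s 11 = Fb + d * d \<and>
    (if real n powr \<gamma> < real (d * d)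
     then regs s 2 = d \<and> regs s 3 = Fb \<and> regs s 7 = n * d \<and> regs s 8 = 1 \<and> regs s 9 = 0
     else regs s 2 = Suc L * b * d \<and> regs s 3 = d))"
proof -
  let ?large = "real n powr \<gamma> < real (d * d)"
  let ?s0 = "initial_state n d"
  define r0 where "r0 = regs ?s0"
  have r0: "r0 0 = n" "r0 (Suc 0) = d" "r0 4 = 0" "r0 5 = 0" "r0 9 = 0" and m0: "mem ?s0 = (\<lambda>_. 0)"
    by (simp_all add: r0_def initial_state_def)
  have dW: "d \<le> W" "d * d \<le> W" "Fb \<le> W" using Fb by linarith+
  note test = large_test[OF _ _ W(1) dW(1,2)]
  have 1: "wp S W (Cond (large_test \<gamma>) Skip
       (While (BRLess (RIndex (IReg 5)) (RPow (RIndex (IReg 0)) (\<gamma> / 2))) (ISet 5 (IAdd (IReg 5) (IConst 1)))))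
     ?s0 (\<lambda>t s. t \<le> 10 + 11 * (b + 1) \<and> mem s = (\<lambda>_. 0) \<and> regs s = r0(5 := b))"
  proof (rule wp_Cond, goal_cases)
    case 1
    show ?case using test r0 by (simp add: r0_def)
  next
    case 2
    then have "?large" using test r0 by (simp add: r0_def)
    then show ?case using b r0 m0 test[where s = ?s0 and \<gamma> = \<gamma>] by (intro wp_Skip) (auto simp: r0_def[symmetric])
  next
    case 3
    then have bb: "b = nat \<lceil>real n powr (\<gamma> / 2)\<rceil>" using b test r0 by (simp add: r0_def)
    show ?case
    proof (rule wp_While[where I = "\<lambda>i s. mem s = (\<lambda>_. 0) \<and> regs s = r0(5 := i)" and N = b and \<tau> = 4], goal_cases)
      case 1
      show ?case using r0 m0 by (auto simp: r0_def[symmetric])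
    next
      case (2 i s)
      have "real i < real n powr (\<gamma> / 2)" using 2(1) unfolding bb by linarith
      moreover have "i + 1 \<le> W" "i \<le> W" using 2(1) W by auto
      ultimately show ?case using 2(2) r0 W by (auto intro!: wp_ISet)
    next
      case (3 s)
      have "\<not> real b < real n powr (\<gamma> / 2)" unfolding bb by linarith
      then show ?case using 3 r0 W by auto
    next
      case (4 t s)
      then show ?case using test r0 by (simp add: r0_def)
    qed
  qed
  have SLb: "Suc L * b \<le> W" "Suc L * b * d \<le> W" "Suc L * b * d * d \<le> W"
  proof -
    have "Suc L * b * 1 \<le> Suc L * b * d" "Suc L * b * d * 1 \<le> Suc L * b * d * d"
      using d by (intro mult_le_mono2; simp)+
    moreover show "Suc L * b * d * d \<le> W" using Fb by linarith
    ultimately show "Suc L * b \<le> W" "Suc L * b * d \<le> W" by linarith+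
  qed
  have 2: "wp S W (Seq (ISet 10 (slot_addr (IMul (IConst (Suc L)) (IReg 5))))
     (Seq (ISet 11 (IAdd (IReg 10) (IMul (IReg 1) (IReg 1))))
     (Cond (large_test \<gamma>)
       (Seq (ISet 2 (IReg 1)) (Seq (ISet 3 (IReg 10)) (Seq (ISet 7 (IMul (IReg 0) (IReg 1))) (ISet 8 (IConst 1)))))
       (Seq (ISet 2 (IMul (IMul (IConst (Suc L)) (IReg 5)) (IReg 1))) (ISet 3 (IReg 1)))))) s
     (\<lambda>t s. t \<le> 90 \<and> mem s = (\<lambda>_. 0) \<and>
    regs s 0 = n \<and> regs s 1 = d \<and> regs s 4 = 0 \<and> regs s 5 = b \<and> regs s 10 = Fb \<and> regs s 11 = Fb + d * d \<and>
    (if ?large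
     then regs s 2 = d \<and> regs s 3 = Fb \<and> regs s 7 = n * d \<and> regs s 8 = 1 \<and> regs s 9 = 0
     else regs s 2 = Suc L * b * d \<and> regs s 3 = d))" if s: "mem s = (\<lambda>_. 0)" "regs s = r0(5 := b)" for s
  proof (rule wp_Seq, rule wp_ISet, goal_cases)
    case 1
    show ?case using s r0 W SLb Fb dW by (simp add: slot_addr_def del: mult_Suc)
  next
    case 2
    have addr: "ival s (slot_addr (IMul (IConst (Suc L)) (IReg 5))) = Fb"
      using s r0 Fb by (simp add: slot_addr_def del: mult_Suc)
    show ?case
      apply (simp only: addr)
      apply (rule wp_Seq)
      apply (rule wp_ISet)
      subgoal using s r0 dW Fb by simp
      apply (rule wp_Cond)
      subgoal by (rule test(1)) (use s r0 in simp_all)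
      subgoal premises prem
      proof -
        have large: ?large using prem test(2) s r0 by simp
        show ?thesis
          by (intro wp_Seq wp_ISet) (use s r0 W dW Fb large test(3) in \<open>auto simp: slot_addr_def large_test_def\<close>)
      qed
      subgoal premises prem
      proof -
        have small: "\<not> ?large" using prem test(2) s r0 by simp
        show ?thesis
          by (intro wp_Seq wp_ISet) (use s r0 W dW Fb SLb small in \<open>auto simp: slot_addr_def large_test_def\<close>)
      qed
      done
  qed
  show ?thesis
    unfolding stream_init_def
    apply (rule wp_Seq)
    apply (rule wp_mono[OF 1])
    apply (elim conjE)
    apply (rule wp_mono[OF 2])
    by auto
qed

lemma (in buffer) buffer_invariant_start:
  "buffer_invariant 0 (\<lambda>_. 0) (digit b L 0) (\<lambda>_. 0)"
proof -
  have "level_mass p b d (\<lambda>_ _. 0) l x = 0" for l x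
    by (simp add: level_mass_def mass_def mat_app_def)
  then show ?thesis
    unfolding buffer_invariant_def
    by (intro exI[of _ "\<lambda>_ _. 0"])
      (auto simp: srep_def slots_invariant_def empty_slot_def mass_invariant_def intro!: exI[of _ "\<lambda>_ _. 0"])
qed

text \<open>Used for the arrival of a row, which overwrites only cells below \<open>d\<close>, in
  front of the buffer.\<close>

lemma (in buffer) buffer_invariant_cong:
  assumes "buffer_invariant t f z M" "\<And>a. d \<le> a \<Longrightarrow> M' a = M a"
  shows "buffer_invariant t f z M'"
  using assms unfolding buffer_invariant_def srep_def by (metis le_add1)

lemma streaming_small:
  assumes buf: "buffer p b d L S W" and A: "A \<in> carrier_mat n d"
    and small: "\<not> real n powr \<gamma> < real (d * d)" and beq: "b = nat \<lceil>real n powr (\<gamma> / 2)\<rceil>"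
    and nb: "n \<le> b ^ L" and WW: "n \<le> W" "n * d \<le> W"
    and \<tau>: "real (100 + 11 * (b + 1)) \<le> \<tau>" "real (20 + 5000 * (Suc L * ((2 * d) ^ 4 * (b * d + 2 * d)))) \<le> \<tau>"
    and e: "3 * real L \<le> e"
  shows "\<exists>T. streaming_outputs S W \<tau> (stream_init \<gamma> L, stream_update p \<gamma> L, Skip) A T \<and>
    subspace_embedding p (1 / real d powr e) 1 A T"
proof -
  interpret buffer p b d L S W by (rule buf)
  define f where "f = (\<lambda>t x. \<Sum>k<t. \<bar>\<Sum>j<d. A $$ (k, j) * x j\<bar> powr p)"
  define I where "I = (\<lambda>t (s::state). regs s 0 = n \<and> regs s 1 = d \<and> regs s 2 = Suc L * b * d \<and> regs s 3 = d \<and>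
    regs s 4 = t \<and> regs s 5 = b \<and> regs s 10 = Fb \<and> regs s 11 = Cb \<and>
    buffer_invariant t (f t) (digit b L t) (mem s))"
  have FbW: "Fb + d * d \<le> W" "Fb \<le> W" using space SW unfolding Fb_def by linarith+
  have dW: "d \<le> W" "d * d \<le> W" using FbW unfolding Fb_def by linarith+
  show ?thesis
  proof (rule streaming_outputsI[where I = I, OF A], goal_cases)
    case 1
    show ?case using space by linarith
  next
    case 2
    have "b = (if real n powr \<gamma> < real (d * d) then 0 else nat \<lceil>real n powr (\<gamma> / 2)\<rceil>)"
      using small beq by simp
    from wp_stream_init[OF this d WW b_le_W _ _ Fb_def FbW(1)] W(3)
    have init: "wp S W (stream_init \<gamma> L) (initial_state n d) (\<lambda>t s. t \<le> 100 + 11 * (b + 1) \<and> mem s = (\<lambda>_. 0) \<and>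
      regs s 0 = n \<and> regs s 1 = d \<and> regs s 4 = 0 \<and> regs s 5 = b \<and> regs s 10 = Fb \<and> regs s 11 = Fb + d * d \<and>
      (if real n powr \<gamma> < real (d * d)
       then regs s 2 = d \<and> regs s 3 = Fb \<and> regs s 7 = n * d \<and> regs s 8 = 1 \<and> regs s 9 = 0
       else regs s 2 = Suc L * b * d \<and> regs s 3 = d))" by simp
    show ?case
    proof (rule wp_mono[OF init], elim conjE, goal_cases)
      case (1 t s)
      have "real t \<le> real (100 + 11 * (b + 1))" using 1(1) by (simp only: of_nat_le_iff)
      then have "real t \<le> \<tau>" using \<tau>(1) by linarith
      moreover have "f 0 = (\<lambda>_. 0)" by (simp add: f_def)
      ultimately show ?case
        using 1 small buffer_invariant_start by (simp add: I_def Cb_def)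
    qed
  next
    case (3 t s)
    let ?s = "receive_row (row A t) s"
    have regs: "regs ?s = regs s" by (simp add: receive_row_def)
    have dimA: "dim_vec (row A t) = d" using A by simp
    have row: "mem ?s j = A $$ (t, j)" if "j < d" for j
      using that A 3(1) by (simp add: receive_row_def)
    have inv: "buffer_invariant t (f t) (digit b L t) (mem ?s)"
      by (rule buffer_invariant_cong) (use 3(2) dimA in \<open>auto simp: I_def receive_row_def\<close>)
    have r: "regs ?s 1 = d" "regs ?s 4 = t" "regs ?s 5 = b" "regs ?s 10 = Fb" "regs ?s 11 = Cb"
      using 3(2) by (simp_all add: regs I_def)
    have r0: "regs ?s 0 = n" "regs ?s (Suc 0) = d" using 3(2) by (simp_all add: regs I_def)
    have tW: "Suc t \<le> W" "Suc t \<le> b ^ L" using 3(1) WW nb by auto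
    note test = large_test[OF r0 WW(1) dW, where \<gamma> = \<gamma>]
    show ?case
      unfolding stream_update_def
    proof (rule wp_Cond, goal_cases)
      case 1
      show ?case by (rule test)
    next
      case 2
      then show ?case using test(2) small by simp
    next
      case 3
      show ?case
      proof (rule wp_mono[OF wp_append_row[OF r tW row inv]], assumption, elim conjE, goal_cases)
        case (1 u s')
        have "real (1 + bcost (large_test \<gamma>) + u) \<le> real (20 + 5000 * (Suc L * X))"
          using 1(1) by (simp only: of_nat_le_iff test(3))
        then have "real (1 + bcost (large_test \<gamma>) + u) \<le> \<tau>" using \<tau>(2) unfolding X_def by linarith
        moreover have "f (Suc t) = (\<lambda>x. f t x + \<bar>\<Sum>j<d. A $$ (t, j) * x j\<bar> powr p)"
          by (simp add: f_def fun_eq_iff)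
        moreover have "\<forall>r\<in>{0,1,2,3,5,10,11}. regs s' r = regs s r" using 1(2) regs by simp
        ultimately show ?case using 1(3,4) \<open>I t s\<close> by (auto simp: I_def)
      qed
    qed
  next
    case 4
    have "real 1 \<le> real (100 + 11 * (b + 1))" by simp
    then show ?case using \<tau>(1) by linarith
  next
    case (5 s)
    define T where "T = mat (Suc L * b * d) d (\<lambda>(i, j). mem s (d + i * d + j))"
    have T: "T \<in> carrier_mat (Suc L * b * d) d" by (simp add: T_def)
    have r: "regs s 2 = Suc L * b * d" "regs s 3 = d" using 5 by (auto simp: I_def)
    have "d + Suc L * b * d * d \<le> S" using space by linarith
    then have res: "result S d s T" unfolding result_def r T_def by simp
    obtain R where R: "srep (mem s) R" "mass_invariant p b d L (f n) R"
      using 5 by (auto simp: I_def buffer_invariant_def)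
    have TR: "row_mass p x (rows T) = mass p (Suc L * (b * d)) (mat_app d R (vec_index x))"
      if "x \<in> carrier_vec d" for x
    proof -
      have "T $$ (i, j) = R i j" if "i < Suc L * (b * d)" "j < d" for i j
      proof -
        have i: "i < Suc L * b * d" using that(1) by (simp only: mult.assoc)
        then have "T $$ (i, j) = mem s (d + (i * d + j))" using that(2) by (simp add: T_def add.assoc del: mult_Suc)
        then show ?thesis using R(1) i that(2) by (simp add: srep_def del: mult_Suc)
      qed
      then show ?thesis
        unfolding row_mass_rows[OF T that] mult.assoc by (intro mass_cong) (simp add: mat_app_def del: mult_Suc)
    qed
    have Af: "row_mass p x (rows A) = f n (vec_index x)" if "x \<in> carrier_vec d" for x
      unfolding row_mass_rows[OF A that] by (simp add: f_def mass_def mat_app_def)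
    have "subspace_embedding p (1 / real d powr e) 1 A T"
      by (rule subspace_embedding_of_mass[OF p d A T _ _ e])
        (use mass_invariant_total[OF R(2) d p] in \<open>auto simp: TR Af\<close>)
    then show ?case using res by blast
  qed
qed

lemma streaming_large:
  assumes p: "1 \<le> p" and d: "1 \<le> d" and A: "A \<in> carrier_mat n d" and n: "1 \<le> n"
    and large: "real n powr \<gamma> < real (d * d)"
    and S: "d + d * d + d + 2 \<le> S" "S \<le> W" and W: "n \<le> W" "n * d \<le> W" "2 * d * d + 2 \<le> W" "Suc L \<le> W"
    and \<tau>: "real (200 + 2400 * (d * d)) \<le> \<tau>" and e: "real (n * d) ^ 2 \<le> real d powr e"
  shows "\<exists>T. streaming_outputs S W \<tau> (stream_init \<gamma> L, stream_update p \<gamma> L, Skip) A T \<and>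
    subspace_embedding p (1 / real d powr e) 1 A T"
proof -
  \<comment> \<open>The row cells are a block with one row at address 0, and \<open>R\<close> plays
    the part of \<open>F\<close> right behind them.\<close>
  interpret layout S W "Suc 0" d 0 d "d + d * d"
    by unfold_locales (use S W d in auto)
  define f where "f = (\<lambda>t x. \<Sum>k<t. (\<Sum>j<d. A $$ (k, j) * x j)\<^sup>2)"
  define J where "J = (\<lambda>t M. \<exists>R. (\<forall>i<d. \<forall>j<d. M (d + (i * d + j)) = R i j) \<and> upper d R \<and>
    (\<forall>x. sq_mass d d R x = f t x / (real (n * d))\<^sup>2))"
  define I where "I = (\<lambda>t (s::state). regs s 0 = n \<and> regs s 2 = d \<and> regs s 3 = d \<and> regs s 7 = n * d \<and>
    env s \<and> J t (mem s))"
  have dW: "d \<le> W" "d * d \<le> W" "1 \<le> W" using S by linarith+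
  show ?thesis
  proof (rule streaming_outputsI[where I = I, OF A], goal_cases)
    case 1
    show ?case using S by linarith
  next
    case 2
    have b: "0 = (if real n powr \<gamma> < real (d * d) then 0 else nat \<lceil>real n powr (\<gamma> / 2)\<rceil>)"
      using large by simp
    have init: "wp S W (stream_init \<gamma> L) (initial_state n d) (\<lambda>t s. t \<le> 100 + 11 * (0 + 1) \<and> mem s = (\<lambda>_. 0) \<and>
      regs s 0 = n \<and> regs s 1 = d \<and> regs s 4 = 0 \<and> regs s 5 = 0 \<and> regs s 10 = d \<and> regs s 11 = d + d * d \<and>
      (if real n powr \<gamma> < real (d * d)
       then regs s 2 = d \<and> regs s 3 = d \<and> regs s 7 = n * d \<and> regs s 8 = 1 \<and> regs s 9 = 0
       else regs s 2 = Suc L * 0 * d \<and> regs s 3 = d))"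
      by (rule wp_stream_init[OF b d]) (use W S in auto)
    show ?case
    proof (rule wp_mono[OF init], elim conjE, goal_cases)
      case (1 t s)
      have "t \<le> 200 + 2400 * (d * d)" using 1(1) by simp
      then have "real t \<le> real (200 + 2400 * (d * d))" by (simp only: of_nat_le_iff)
      then have "real t \<le> \<tau>" using \<tau> by linarith
      moreover have "J 0 (\<lambda>_. 0)"
        unfolding J_def by (intro exI[of _ "\<lambda>_ _. 0"]) (simp add: upper_def sq_mass_def mat_app_def f_def)
      ultimately show ?case using 1 large by (simp add: I_def env_def)
    qed
  next
    case (3 t s)
    let ?s = "receive_row (row A t) s"
    have regs: "regs ?s = regs s" by (simp add: receive_row_def)
    have dimA: "dim_vec (row A t) = d" using A by simp
    have row: "mem ?s j = A $$ (t, j)" if "j < d" for j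
      using that A 3(1) by (simp add: receive_row_def)
    obtain R where R: "\<And>i j. i < d \<Longrightarrow> j < d \<Longrightarrow> mem s (d + (i * d + j)) = R i j" "upper d R"
      "\<And>x. sq_mass d d R x = f t x / (real (n * d))\<^sup>2" using 3(2) by (auto simp: I_def J_def)
    have env: "env ?s" using 3(2) regs by (simp add: I_def env_def)
    have r0: "regs ?s 0 = n" "regs ?s (Suc 0) = d" "regs ?s 7 = n * d" "regs ?s 2 = d" "regs ?s 3 = d"
      using 3(2) by (simp_all add: regs I_def env_def)
    let ?s1 = "?s\<lparr>regs := (regs ?s)(12 := 0)\<rparr>"
    have e1: "env ?s1" using env by (simp add: env_def)
    have "rep (mem ?s) (\<lambda>k j. A $$ (t, j)) R (\<lambda>l. mem ?s (d + d * d + l)) (mem ?s1)"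
      using row R(1) dimA by (auto simp: rep_def receive_row_def)
    note w = wp_insert_row[OF e1 _ _ _ _ _ R(2) this, of 0 "n * d"]
    note test = large_test[OF r0(1,2) W(1) dW(1,2), where \<gamma> = \<gamma>]
    show ?case
      unfolding stream_update_def
    proof (rule wp_Cond, goal_cases)
      case 1
      show ?case by (rule test)
    next
      case 2
      have "wp S W insert_row ?s1 (\<lambda>u s'. real (1 + bcost (large_test \<gamma>) + (2 + u)) \<le> \<tau> \<and> I (Suc t) s')"
      proof (rule wp_mono[OF w], goal_cases)
        case (6 u s')
        then obtain R' U' c where 7: "u \<le> 600 * (ud * ud)" "frame 13 ?s1 s'" "upper d R'"
          "rep (mem ?s) U' R' c (mem s')"
          "\<And>x. sq_mass d d R' x = sq_mass d d R x + (\<Sum>j<d. A $$ (t, j) / real (n * d) * x j)\<^sup>2" by auto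
        have "real (1 + bcost (large_test \<gamma>) + (2 + u)) \<le> real (200 + 2400 * (d * d))"
          unfolding of_nat_le_iff test(3) using 7(1) by (simp add: ud_def)
        then have "real (1 + bcost (large_test \<gamma>) + (2 + u)) \<le> \<tau>" using \<tau> by linarith
        moreover have "sq_mass d d R' x = f (Suc t) x / (real (n * d))\<^sup>2" for x
        proof -
          have "(\<Sum>j<d. A $$ (t, j) / real (n * d) * x j) = (\<Sum>j<d. A $$ (t, j) * x j) / real (n * d)"
            by (simp only: times_divide_eq_left sum_divide_distrib)
          then show ?thesis by (simp only: 7(5) R(3) f_def sum.lessThan_Suc add_divide_distrib power_divide)
        qed
        then have "J (Suc t) (mem s')"
          unfolding J_def using 7(3) rep_get(2)[OF 7(4)] by (intro exI[of _ R']) auto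
        moreover have "env s'" using 7(2) e1 by (simp add: env_def frame_def)
        ultimately show ?case using 7(2) r0 by (simp add: I_def frame_def)
      qed (use r0 n d W in auto)
      then show ?case by (intro wp_Seq wp_ISet) simp_all
    next
      case 3
      then show ?case using test(2) large by simp
    qed
  next
    case 4
    have "real 1 \<le> real (200 + 2400 * (d * d))" by simp
    then show ?case using \<tau> by linarith
  next
    case (5 s)
    define T where "T = mat d d (\<lambda>(i, j). mem s (d + i * d + j))"
    have T: "T \<in> carrier_mat d d" by (simp add: T_def)
    have r: "regs s 2 = d" "regs s 3 = d" using 5 by (auto simp: I_def)
    have res: "result S d s T" unfolding result_def r T_def using S by simp
    obtain R where R: "\<And>i j. i < d \<Longrightarrow> j < d \<Longrightarrow> mem s (d + (i * d + j)) = R i j"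
      "\<And>x. sq_mass d d R x = f n x / (real (n * d))\<^sup>2" using 5 by (auto simp: I_def J_def)
    have "row_sq x (rows T) = row_sq x (rows A) / (real (n * d))\<^sup>2" if x: "x \<in> carrier_vec d" for x
    proof -
      have "row_sq x (rows T) = sq_mass d d R (vec_index x)"
        unfolding row_sq_rows[OF T x] using R(1) by (simp add: sq_mass_def mat_app_def T_def add.assoc)
      moreover have "row_sq x (rows A) = f n (vec_index x)"
        unfolding row_sq_rows[OF A x] by (simp add: sq_mass_def mat_app_def f_def)
      ultimately show ?thesis using R(2) by simp
    qed
    then have "subspace_embedding p (1 / real d powr e) 1 A T"
      by (intro subspace_embedding_of_sq[OF p d n A T _ e])
    then show ?case using res by blast
  qed
qed

theorem streaming_algorithm:
  assumes p: "1 \<le> p" and \<gamma>: "0 < \<gamma>" "\<gamma> < 1" and d: "1 \<le> d" "real d \<le> real n powr \<gamma>"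
    and L: "L = nat \<lceil>2 / \<gamma>\<rceil>" and C: "1000000 * real (Suc L) \<le> C" "C \<le> 2 ^ k" "Suc L \<le> k + 2"
    and A: "A \<in> carrier_mat n d"
  shows "\<exists>T. streaming_outputs (space_bound C \<gamma> n d) (word_bound (k + 2) n d) (time_bound C \<gamma> n d)
      (stream_init \<gamma> L, stream_update p \<gamma> L, Skip) A T \<and>
    subspace_embedding p (1 / real d powr (12 / \<gamma>)) 1 A T"
proof -
  note par = parameters[OF \<gamma> d]
  define N where "N = real n powr \<gamma>"
  define S where "S = space_bound C \<gamma> n d"
  define W where "W = word_bound (k + 2) n d"
  define \<tau> where "\<tau> = time_bound C \<gamma> n d"
  have N: "1 \<le> N" "real d \<le> N" using par d by (simp_all add: N_def)
  have C1: "1000000 \<le> C" using C(1) by simp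
  then have k: "(4::real) \<le> 2 ^ k" using C(2) by linarith
  note Wf = word_bound_facts[OF par(1) d(1) k, folded W_def]
  have SW: "S \<le> W" unfolding S_def W_def using space_bound_le_word_bound[OF \<gamma> d _ C(2)] C1 by simp
  have nd: "2 \<le> n + d" using par(1) d(1) by simp
  have LW: "Suc L \<le> W"
  proof -
    have "Suc L \<le> 2 ^ (k + 2)" using C(3) less_exp[of "k + 2"] by linarith
    also have "\<dots> \<le> (n + d) ^ (k + 2)" using nd by (intro power_mono) auto
    finally show ?thesis by (simp add: W_def word_bound_def)
  qed
  have Nd: "1 \<le> N * real d" "real d \<le> N * real d" "real d * real d \<le> N * real d"
  proof -
    have "1 * 1 \<le> N * real d" "1 * real d \<le> N * real d" using N d by (intro mult_mono; simp)+
    then show "1 \<le> N * real d" "real d \<le> N * real d" by simp_all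
    show "real d * real d \<le> N * real d" using N by (intro mult_right_mono) auto
  qed
  have Nd4: "1 \<le> real d ^ 4" "N \<le> N * real d ^ 4"
  proof -
    show "1 \<le> real d ^ 4" using d by (intro one_le_power) simp
    then show "N \<le> N * real d ^ 4" using N by simp
  qed
  have \<tau>: "C / 2 * (N * real d ^ 4) \<le> \<tau>"
    using time_bound_ge[OF d, of "C / 2"] C1 by (simp add: N_def \<tau>_def)
  have \<tau>1: "500000 * (N * real d ^ 4) \<le> \<tau>"
    by (rule order_trans[OF mult_right_mono \<tau>]) (use C1 N in auto)
  show ?thesis
    unfolding S_def[symmetric] W_def[symmetric] \<tau>_def[symmetric]
  proof (cases "real n powr \<gamma> < real (d * d)")
    case True
    show "\<exists>T. streaming_outputs S W \<tau> (stream_init \<gamma> L, stream_update p \<gamma> L, Skip) A T \<and>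
        subspace_embedding p (1 / real d powr (12 / \<gamma>)) 1 A T"
    proof (rule streaming_large[OF p d(1) A par(1) True _ SW Wf(1,3,4) LW _ large_dimension[OF \<gamma> d True]])
      have "real (d + d * d + d + 2) \<le> 5 * (N * real d)" using Nd by simp
      also have "\<dots> \<le> C * (N * real d)" using C1 Nd by (intro mult_right_mono) auto
      finally show "d + d * d + d + 2 \<le> S" unfolding S_def by (intro space_bound_ge) (simp add: N_def)
      have "real d * real d \<le> N * real d ^ 4"
      proof -
        have "real d * real d \<le> N * real d" by (rule Nd)
        also have "\<dots> \<le> N * real d ^ 4" using N d self_le_power[of "real d" 4] by (intro mult_left_mono) auto
        finally show ?thesis .
      qed
      moreover have "real (200 + 2400 * (d * d)) = 200 + 2400 * (real d * real d)" by simp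
      ultimately have "real (200 + 2400 * (d * d)) \<le> 500000 * (N * real d ^ 4)"
        using Nd4(2) N(1) by linarith
      then show "real (200 + 2400 * (d * d)) \<le> \<tau>" using \<tau>1 by linarith
    qed
  next
    case False
    define b where "b = nat \<lceil>real n powr (\<gamma> / 2)\<rceil>"
    note half = nat_ceiling_powr_half[OF par(2), folded b_def]
    have bd: "real b * real d \<le> 2 * N"
      using ceiling_times_dim_le[OF par(2) False] by (simp add: b_def N_def)
    have pos: "0 < real n powr (\<gamma> / 2)" using par(1) by simp
    then have b1: "1 \<le> b" using half(1) by linarith
    have le: "real n powr (\<gamma> / 2) \<le> real n powr \<gamma>" using par(1) \<gamma> by (intro powr_mono) auto
    have "real n powr (\<gamma> / 2) \<le> real n" using le par(3) by linarith
    then have "b \<le> n" unfolding b_def by linarith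
    then have "b ^ Suc L \<le> (n + d) ^ Suc L" by (intro power_mono) auto
    also have "\<dots> \<le> (n + d) ^ (k + 2)" using nd C(3) by (intro power_increasing) auto
    finally have bW: "b ^ Suc L \<le> W" by (simp add: W_def word_bound_def)
    have "2 / \<gamma> > 1" using \<gamma> by (simp add: field_simps)
    then have L1: "1 \<le> L" unfolding L by linarith
    have space: "d + Suc L * b * d * d + d * d + d + 2 \<le> S"
    proof -
      have "real (d + Suc L * b * d * d + d * d + d + 2) =
          real d + real (Suc L) * ((real b * real d) * real d) + real d * real d + real d + 2"
        by (simp only: of_nat_add of_nat_mult of_nat_numeral mult.assoc)
      also have "\<dots> \<le> N * real d + real (Suc L) * ((2 * N) * real d) + N * real d + N * real d + 2 * (N * real d)"
      proof -
        have "real (Suc L) * ((real b * real d) * real d) \<le> real (Suc L) * ((2 * N) * real d)"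
          using bd by (intro mult_left_mono mult_right_mono) auto
        then show ?thesis using Nd by linarith
      qed
      also have "\<dots> = (5 + 2 * real (Suc L)) * (N * real d)" by (simp add: algebra_simps)
      also have "\<dots> \<le> C * (N * real d)" using C(1) Nd by (intro mult_right_mono) auto
      finally show ?thesis unfolding S_def by (intro space_bound_ge) (simp add: N_def)
    qed
    have buf: "buffer p b d L S W"
      using p b1 d L1 space SW Wf(4) bW LW by unfold_locales auto
    show "\<exists>T. streaming_outputs S W \<tau> (stream_init \<gamma> L, stream_update p \<gamma> L, Skip) A T \<and>
        subspace_embedding p (1 / real d powr (12 / \<gamma>)) 1 A T"
    proof (rule streaming_small[OF buf A False b_def _ Wf(1,3)])
      show "n \<le> b ^ L" unfolding L by (rule le_ceiling_power[OF \<gamma>(1) par(1) half(1)])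
      have "real b \<le> 2 * N" using half(2) le by (simp add: N_def)
      moreover have "real (100 + 11 * (b + 1)) = 111 + 11 * real b" by simp
      ultimately have "real (100 + 11 * (b + 1)) \<le> 500000 * (N * real d ^ 4)"
        using Nd4(2) N(1) by linarith
      then show "real (100 + 11 * (b + 1)) \<le> \<tau>" using \<tau>1 by linarith
      have "real b * real d + 2 * real d \<le> 4 * N" using bd N by linarith
      then have "real (Suc L) * (16 * real d ^ 4 * (real b * real d + 2 * real d))
          \<le> real (Suc L) * (16 * real d ^ 4 * (4 * N))"
        by (intro mult_left_mono) auto
      then have "real (20 + 5000 * (Suc L * ((2 * d) ^ 4 * (b * d + 2 * d)))) \<le>
          20 + 5000 * (real (Suc L) * (16 * real d ^ 4 * (4 * N)))"
        by (simp only: of_nat_add of_nat_mult of_nat_numeral of_nat_power power_mult_distrib) simp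
      also have "\<dots> \<le> 500000 * real (Suc L) * (N * real d ^ 4)"
      proof -
        have "1 \<le> N * real d ^ 4" using Nd4(2) N(1) by linarith
        then have "1 * 1 \<le> real (Suc L) * (N * real d ^ 4)" by (intro mult_mono) auto
        \<comment> \<open>The 320000 together with the 20 stays below 500000, half of the 1000000
          demanded of \<open>C\<close>; the factor 2 is again that of
          \<open>time_bound_ge\<close>.\<close>
        moreover have "5000 * (real (Suc L) * (16 * real d ^ 4 * (4 * N))) = 320000 * (real (Suc L) * (N * real d ^ 4))"
          by simp
        ultimately show ?thesis by (simp only: mult.assoc)
      qed
      also have "\<dots> \<le> C / 2 * (N * real d ^ 4)" using C(1) N by (intro mult_right_mono) auto
      finally show "real (20 + 5000 * (Suc L * ((2 * d) ^ 4 * (b * d + 2 * d)))) \<le> \<tau>"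
        using \<tau> by linarith
      have "real L \<le> 2 / \<gamma> + 1" unfolding L using \<gamma> by simp
      also have "\<dots> \<le> 4 / \<gamma>" using \<gamma> by (simp add: field_simps)
      finally show "3 * real L \<le> 12 / \<gamma>" by simp
    qed
  qed
qed

theorem theorem3:
  fixes p :: real
  assumes "1 \<le> p" and "p \<noteq> 2"
  shows "\<exists>K > 0. \<forall>\<gamma>. 0 < \<gamma> \<and> \<gamma> < 1 \<longrightarrow> (\<exists>C > 0. \<exists>k :: nat.
    (\<exists>P :: streaming_alg. \<forall>n d. \<forall>A \<in> carrier_mat n d.
       1 \<le> d \<and> real d \<le> real n powr \<gamma> \<longrightarrow>
       (\<exists>T. streaming_outputs (space_bound C \<gamma> n d) (word_bound k n d) (time_bound C \<gamma> n d) P A T \<and>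
            subspace_embedding p (1 / real d powr (K / \<gamma>)) 1 A T)) \<and>
    (\<exists>Q :: distributed_alg. \<forall>n d bs.
       1 \<le> d \<and> real d \<le> real n powr \<gamma> \<and> block_partition n (real n powr \<gamma>) bs \<longrightarrow>
       (\<exists>t. computation_tree bs t \<and>
          (\<forall>A \<in> carrier_mat n d.
             \<exists>T. distributed_outputs (space_bound C \<gamma> n d) (word_bound k n d) (time_bound C \<gamma> n d)
                   Q bs A t T \<and>
                 subspace_embedding p (1 / real d powr (K / \<gamma>)) 1 A T))))"
proof (rule exI[of _ 12], intro conjI allI impI, goal_cases)
  case 1
  show ?case by simp
next
  case (2 \<gamma>)
  then have \<gamma>: "0 < \<gamma>" "\<gamma> < 1" by auto
  define L where "L = nat \<lceil>2 / \<gamma>\<rceil>"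
  \<comment> \<open>One number serves as \<open>C\<close> and, by \<open>c \<le> 2 ^ c\<close>, also
    fixes the exponent of the word bound. It depends on \<open>\<gamma>\<close> only, through
    \<open>L\<close>.\<close>
  define c where "c = 1000000 * Suc L"
  have C: "1000000 * real (Suc L) \<le> real c" "real c \<le> 2 ^ c" "Suc L \<le> c + 2" "400000 \<le> real c"
    using of_nat_less_two_power[of c, where 'a = real] by (simp_all add: c_def)
  show ?case
  proof (rule exI[of _ "real c"], intro conjI exI[of _ "c + 2"], goal_cases)
    case 1
    show ?case by (simp add: c_def)
  next
    case 2
    show ?case
      using streaming_algorithm[OF assms(1) \<gamma> _ _ L_def C(1-3)]
      by (intro exI[of _ "(stream_init \<gamma> L, stream_update p \<gamma> L, Skip)"] allI ballI impI) auto
  next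
    case 3
    show ?case
      using distributed_algorithm[OF assms(1) \<gamma> _ _ C(4,2)]
      by (intro exI[of _ "(node_com p \<gamma> (IMul (IReg 0) (IReg 1)), node_com p \<gamma> (IConst 1))"] allI impI) auto
  qed
qed

end
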